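(* Let $n\in\{2,3\}$ and $k>0$. Let $V=\chi_P\varphi$ and $V'=\chi_{P'}\varphi'$ be two non-constant admissible potentials (in the sense recalled in the context). Let $u^i$ be an entire solution of $(\Delta+k^2)u^i=0$ in $\mathbb{R}^n$, and let $u,u'\in H^1_{loc}(\mathbb{R}^n)$ be the total waves solving the scattering problem with potential $V$, respectively $V'$, and incident wave $u^i$. Assume that at each vertex $x_c$ of $P$ or of $P'$ one has $u(x_c)\neq 0$ or $u'(x_c)\neq 0$. Assume that $A_{u^i}=A'_{u^i}$, where $A_{u^i}$ and $A'_{u^i}$ are the far-field patterns arising from $V$ and $V'$ respectively. Then $P=P'$ and $\varphi(x_c)=\varphi'(x_c)$ at each vertex $x_c$ of $P=P'$.
   Context: Scattering problem: for $V\in L^\infty(\mathbb{R}^n)$ complex-valued with compact support and $u^i$ an entire solution of $(\Delta+k^2)u^i=0$, the total wave $u\in H^1_{loc}(\mathbb{R}^n)$ solves $(\Delta+k^2(1+V))u=0$ in $\mathbb{R}^n$ and the scattered wave $u^s=u-u^i$ satisfies the Sommerfeld radiation condition $\lim_{r=|x|\to\infty}|x|^{(n-1)/2}(\partial_r-ik)(u-u^i)=0$ uniformly in $\hat x=x/|x|$. The far-field pattern $A_{u^i}:\mathbb{S}^{n-1}\to\mathbb{C}$ is defined by $u(r\hat x)=u^i(r\hat x)+\frac{e^{ikr}}{r^{(n-1)/2}}A_{u^i}(\hat x)+\mathcal{O}(r^{-n/2})$ as $r\to\infty$, uniformly in $\hat x$. The total wave is continuous (it lies in $H^2_{loc}$),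 so its point values are defined. An admissible cell is a bounded open convex polytope in $\mathbb{R}^n$ (a polygon in 2D, a polyhedron in 3D). A potential $V\in L^\infty(\mathbb{R}^n)$ is a non-constant admissible potential if there are an admissible cell $P\subset\mathbb{R}^n$ and a bounded function $\varphi\in L^\infty(\mathbb{R}^n)$ with $V=\chi_P\varphi$, such that $\varphi$ is Hölder $C^\alpha$-continuous in a neighbourhood of each vertex of $P$, with $\alpha>0$ in 2D and $\alpha>1/4$ in 3D, and $\varphi$ does not vanish at any vertex of $P$. *)

theory Defs
  imports "HOL-Analysis.Analysis"
begin

definition pd :: "'n::finite \<Rightarrow> (real^'n \<Rightarrow> complex) \<Rightarrow> real^'n \<Rightarrow> complex" where
  "pd i f x = vector_derivative (\<lambda>t. f (x + t *\<^sub>R axis i 1)) (at 0)"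

definition iter_pd :: "'n::finite list \<Rightarrow> (real^'n \<Rightarrow> complex) \<Rightarrow> real^'n \<Rightarrow> complex" where
  "iter_pd is f = fold pd is f"

definition smooth_fun :: "(real^'n::finite \<Rightarrow> complex) \<Rightarrow> bool" where
  "smooth_fun f \<longleftrightarrow>
     (\<forall>is. continuous_on UNIV (iter_pd is f) \<and>
        (\<forall>i x. (\<lambda>t. iter_pd is f (x + t *\<^sub>R axis i 1)) differentiable (at 0)))"

definition test_fun :: "(real^'n::finite \<Rightarrow> complex) \<Rightarrow> bool" where
  "test_fun f \<longleftrightarrow> smooth_fun f \<and> bounded {x. f x \<noteq> 0}"

definition laplacian :: "(real^'n::finite \<Rightarrow> complex) \<Rightarrow> real^'n \<Rightarrow> complex" where
  "laplacian f x = (\<Sum>i\<in>UNIV. pd i (pd i f) x)"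

definition L2_loc :: "(real^'n::finite \<Rightarrow> complex) \<Rightarrow> bool" where
  "L2_loc u \<longleftrightarrow> u \<in> borel_measurable lebesgue \<and>
     (\<forall>K. compact K \<longrightarrow> set_integrable lebesgue K (\<lambda>x. (cmod (u x))\<^sup>2))"

definition weak_pd :: "'n::finite \<Rightarrow> (real^'n \<Rightarrow> complex) \<Rightarrow> (real^'n \<Rightarrow> complex) \<Rightarrow> bool" where
  "weak_pd i u g \<longleftrightarrow>
     (\<forall>\<psi>. test_fun \<psi> \<longrightarrow>
        (LINT x|lebesgue. u x * pd i \<psi> x) = - (LINT x|lebesgue. g x * \<psi> x))"

definition H1_loc :: "(real^'n::finite \<Rightarrow> complex) \<Rightarrow> bool" where
  "H1_loc u \<longleftrightarrow> L2_loc u \<and> (\<forall>i. \<exists>g. L2_loc g \<and> weak_pd i u g)"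

definition entire_helmholtz :: "real \<Rightarrow> (real^'n::finite \<Rightarrow> complex) \<Rightarrow> bool" where
  "entire_helmholtz k w \<longleftrightarrow> smooth_fun w \<and>
     (\<forall>x. laplacian w x + complex_of_real (k\<^sup>2) * w x = 0)"

definition radial_deriv :: "(real^'n::finite \<Rightarrow> complex) \<Rightarrow> real^'n \<Rightarrow> complex" where
  "radial_deriv w x = vector_derivative (\<lambda>t. w (t *\<^sub>R sgn x)) (at (norm x))"

definition sommerfeld :: "real \<Rightarrow> (real^'n::finite \<Rightarrow> complex) \<Rightarrow> bool" where
  "sommerfeld k w \<longleftrightarrow>
     (\<forall>\<epsilon>>0. \<exists>R. \<forall>x::real^'n. norm x \<ge> R \<longrightarrow>
        (\<lambda>t. w (t *\<^sub>R sgn x)) differentiable (at (norm x)) \<and>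
        norm x powr ((real CARD('n) - 1) / 2) *
          cmod (radial_deriv w x - \<i> * complex_of_real k * w x) < \<epsilon>)"

text \<open>u is a total wave for potential V, wave number k and incident wave ui:
  u (the continuous representative) lies in H^1_loc, solves
  (Delta + k^2 (1+V)) u = 0 in the distributional sense, and u - ui is radiating.\<close>
definition total_wave ::
  "real \<Rightarrow> (real^'n::finite \<Rightarrow> complex) \<Rightarrow> (real^'n \<Rightarrow> complex) \<Rightarrow> (real^'n \<Rightarrow> complex) \<Rightarrow> bool" where
  "total_wave k V ui u \<longleftrightarrow>
     continuous_on UNIV u \<and> H1_loc u \<and>
     (\<forall>\<psi>. test_fun \<psi> \<longrightarrow>
        (LINT x|lebesgue. u x * (laplacian \<psi> x
            + complex_of_real (k\<^sup>2) * (1 + V x) * \<psi> x)) = 0) \<and>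
     sommerfeld k (\<lambda>x. u x - ui x)"

definition far_field :: "real \<Rightarrow> (real^'n::finite \<Rightarrow> complex) \<Rightarrow> (real^'n \<Rightarrow> complex) \<Rightarrow> (real^'n \<Rightarrow> complex) \<Rightarrow> bool" where
  "far_field k ui u A \<longleftrightarrow>
     (\<exists>C R. \<forall>r\<ge>R. \<forall>xh::real^'n. norm xh = 1 \<longrightarrow>
        cmod (u (r *\<^sub>R xh) - ui (r *\<^sub>R xh)
              - exp (\<i> * complex_of_real (k * r)) / complex_of_real (r powr ((real CARD('n) - 1) / 2)) * A xh)
        \<le> C * r powr (- (real CARD('n) / 2)))"

definition admissible_cell :: "(real^'n::finite) set \<Rightarrow> bool" where
  "admissible_cell P \<longleftrightarrow> P \<noteq> {} \<and> (\<exists>S. finite S \<and> P = interior (convex hull S))"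

definition vertices :: "(real^'n::finite) set \<Rightarrow> (real^'n) set" where
  "vertices P = {v. v extreme_point_of (closure P)}"

definition potential :: "(real^'n::finite) set \<Rightarrow> (real^'n \<Rightarrow> complex) \<Rightarrow> real^'n \<Rightarrow> complex" where
  "potential P \<phi> x = indicator P x * \<phi> x"

definition admissible_potential :: "(real^'n::finite) set \<Rightarrow> (real^'n \<Rightarrow> complex) \<Rightarrow> bool" where
  "admissible_potential P \<phi> \<longleftrightarrow>
     admissible_cell P \<and>
     \<phi> \<in> borel_measurable lebesgue \<and> (\<exists>B. AE x in lebesgue. cmod (\<phi> x) \<le> B) \<and>
     (\<exists>\<alpha>>0. (CARD('n) = 3 \<longrightarrow> \<alpha> > 1/4) \<and>
        (\<forall>v\<in>vertices P. \<exists>\<delta>>0. \<exists>C. \<forall>x\<in>ball v \<delta>. \<forall>y\<in>ball v \<delta>.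
            cmod (\<phi> x - \<phi> y) \<le> C * dist x y powr \<alpha>)) \<and>
     (\<forall>v\<in>vertices P. \<phi> v \<noteq> 0)"

end

(* The difference w = u - u' of the two total waves is continuous, solves the inhomogeneous equation
   (Delta + k^2) w = -k^2 (V u - V' u') in the weak sense, and is O(|x|^(-n/2)) because the far fields agree.

   Rellich's theorem, applied to mollifications of w and to all balls containing the convex hull Q of the two
   cells, gives w = 0 off Q. It is proved by Kato's energy method: spherical means of w and of its derivatives
   satisfy ordinary differential inequalities in r that force w to vanish, without Bessel functions or
   spherical harmonics.

   Let v be an extreme point of Q that is a vertex of P. Near v the set P is a convex cone K, w vanishes off a
   pointed cone, and Delta w = f where f - F0 chi_K tends to 0 at v. Test this with a cut-off of
   g(x + eps e) - g(x + 2 eps e), where g is an axial derivative of the fundamental solution and e points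
   into K. The left side is O(eps), while the integral over K is of order -eps log(1/eps), since it reduces to
   g over the layer between K and K + eps e. The contributions of f - F0 chi_K are o(eps log(1/eps)). Hence
   F0 = 0. In the case at hand F0 is -k^2 (phi u - phi' u')(v), or -k^2 (phi u)(v) if v is not in the closure
   of P'; as w(v) = 0, the latter contradicts the nonvanishing of u or u' at v. So every extreme point of Q
   lies in both closures, both closures equal Q, and phi = phi' at the vertices. *)
theory Submission
  imports Defs "HOL-Computational_Algebra.Polynomial"
begin

section \<open>Smooth real functions as test functions\<close>

text \<open>At a vertex only continuity of the source is used, and \<open>w\<close> itself is never
  differentiated: it is continuous, vanishes off a pointed cone, and all derivatives fall on an
  explicit kernel. That kernel must be singular enough to feel the cone. Since \<open>g\<close> is
  homogeneous of degree -(n-1), the difference of two shifts decays like eps |z|^(-n), so every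
  scale between eps and 1 contributes the same amount to the integral over K; the logarithm counts
  the scales. As e points into the support cone, the poles of the shifted kernels lie off it. Test
  functions have to be smooth everywhere, so the poles are smoothed at a scale
  \<open>\<delta>\<close> = eps^(n+4), whose effect on the Laplacian is O(eps). Rellich's theorem
  for balls spreads to the complement of Q because a point off a compact convex set is off some ball
  containing that set. In Kato's method the weight exponent m is raised step by step: decay at one
  exponent makes the energy nonpositive, which yields decay at the next one, and for large m a
  nonpositive energy leaves no room for a nonzero solution. Complex functions become real ones by
  multiplication with a conjugate value and passage to real parts.\<close>

text \<open>Differentiability is expressed by gradients, which makes the closure properties provable by induction on
  the order; \<open>smooth_fun_of_real\<close> leads back to iterated partial derivatives.\<close>

primrec Ck :: "nat \<Rightarrow> (real^'n::finite \<Rightarrow> real) \<Rightarrow> bool" where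
  "Ck 0 f = continuous_on UNIV f"
| "Ck (Suc m) f = (\<exists>g. (\<forall>x. (f has_derivative (\<lambda>v. g x \<bullet> v)) (at x)) \<and> (\<forall>i. Ck m (\<lambda>x. g x $ i)))"

lemma Ck_SucI:
  assumes "\<And>x. (f has_derivative (\<lambda>v. g x \<bullet> v)) (at x)" "\<And>i. Ck m (\<lambda>x. g x $ i)"
  shows "Ck (Suc m) f"
  using assms by auto

lemma Ck_continuous: "Ck m f \<Longrightarrow> continuous_on UNIV f"
proof (cases m)
  case (Suc j)
  assume "Ck m f"
  then obtain g where "\<And>x. (f has_derivative (\<lambda>v. g x \<bullet> v)) (at x)" using Suc by auto
  then show ?thesis
    by (meson continuous_at_imp_continuous_on has_derivative_continuous)
qed auto

lemma Ck_decrease: "Ck (Suc m) f \<Longrightarrow> Ck m f"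
proof (induction m arbitrary: f)
  case 0
  then show ?case using Ck_continuous by fastforce
next
  case (Suc m)
  then obtain g where "\<And>x. (f has_derivative (\<lambda>v. g x \<bullet> v)) (at x)" "\<And>i. Ck (Suc m) (\<lambda>x. g x $ i)"
    by auto
  with Suc.IH show ?case by (intro Ck_SucI) auto
qed

lemma Ck_const: "Ck m (\<lambda>x. c)"
proof (induction m arbitrary: c)
  case (Suc m)
  show ?case
    by (rule Ck_SucI[where g = "\<lambda>x. 0"]) (auto simp: Suc)
qed auto

lemma Ck_affine: "Ck m (\<lambda>x. a \<bullet> x + b)"
proof (cases m)
  case 0
  then show ?thesis by (auto intro!: continuous_intros)
next
  case (Suc j)
  show ?thesis unfolding Suc
    by (rule Ck_SucI[where g = "\<lambda>x. a"]) (auto intro!: derivative_eq_intros Ck_const)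
qed

lemma Ck_add: "Ck m f \<Longrightarrow> Ck m g \<Longrightarrow> Ck m (\<lambda>x. f x + g x)"
proof (induction m arbitrary: f g)
  case 0
  then show ?case by (auto intro!: continuous_intros)
next
  case (Suc m)
  then obtain f' g' where
    "\<And>x. (f has_derivative (\<lambda>v. f' x \<bullet> v)) (at x)" "\<And>i. Ck m (\<lambda>x. f' x $ i)"
    "\<And>x. (g has_derivative (\<lambda>v. g' x \<bullet> v)) (at x)" "\<And>i. Ck m (\<lambda>x. g' x $ i)"
    by auto
  then show ?case
    by (intro Ck_SucI[where g = "\<lambda>x. f' x + g' x"])
       (auto intro!: derivative_eq_intros Suc.IH simp: inner_add_left)
qed

lemma Ck_mult: "Ck m f \<Longrightarrow> Ck m g \<Longrightarrow> Ck m (\<lambda>x. f x * g x)"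
proof (induction m arbitrary: f g)
  case 0
  then show ?case by (auto intro!: continuous_intros)
next
  case (Suc m)
  then obtain f' g' where D:
    "\<And>x. (f has_derivative (\<lambda>v. f' x \<bullet> v)) (at x)" "\<And>i. Ck m (\<lambda>x. f' x $ i)"
    "\<And>x. (g has_derivative (\<lambda>v. g' x \<bullet> v)) (at x)" "\<And>i. Ck m (\<lambda>x. g' x $ i)"
    by auto
  have "Ck m f" "Ck m g" using Suc.prems Ck_decrease by auto
  with D show ?case
    by (intro Ck_SucI[where g = "\<lambda>x. g x *\<^sub>R f' x + f x *\<^sub>R g' x"])
       (auto intro!: derivative_eq_intros Suc.IH Ck_add simp: inner_add_left algebra_simps)
qed

lemma Ck_uminus: "Ck m f \<Longrightarrow> Ck m (\<lambda>x. - f x)"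
  using Ck_mult[OF Ck_const[of m "-1"]] by simp

lemma Ck_diff: "Ck m f \<Longrightarrow> Ck m g \<Longrightarrow> Ck m (\<lambda>x. f x - g x)"
  using Ck_add[OF _ Ck_uminus] by simp

lemma Ck_sum: "finite I \<Longrightarrow> (\<And>i. i \<in> I \<Longrightarrow> Ck m (f i)) \<Longrightarrow> Ck m (\<lambda>x. \<Sum>i\<in>I. f i x)"
  by (induction I rule: finite_induct) (auto intro: Ck_const Ck_add)

lemma Ck_component: "Ck m (\<lambda>x. x $ i)"
  using Ck_affine[of m "axis i 1" 0] by (simp add: inner_axis')

lemma Ck_dist_sq: "Ck m (\<lambda>x. (x - a) \<bullet> (x - a))"
proof -
  have "Ck m (\<lambda>x. \<Sum>i\<in>UNIV. (x $ i - a $ i) * (x $ i - a $ i))"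
    by (intro Ck_sum Ck_mult Ck_diff Ck_component Ck_const) auto
  then show ?thesis by (simp add: inner_vec_def)
qed

text \<open>The chain rule turns \<open>b j\<close> into \<open>b (Suc j)\<close>, so the whole
  sequence of derivatives is carried along and \<open>j\<close> is generalized in the
  induction.\<close>

lemma Ck_compose:
  assumes b: "\<And>j t. (b j has_real_derivative b (Suc j) t) (at t)" and f: "\<And>m. Ck m f"
  shows "Ck m (\<lambda>x. b j (f x))"
proof (induction m arbitrary: j)
  case 0
  have "continuous_on UNIV (b j)"
    by (meson DERIV_isCont b continuous_at_imp_continuous_on)
  with Ck_continuous[OF f[of 0]] show ?case
    by (auto intro: continuous_on_compose2)
next
  case (Suc m)
  obtain f' where D: "\<And>x. (f has_derivative (\<lambda>v. f' x \<bullet> v)) (at x)" "\<And>i. Ck m (\<lambda>x. f' x $ i)"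
    using f[of "Suc m"] by auto
  have "((\<lambda>x. b j (f x)) has_derivative (\<lambda>v. b (Suc j) (f x) * (f' x \<bullet> v))) (at x)" for x
    using has_derivative_compose[OF D(1) has_field_derivative_imp_has_derivative[OF b]] by auto
  then show ?case
    by (intro Ck_SucI[where g = "\<lambda>x. b (Suc j) (f x) *\<^sub>R f' x"]) (auto intro!: Ck_mult Suc D)
qed

text \<open>Differentiation lowers the exponent by 1, so the family over all \<open>a\<close> is
  closed and the induction generalizes \<open>a\<close>.\<close>

lemma Ck_powr:
  assumes f: "\<And>m. Ck m f" and pos: "\<And>x. f x > 0"
  shows "Ck m (\<lambda>x. f x powr a)"
proof (induction m arbitrary: a)
  case 0
  show ?case using Ck_continuous[OF f[of 0]] pos
    by (auto intro!: continuous_intros simp: less_imp_neq[symmetric])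
next
  case (Suc m)
  obtain f' where D: "\<And>x. (f has_derivative (\<lambda>v. f' x \<bullet> v)) (at x)" "\<And>i. Ck m (\<lambda>x. f' x $ i)"
    using f[of "Suc m"] by auto
  have "((\<lambda>x. f x powr a) has_derivative (\<lambda>v. (a * f x powr (a - 1)) * (f' x \<bullet> v))) (at x)" for x
    using has_derivative_compose[OF D(1) has_field_derivative_imp_has_derivative[OF
        has_real_derivative_powr[OF pos]]] by auto
  then show ?case
    by (intro Ck_SucI[where g = "\<lambda>x. (a * f x powr (a - 1)) *\<^sub>R f' x"])
       (auto intro!: Ck_mult Suc D Ck_const)
qed

definition smooth :: "(real^'n::finite \<Rightarrow> real) \<Rightarrow> bool" where
  "smooth f \<longleftrightarrow> (\<forall>m. Ck m f)"

lemma smoothI: "(\<And>m. Ck m f) \<Longrightarrow> smooth f" by (simp add: smooth_def)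

lemma gradient_unique:
  fixes f :: "real^'n::finite \<Rightarrow> real"
  assumes "(f has_derivative (\<lambda>v. g \<bullet> v)) (at x)" "(f has_derivative (\<lambda>v. h \<bullet> v)) (at x)"
  shows "g = h"
  using has_derivative_unique[OF assms] by (metis vector_eq_rdot)

text \<open>Each order of \<open>Ck\<close> supplies a gradient of its own; uniqueness of the
  derivative identifies all of them with the given \<open>g\<close>.\<close>

lemma smooth_gradient:
  assumes "smooth f" "\<And>x. (f has_derivative (\<lambda>v. g x \<bullet> v)) (at x)"
  shows "smooth (\<lambda>x. g x $ i)"
  unfolding smooth_def
proof
  fix m
  obtain h where h: "\<And>x. (f has_derivative (\<lambda>v. h x \<bullet> v)) (at x)" "Ck m (\<lambda>x. h x $ i)"
    using assms(1) unfolding smooth_def by (metis Ck.simps(2))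
  with assms(2) have "h = g" using gradient_unique by blast
  with h show "Ck m (\<lambda>x. g x $ i)" by simp
qed

lemma smooth_has_gradient:
  assumes "smooth f"
  obtains g where "\<And>x. (f has_derivative (\<lambda>v. g x \<bullet> v)) (at x)"
  using assms unfolding smooth_def by (metis Ck.simps(2))

lemma line_vector_derivative:
  fixes f :: "real^'n::finite \<Rightarrow> real"
  assumes "(f has_derivative (\<lambda>v. g \<bullet> v)) (at x)"
  shows "((\<lambda>t. complex_of_real (f (x + t *\<^sub>R axis i 1))) has_vector_derivative of_real (g $ i)) (at 0)"
proof -
  have "((\<lambda>t. x + t *\<^sub>R axis i 1) has_derivative (\<lambda>t. t *\<^sub>R axis i 1)) (at 0)"
    by (auto intro!: derivative_eq_intros)
  moreover have "(f has_derivative (\<lambda>v. g \<bullet> v)) (at (x + 0 *\<^sub>R axis i 1))" using assms by simp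
  ultimately have "((\<lambda>t. f (x + t *\<^sub>R axis i 1)) has_derivative (\<lambda>t. g \<bullet> (t *\<^sub>R axis i 1))) (at 0)"
    by (rule has_derivative_compose)
  then have "((\<lambda>t. complex_of_real (f (x + t *\<^sub>R axis i 1))) has_derivative (\<lambda>t. of_real (g \<bullet> (t *\<^sub>R axis i 1)))) (at 0)"
    by (rule has_derivative_of_real)
  moreover have "complex_of_real (g \<bullet> (t *\<^sub>R axis i 1)) = t *\<^sub>R of_real (g $ i)" for t
    by (simp only: inner_scaleR_right inner_axis) (simp add: scaleR_conv_of_real)
  ultimately show ?thesis
    by (simp only: has_vector_derivative_def)
qed

lemma pd_of_real:
  assumes "(f has_derivative (\<lambda>v. g \<bullet> v)) (at x)"
  shows "pd i (\<lambda>x. complex_of_real (f x)) x = of_real (g $ i)"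
  unfolding pd_def using line_vector_derivative[OF assms] by (rule vector_derivative_at)

text \<open>\<open>fold\<close> differentiates by the head of the list first, so the induction
  replaces \<open>f\<close> by one of its partial derivatives, again smooth and real.\<close>

lemma smooth_iter_pd:
  "smooth f \<Longrightarrow> \<exists>h. smooth h \<and> iter_pd is (\<lambda>x. complex_of_real (f x)) = (\<lambda>x. of_real (h x))"
proof (induction "is" arbitrary: f)
  case Nil
  then show ?case by (auto simp: iter_pd_def)
next
  case (Cons i "is")
  obtain g where g: "\<And>x. (f has_derivative (\<lambda>v. g x \<bullet> v)) (at x)"
    using smooth_has_gradient[OF Cons.prems] by blast
  have "pd i (\<lambda>x. complex_of_real (f x)) = (\<lambda>x. of_real (g x $ i))"
    using pd_of_real[OF g] by blast
  with Cons.IH[OF smooth_gradient[OF Cons.prems g, of i]] show ?case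
    by (simp add: iter_pd_def)
qed

lemma smooth_fun_of_real:
  assumes "smooth f" shows "smooth_fun (\<lambda>x. complex_of_real (f x))"
  unfolding smooth_fun_def
proof (intro allI conjI)
  fix "is" :: "'a list" and i :: 'a and x
  obtain h where h: "smooth h" "iter_pd is (\<lambda>x. complex_of_real (f x)) = (\<lambda>x. of_real (h x))"
    using smooth_iter_pd[OF assms] by blast
  obtain g where g: "\<And>x. (h has_derivative (\<lambda>v. g x \<bullet> v)) (at x)"
    using smooth_has_gradient[OF h(1)] by blast
  have "continuous_on UNIV h" using h(1) Ck_continuous unfolding smooth_def by blast
  then show "continuous_on UNIV (iter_pd is (\<lambda>x. complex_of_real (f x)))"
    unfolding h(2) by (intro continuous_intros)
  show "(\<lambda>t. iter_pd is (\<lambda>x. complex_of_real (f x)) (x + t *\<^sub>R axis i 1)) differentiable (at 0)"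
    unfolding h(2) using line_vector_derivative[OF g]
    by (auto simp: has_vector_derivative_def differentiable_def)
qed

lemma laplacian_of_real:
  assumes "\<And>x. (f has_derivative (\<lambda>v. g x \<bullet> v)) (at x)"
    "\<And>x i. ((\<lambda>x. g x $ i) has_derivative (\<lambda>v. h x $ i \<bullet> v)) (at x)"
  shows "laplacian (\<lambda>x. complex_of_real (f x)) x = of_real (\<Sum>i\<in>UNIV. h x $ i $ i)"
proof -
  have "pd i (\<lambda>x. complex_of_real (f x)) = (\<lambda>x. of_real (g x $ i))" for i
    using pd_of_real[OF assms(1)] by blast
  then show ?thesis
    by (simp add: laplacian_def pd_of_real[OF assms(2)])
qed

section \<open>Flat functions built from exp(-1/t)\<close>

definition bump_poly :: "real poly \<Rightarrow> real \<Rightarrow> real" where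
  "bump_poly p t = (if t > 0 then poly p (1/t) * exp (- (1/t)) else 0)"

lemma poly_exp_tendsto_0: "((\<lambda>x::real. x ^ m * poly p x * exp (-x)) \<longlongrightarrow> 0) at_top"
proof (induction p arbitrary: m)
  case (pCons a p)
  have "((\<lambda>x::real. a * (x ^ m / exp x)) \<longlongrightarrow> a * 0) at_top"
    by (intro tendsto_intros tendsto_power_div_exp_0)
  moreover note pCons.IH[of "Suc m"]
  ultimately have "((\<lambda>x::real. a * (x ^ m / exp x) + x ^ Suc m * poly p x * exp (-x)) \<longlongrightarrow> a * 0 + 0) at_top"
    by (rule tendsto_add)
  then show ?case by (simp add: exp_minus field_simps)
qed auto

text \<open>With s = 1/t the derivative of p(s) exp(-s) is s^2 (p - p')(s) exp(-s), and
  \<open>monom 1 2\<close> is the factor s^2. At 0 the difference quotient is s p(s) exp(-s) on the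
  right and 0 on the left.\<close>

lemma bump_poly_derivative:
  "(bump_poly p has_real_derivative bump_poly (monom 1 2 * (p - pderiv p)) t) (at t)"
proof -
  consider "t > 0" | "t < 0" | "t = 0" by linarith
  then show ?thesis
  proof cases
    case 1
    have "((\<lambda>t. poly p (1/t) * exp (- (1/t))) has_real_derivative
       bump_poly (monom 1 2 * (p - pderiv p)) t) (at t)"
      using 1 by (auto intro!: derivative_eq_intros simp: bump_poly_def poly_monom field_simps power2_eq_square)
    note a = this
    have b: "\<forall>\<^sub>F x in nhds t. poly p (1/x) * exp (- (1/x)) = bump_poly p x"
      using eventually_nhds_in_open[of "{0<..}" t] 1
      by (auto elim!: eventually_mono simp: bump_poly_def)
    show ?thesis using a DERIV_cong_ev[OF refl b refl] by simp
  next
    case 2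
    have "((\<lambda>t. 0) has_real_derivative bump_poly (monom 1 2 * (p - pderiv p)) t) (at t)"
      using 2 by (simp add: bump_poly_def)
    note a = this
    have b: "\<forall>\<^sub>F x in nhds t. 0 = bump_poly p x"
      using eventually_nhds_in_open[of "{..<0}" t] 2
      by (auto elim!: eventually_mono simp: bump_poly_def)
    show ?thesis using a DERIV_cong_ev[OF refl b refl] by simp
  next
    case 3
    have lim: "((\<lambda>x. inverse x * poly p (inverse x) * exp (- inverse x)) \<longlongrightarrow> 0) (at_right (0::real))"
      using filterlim_compose[OF poly_exp_tendsto_0[of 1 p] filterlim_inverse_at_top_right] by simp
    have "((\<lambda>x. bump_poly p x / x) \<longlongrightarrow> 0) (at_right 0)"
      by (rule Lim_transform_eventually[OF lim])
         (auto simp: eventually_at_filter bump_poly_def field_simps)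
    moreover have "((\<lambda>x. bump_poly p x / x) \<longlongrightarrow> 0) (at_left 0)"
      by (rule Lim_transform_eventually[OF tendsto_const])
         (auto simp: eventually_at_filter bump_poly_def)
    ultimately have "((\<lambda>x. bump_poly p x / x) \<longlongrightarrow> 0) (at 0)"
      using filterlim_split_at by blast
    then show ?thesis using 3 by (simp add: has_field_derivative_iff bump_poly_def)
  qed
qed

text \<open>\<open>bump j\<close> is the derivative of order j of the function that is exp(-1/t) for positive t and 0 elsewhere.\<close>

definition bump :: "nat \<Rightarrow> real \<Rightarrow> real" where
  "bump j = bump_poly (((\<lambda>p. monom 1 2 * (p - pderiv p)) ^^ j) 1)"

lemma bump_derivative: "(bump j has_real_derivative bump (Suc j) t) (at t)"
  unfolding bump_def using bump_poly_derivative by simp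

lemma Ck_bump: "(\<And>m. Ck m f) \<Longrightarrow> Ck m (\<lambda>x. bump j (f x))"
  by (rule Ck_compose[of bump, OF bump_derivative])

lemma bump_pos: "t > 0 \<Longrightarrow> bump 0 t > 0" and bump_nonneg: "bump 0 t \<ge> 0"
  and bump_zero: "t \<le> 0 \<Longrightarrow> bump j t = 0"
  by (auto simp: bump_def bump_poly_def)

lemma continuous_bump: "continuous_on UNIV (bump j)"
  by (meson DERIV_isCont bump_derivative continuous_at_imp_continuous_on)

section \<open>Differentiation of convolutions\<close>

text \<open>Dominated convergence for the remainder of the first-order expansion divided by the
  increment: the Lipschitz bound and the gradient bound together give the majorant 2 B.\<close>

lemma has_derivative_integral:
  fixes f :: "'a::euclidean_space \<Rightarrow> 'b \<Rightarrow> real" and D :: "'b \<Rightarrow> 'a"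
  assumes r: "r > 0"
    and int: "\<And>x. x \<in> ball x0 r \<Longrightarrow> integrable M (f x)"
    and der: "\<And>y. ((\<lambda>x. f x y) has_derivative (\<lambda>v. D y \<bullet> v)) (at x0)"
    and lip: "\<And>x y. x \<in> ball x0 r \<Longrightarrow> \<bar>f x y - f x0 y\<bar> \<le> B y * norm (x - x0)"
    and B: "integrable M B" and D: "D \<in> borel_measurable M" "\<And>y. norm (D y) \<le> B y"
  shows "((\<lambda>x. \<integral>y. f x y \<partial>M) has_derivative (\<lambda>v. (\<integral>y. D y \<partial>M) \<bullet> v)) (at x0)"
proof -
  have intD: "integrable M D"
    by (rule Bochner_Integration.integrable_bound[OF B D(1)])
       (use D(2) in \<open>auto intro: order_trans[OF _ abs_ge_self]\<close>)
  have intf0: "integrable M (f x0)" using int r by simp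
  show ?thesis
    unfolding has_derivative_iff_norm tendsto_at_iff_sequentially
  proof (intro conjI allI impI)
    show "bounded_linear ((\<bullet>) (\<integral>y. D y \<partial>M))" by (rule bounded_linear_inner_right)
    fix X assume X: "\<forall>i. X i \<in> UNIV - {x0}" "X \<longlonglongrightarrow> x0"
    obtain N where N: "\<And>i. i \<ge> N \<Longrightarrow> X i \<in> ball x0 r"
      using X(2) r unfolding lim_sequentially by (metis dist_commute mem_ball)
    \<comment> \<open>The sequence is started at \<open>N\<close>, from where on it stays in the
      ball in which the integrals exist.\<close>
    define s where "s i y = (f (X (i + N)) y - f x0 y - D y \<bullet> (X (i + N) - x0)) / norm (X (i + N) - x0)" for i y
    have ne: "norm (X i - x0) > 0" for i using X(1) by simp
    have XN: "X (i + N) \<in> ball x0 r" for i using N by simp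
    have lim: "(\<lambda>i. \<integral>y. s i y \<partial>M) \<longlonglongrightarrow> (\<integral>y. 0 \<partial>M)"
    proof (rule integral_dominated_convergence[where w = "\<lambda>y. 2 * B y"])
      show "s i \<in> borel_measurable M" for i
        unfolding s_def by (intro borel_measurable_divide borel_measurable_diff borel_measurable_inner borel_measurable_const
             borel_measurable_integrable[OF int[OF XN]] borel_measurable_integrable[OF intf0] D(1))
      show "integrable M (\<lambda>y. 2 * B y)" using B by simp
      show "AE y in M. (\<lambda>i. s i y) \<longlonglongrightarrow> 0"
      proof (rule AE_I2)
        fix y
        have "(((\<lambda>z. norm (f z y - f x0 y - D y \<bullet> (z - x0)) / norm (z - x0)) \<circ> X) \<longlongrightarrow> 0) sequentially"
          using der[of y] X unfolding has_derivative_iff_norm tendsto_at_iff_sequentially by blast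
        from LIMSEQ_ignore_initial_segment[OF this, of N]
        have "(\<lambda>i. norm (s i y)) \<longlonglongrightarrow> 0" by (simp add: s_def o_def)
        then show "(\<lambda>i. s i y) \<longlonglongrightarrow> 0" by (rule tendsto_norm_zero_cancel)
      qed
      show "AE y in M. norm (s i y) \<le> 2 * B y" for i
      proof (rule AE_I2)
        fix y
        let ?d = "norm (X (i + N) - x0)"
        have "\<bar>D y \<bullet> (X (i + N) - x0)\<bar> \<le> B y * ?d"
          using Cauchy_Schwarz_ineq2[of "D y"] D(2)[of y] by (meson mult_right_mono norm_ge_zero order_trans)
        with lip[OF XN, of i y] have "\<bar>f (X (i + N)) y - f x0 y - D y \<bullet> (X (i + N) - x0)\<bar> \<le> 2 * B y * ?d"
          by linarith
        then show "norm (s i y) \<le> 2 * B y" unfolding s_def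
          using ne[of "i + N"] by (simp add: field_simps)
      qed
    qed auto
    have "(\<integral>y. s i y \<partial>M) = ((\<integral>y. f (X (i + N)) y \<partial>M) - (\<integral>y. f x0 y \<partial>M) - (\<integral>y. D y \<partial>M) \<bullet> (X (i + N) - x0)) / norm (X (i + N) - x0)" for i
      unfolding s_def using int[OF XN] intf0 intD by simp
    with lim have "(\<lambda>i. ((\<integral>y. f (X (i + N)) y \<partial>M) - (\<integral>y. f x0 y \<partial>M) - (\<integral>y. D y \<partial>M) \<bullet> (X (i + N) - x0)) / norm (X (i + N) - x0)) \<longlonglongrightarrow> 0"
      by simp
    from tendsto_norm_zero[OF this]
    have "(\<lambda>i. norm ((\<integral>y. f (X (i + N)) y \<partial>M) - (\<integral>y. f x0 y \<partial>M) - (\<integral>y. D y \<partial>M) \<bullet> (X (i + N) - x0)) / norm (X (i + N) - x0)) \<longlonglongrightarrow> 0"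
      by simp
    from LIMSEQ_offset[OF this]
    show "((\<lambda>x. norm ((\<integral>y. f x y \<partial>M) - (\<integral>y. f x0 y \<partial>M) - (\<integral>y. D y \<partial>M) \<bullet> (x - x0)) / norm (x - x0)) \<circ> X) \<longlonglongrightarrow> 0"
      by (simp add: o_def)
  qed
qed

lemma gradient_lipschitz:
  fixes F :: "'a::euclidean_space \<Rightarrow> real"
  assumes "convex S" "\<And>x. x \<in> S \<Longrightarrow> (F has_derivative (\<lambda>v. \<Gamma> x \<bullet> v)) (at x)"
    "\<And>x. x \<in> S \<Longrightarrow> norm (\<Gamma> x) \<le> L" "x \<in> S" "y \<in> S"
  shows "\<bar>F x - F y\<bar> \<le> L * norm (x - y)"
proof -
  have "norm (F x - F y) \<le> L * norm (x - y)"
  proof (rule differentiable_bound[OF assms(1) _ _ assms(4,5)])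
    fix z assume z: "z \<in> S"
    show "(F has_derivative (\<lambda>v. \<Gamma> z \<bullet> v)) (at z within S)"
      using assms(2)[OF z] by (rule has_derivative_at_withinI)
    show "onorm (\<lambda>v. \<Gamma> z \<bullet> v) \<le> L"
    proof (rule onorm_bound)
      show "0 \<le> L" using assms(3)[OF z] norm_ge_zero order_trans by blast
      show "norm (\<Gamma> z \<bullet> v) \<le> L * norm v" for v
        using Cauchy_Schwarz_ineq2[of "\<Gamma> z" v] assms(3)[OF z]
        by (metis mult_right_mono norm_ge_zero order_trans real_norm_def)
    qed
  qed
  then show ?thesis by simp
qed

lemma continuous_support_bounded:
  fixes F :: "'a::euclidean_space \<Rightarrow> 'b::real_normed_vector"
  assumes "continuous_on UNIV F" "\<And>x. x \<notin> cball c R \<Longrightarrow> F x = 0"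
  obtains L where "L \<ge> 0" "\<And>x. norm (F x) \<le> L"
proof -
  have "bounded (F ` cball c R)"
    by (intro compact_imp_bounded compact_continuous_image continuous_on_subset[OF assms(1)]) auto
  then obtain L where L: "\<And>x. x \<in> cball c R \<Longrightarrow> norm (F x) \<le> L"
    by (force simp: bounded_iff)
  have "norm (F x) \<le> max L 0" for x
    using L[of x] assms(2)[of x] by (cases "x \<in> cball c R") auto
  then show ?thesis using that[of "max L 0"] by simp
qed

lemma continuous_support_integrable:
  fixes F :: "'a::euclidean_space \<Rightarrow> 'b::euclidean_space"
  assumes "continuous_on UNIV F" "\<And>x. x \<notin> cball c R \<Longrightarrow> F x = 0"
  shows "integrable lborel F"
proof -
  have "integrable lborel (\<lambda>x. indicator (cball c R) x *\<^sub>R F x)"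
    by (rule borel_integrable_compact) (use assms in \<open>auto intro: continuous_on_subset\<close>)
  moreover have "(\<lambda>x. indicator (cball c R) x *\<^sub>R F x) = F"
    using assms(2) by (auto simp: indicator_def)
  ultimately show ?thesis by simp
qed

lemma lborel_integral_translation:
  fixes F :: "'a::euclidean_space \<Rightarrow> real"
  assumes "F \<in> borel_measurable borel"
  shows "(\<integral>x. F (x + v) \<partial>lborel) = (\<integral>x. F x \<partial>lborel)"
proof -
  have "(\<integral>x. F x \<partial>lborel) = (\<integral>x. F x \<partial>distr lborel borel ((+) v))"
    by (simp add: lborel_distr_plus)
  also have "\<dots> = (\<integral>x. F (v + x) \<partial>lborel)"
    using assms by (intro integral_distr) auto
  finally show ?thesis by (simp add: add.commute)
qed

lemma gradient_outside_support:
  fixes F :: "'a::euclidean_space \<Rightarrow> real"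
  assumes "\<And>x. (F has_derivative (\<lambda>v. \<Gamma> x \<bullet> v)) (at x)"
    "\<And>x. x \<notin> cball c R \<Longrightarrow> F x = 0" "x \<notin> cball c R"
  shows "\<Gamma> x = 0"
proof -
  have "((\<lambda>_. 0::real) has_derivative (\<lambda>v. \<Gamma> x \<bullet> v)) (at x)"
    by (rule has_derivative_transform_within_open[OF assms(1), of "- cball c R"]) (use assms(2,3) in auto)
  moreover have "((\<lambda>_. 0::real) has_derivative (\<lambda>v. 0)) (at x)" by simp
  ultimately have "(\<lambda>v. \<Gamma> x \<bullet> v) = (\<lambda>v. 0)" by (rule has_derivative_unique)
  then show ?thesis by (metis inner_eq_zero_iff)
qed

text \<open>Translation invariance makes the integral of F(y + v) independent of v, and its
  derivative at v = 0 is the integral of the gradient. Integration by parts on spheres rests on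
  this.\<close>

lemma integral_gradient_eq_0:
  fixes F :: "'a::euclidean_space \<Rightarrow> real"
  assumes der: "\<And>x. (F has_derivative (\<lambda>v. \<Gamma> x \<bullet> v)) (at x)" and cont: "continuous_on UNIV \<Gamma>"
    and supp: "\<And>x. x \<notin> cball 0 R \<Longrightarrow> F x = 0"
  shows "(\<integral>x. \<Gamma> x \<partial>lborel) = 0"
proof -
  have contF: "continuous_on UNIV F"
    by (meson der continuous_at_imp_continuous_on has_derivative_continuous)
  have suppG: "\<And>x. x \<notin> cball 0 R \<Longrightarrow> \<Gamma> x = 0"
    using gradient_outside_support[OF der supp] by blast
  obtain L where L: "L \<ge> 0" "\<And>x. norm (\<Gamma> x) \<le> L"
    using continuous_support_bounded[OF cont suppG] by blast
  have lip: "\<bar>F x - F y\<bar> \<le> L * norm (x - y)" for x y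
    using gradient_lipschitz[OF convex_UNIV der L(2)] by simp
  have "((\<lambda>v. \<integral>y. F (y + v) \<partial>lborel) has_derivative (\<lambda>v. (\<integral>y. \<Gamma> y \<partial>lborel) \<bullet> v)) (at 0)"
  proof (rule has_derivative_integral[where r = 1 and B = "\<lambda>y. indicator (cball 0 (R + 1)) y * L"])
    fix v :: 'a assume v: "v \<in> ball 0 1"
    have out: "F (y + v) = 0" if "y \<notin> cball 0 (R + 1)" for y
    proof (rule supp)
      have "norm y \<le> norm (y + v) + norm v" using norm_triangle_ineq4[of "y + v" v] by simp
      with that v show "y + v \<notin> cball 0 R" by simp
    qed
    show "integrable lborel (\<lambda>y. F (y + v))"
    proof (rule continuous_support_integrable[OF _ out])
      show "continuous_on UNIV (\<lambda>y. F (y + v))"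
        by (rule continuous_on_compose2[OF contF]) (auto intro!: continuous_intros)
    qed
    show "\<bar>F (y + v) - F (y + 0)\<bar> \<le> indicator (cball 0 (R + 1)) y * L * norm (v - 0)" for y
    proof (cases "y \<in> cball 0 (R + 1)")
      case True
      then show ?thesis using lip[of "y + v" y] by simp
    next
      case False
      then show ?thesis using out[OF False] supp[of y] by simp
    qed
  next
    show "((\<lambda>v. F (y + v)) has_derivative (\<lambda>v. \<Gamma> y \<bullet> v)) (at 0)" for y
    proof -
      have "((\<lambda>v. y + v) has_derivative (\<lambda>v. v)) (at 0)" by (auto intro!: derivative_eq_intros)
      moreover have "(F has_derivative (\<lambda>v. \<Gamma> y \<bullet> v)) (at (y + 0))" using der by simp
      ultimately show ?thesis by (rule has_derivative_compose)
    qed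
    show "integrable lborel (\<lambda>y. indicator (cball 0 (R + 1)) y * L)" 
      by (intro integrable_mult_left integrable_real_indicator) (use emeasure_lborel_cball_finite in auto)
    show "\<Gamma> \<in> borel_measurable lborel" using cont by (simp add: borel_measurable_continuous_onI)
    show "norm (\<Gamma> y) \<le> indicator (cball 0 (R + 1)) y * L" for y
      using L suppG[of y] by (auto simp: indicator_def)
  qed simp
  moreover have "(\<integral>y. F (y + v) \<partial>lborel) = (\<integral>y. F y \<partial>lborel)" for v
    by (rule lborel_integral_translation) (use contF in \<open>simp add: borel_measurable_continuous_onI\<close>)
  ultimately have "((\<lambda>v. \<integral>y. F y \<partial>lborel) has_derivative (\<lambda>v. (\<integral>y. \<Gamma> y \<partial>lborel) \<bullet> v)) (at 0)"
    by simp
  moreover have "((\<lambda>v::'a. \<integral>y. F y \<partial>lborel) has_derivative (\<lambda>v. 0)) (at 0)" by simp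
  ultimately have "(\<lambda>v. (\<integral>y. \<Gamma> y \<partial>lborel) \<bullet> v) = (\<lambda>v. 0)" by (rule has_derivative_unique)
  then show ?thesis by (metis inner_eq_zero_iff)
qed

text \<open>The derivative falls on the kernel, so that a merely continuous \<open>w\<close> can be
  mollified; the support of the kernel confines the integral to a ball on which \<open>w\<close> is
  bounded.\<close>

lemma has_derivative_convolution:
  fixes w \<kappa> :: "'a::euclidean_space \<Rightarrow> real"
  assumes w: "continuous_on UNIV w"
    and der: "\<And>x. (\<kappa> has_derivative (\<lambda>v. \<gamma> x \<bullet> v)) (at x)" and cont: "continuous_on UNIV \<gamma>"
    and supp: "\<And>x. x \<notin> cball 0 R \<Longrightarrow> \<kappa> x = 0"
  shows "((\<lambda>x. \<integral>y. w y * \<kappa> (x - y) \<partial>lborel) has_derivative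
           (\<lambda>v. (\<integral>y. w y *\<^sub>R \<gamma> (x - y) \<partial>lborel) \<bullet> v)) (at x)"
proof -
  have contk: "continuous_on UNIV \<kappa>"
    by (meson der continuous_at_imp_continuous_on has_derivative_continuous)
  have suppG: "\<And>x. x \<notin> cball 0 R \<Longrightarrow> \<gamma> x = 0"
    using gradient_outside_support[OF der supp] by blast
  obtain L where L: "L \<ge> 0" "\<And>x. norm (\<gamma> x) \<le> L"
    using continuous_support_bounded[OF cont suppG] by blast
  have lip: "\<bar>\<kappa> x - \<kappa> y\<bar> \<le> L * norm (x - y)" for x y
    using gradient_lipschitz[OF convex_UNIV der L(2)] by simp
  have "bounded (w ` cball x (R + 1))"
    by (intro compact_imp_bounded compact_continuous_image continuous_on_subset[OF w]) auto
  then obtain W where W: "\<And>y. y \<in> cball x (R + 1) \<Longrightarrow> \<bar>w y\<bar> \<le> W"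
    by (force simp: bounded_iff)
  have out: "z - y \<notin> cball 0 R" if "y \<notin> cball x (R + 1)" "z \<in> ball x 1" for z y
  proof -
    have "dist x y \<le> dist x z + dist z y" by (rule dist_triangle)
    moreover have "dist 0 (z - y) = dist z y" by (simp add: dist_norm norm_minus_commute)
    ultimately show ?thesis using that by simp
  qed
  show ?thesis
  proof (rule has_derivative_integral[where r = 1 and B = "\<lambda>y. indicator (cball x (R + 1)) y * (W * L)"])
    fix z :: 'a assume z: "z \<in> ball x 1"
    show "integrable lborel (\<lambda>y. w y * \<kappa> (z - y))"
    proof (rule continuous_support_integrable)
      show "continuous_on UNIV (\<lambda>y. w y * \<kappa> (z - y))"
        by (intro continuous_intros w continuous_on_compose2[OF contk]) (auto intro!: continuous_intros)
      show "w y * \<kappa> (z - y) = 0" if "y \<notin> cball x (R + 1)" for y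
        using supp[OF out[OF that z]] by simp
    qed
    show "\<bar>w y * \<kappa> (z - y) - w y * \<kappa> (x - y)\<bar> \<le> indicator (cball x (R + 1)) y * (W * L) * norm (z - x)" for y
    proof (cases "y \<in> cball x (R + 1)")
      case True
      have "\<bar>w y * \<kappa> (z - y) - w y * \<kappa> (x - y)\<bar> = \<bar>w y\<bar> * \<bar>\<kappa> (z - y) - \<kappa> (x - y)\<bar>"
        by (simp add: abs_mult[symmetric] right_diff_distrib)
      also have "\<dots> \<le> W * (L * norm (z - x))"
        using W[OF True] lip[of "z - y" "x - y"] by (intro mult_mono) auto
      finally show ?thesis using True by simp
    next
      case False
      then show ?thesis using supp[OF out[OF False z]] supp[OF out[OF False, of x]] by simp
    qed
  next
    show "((\<lambda>x. w y * \<kappa> (x - y)) has_derivative (\<lambda>v. (w y *\<^sub>R \<gamma> (x - y)) \<bullet> v)) (at x)" for y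
    proof -
      have "((\<lambda>v. v - y) has_derivative (\<lambda>v. v)) (at x)" by (auto intro!: derivative_eq_intros)
      from has_derivative_compose[OF this der]
      have "((\<lambda>x. \<kappa> (x - y)) has_derivative (\<lambda>v. \<gamma> (x - y) \<bullet> v)) (at x)" .
      then show ?thesis by (auto intro!: derivative_eq_intros)
    qed
    show "integrable lborel (\<lambda>y. indicator (cball x (R + 1)) y * (W * L))" 
      by (intro integrable_mult_left integrable_real_indicator) (use emeasure_lborel_cball_finite in auto)
    have "continuous_on UNIV (\<lambda>y. w y *\<^sub>R \<gamma> (x - y))"
      by (intro continuous_intros w continuous_on_compose2[OF cont]) (auto intro!: continuous_intros)
    then show "(\<lambda>y. w y *\<^sub>R \<gamma> (x - y)) \<in> borel_measurable lborel" by (simp add: borel_measurable_continuous_onI)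
    show "norm (w y *\<^sub>R \<gamma> (x - y)) \<le> indicator (cball x (R + 1)) y * (W * L)" for y
    proof (cases "y \<in> cball x (R + 1)")
      case True
      then show ?thesis using W[OF True] L by (simp add: mult_mono')
    next
      case False
      then show ?thesis using suppG[OF out[OF False, of x]] by simp
    qed
  qed simp
qed

section \<open>A differential inequality for radial averages\<close>

text \<open>For an exterior solution W, the functions n0, n01, n1, nX are the means over the sphere of radius r of
  \<open>W\<^sup>2\<close>, \<open>W (x \<bullet> \<nabla>W)\<close>, \<open>(x \<bullet> \<nabla>W)\<^sup>2\<close> and \<open>\<bar>x\<bar>\<^sup>2 \<bar>\<nabla>W\<bar>\<^sup>2 - (x \<bullet> \<nabla>W)\<^sup>2\<close>.\<close>

locale radial_energy =
  fixes n0 n01 n1 nX :: "real \<Rightarrow> real" and R k C :: real and n :: nat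
  assumes R: "R > 0" and k: "k > 0" and n: "n \<ge> 1"
    and d0: "\<And>r. r > R \<Longrightarrow> (n0 has_real_derivative 2 * n01 r / r) (at r)"
    and d01: "\<And>r. r > R \<Longrightarrow> (n01 has_real_derivative
          (n1 r - (real n - 2) * n01 r - k\<^sup>2 * r\<^sup>2 * n0 r + nX r) / r) (at r)"
    and dE: "\<And>r. r > R \<Longrightarrow> ((\<lambda>r. n1 r - nX r) has_real_derivative
          (- 2 * (real n - 2) * n1 r - 2 * k\<^sup>2 * r\<^sup>2 * n01 r) / r) (at r)"
    and n0_nonneg: "\<And>r. n0 r \<ge> 0" and nX_nonneg: "\<And>r. nX r \<ge> 0"
    and psd: "\<And>b r. n1 r + 2 * b * n01 r + b\<^sup>2 * n0 r \<ge> 0"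
    and decay0: "\<And>r. r > R \<Longrightarrow> r ^ n * n0 r \<le> C"
    and decay1: "\<And>r. r > R \<Longrightarrow> r ^ n * n1 r \<le> C * r\<^sup>2"
begin

text \<open>\<open>G m\<close> is the energy, in the manner of Kato, of W times r to the power \<open>\<beta> m\<close>; the exponent \<open>p m = 2 \<beta> m\<close> is the one for
  which its derivative is a sum of nonnegative terms.\<close>

definition "\<beta> m = (2 * real m + real n - 1) / 2"
definition "p m = 2 * m + (n - 1)"
definition "B m r = n1 r + 2 * \<beta> m * n01 r + (\<beta> m)\<^sup>2 * n0 r"
definition "\<kappa> m = (2 * real m + 1) * \<beta> m - (\<beta> m)\<^sup>2"
definition "G m r = r ^ p m * (B m r + (\<kappa> m + k\<^sup>2 * r\<^sup>2) * n0 r - nX r)"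
text \<open>As \<open>n1 r / r\<^sup>2\<close> is the mean of the squared radial derivative, this
  is, up to a constant, the integral of that square plus the square of W over the sphere of radius
  r.\<close>

definition "e r = r ^ (n - 1) * (n1 r / r\<^sup>2 + n0 r)"

lemma B_nonneg: "B m r \<ge> 0"
  unfolding B_def by (rule psd)

lemma p_eq: "real (p m) = 2 * \<beta> m"
  using n by (simp add: p_def \<beta>_def of_nat_diff)

lemma n1_nonneg: "n1 r \<ge> 0"
  using psd[of r 0] by simp

lemma d_power: "r > R \<Longrightarrow> ((\<lambda>r. r ^ p m) has_real_derivative 2 * \<beta> m * r ^ p m / r) (at r)"
proof -
  assume "r > R"
  with R have "r > 0" by simp
  then have "real (p m) * r ^ (p m - 1) = 2 * \<beta> m * r ^ p m / r"
    by (cases "p m") (auto simp: p_eq[symmetric] field_simps)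
  then show ?thesis
    using DERIV_pow[of "p m" r] by simp
qed

text \<open>The origin of \<open>\<kappa> m\<close>: written with \<open>n1 - nX\<close>, the energy
  has \<open>n0\<close> with coefficient \<open>(2 * real m + 1) * \<beta> m\<close> plus
  \<open>k\<^sup>2 * r\<^sup>2\<close>. In the derivative the \<open>nX\<close> terms then cancel,
  because the power of r is \<open>2 * \<beta> m\<close>, and the remaining terms complete the
  square \<open>B m\<close>.\<close>

lemma dG: 
  assumes r: "r > R"
  shows "(G m has_real_derivative
     r ^ p m * (2 * (2 * real m + 1) * B m r + 2 * k\<^sup>2 * r\<^sup>2 * n0 r) / r) (at r)"
proof -
  have r0: "r > 0" using R r by simp
  have eq: "G m = (\<lambda>r. r ^ p m * ((n1 r - nX r) + 2 * \<beta> m * n01 r + ((2 * real m + 1) * \<beta> m + k\<^sup>2 * r\<^sup>2) * n0 r))"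
    by (rule ext) (simp add: G_def B_def \<kappa>_def algebra_simps)
  have "real n = 2 * \<beta> m - 2 * real m + 1" by (simp add: \<beta>_def field_simps)
  note n_eq = this
  have dq: "((\<lambda>r. (2 * real m + 1) * \<beta> m + k\<^sup>2 * r\<^sup>2) has_real_derivative 2 * k\<^sup>2 * r) (at r)"
    by (auto intro!: derivative_eq_intros)
  show ?thesis unfolding eq
    apply (rule DERIV_cong)
     apply (rule DERIV_mult[OF d_power[OF r] DERIV_add[OF DERIV_add[OF dE[OF r] DERIV_cmult[OF d01[OF r]]] DERIV_mult[OF dq d0[OF r]]]])
    unfolding n_eq B_def using r0 by (simp add: field_simps power2_eq_square)
qed

text \<open>The factor \<open>1 / r\<^sup>2\<close> offsets the growth in \<open>G_le_e\<close>.
  Alone it would leave in the derivative a multiple of \<open>- \<kappa> m * n0 r\<close>, possibly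
  negative; subtracting \<open>1 / r ^ 3\<close> frees a term
  \<open>k\<^sup>2 * r\<^sup>2 * n0 r\<close> that absorbs it from \<open>Rm m\<close> on.\<close>

definition "T m r = (1 / r\<^sup>2 - 1 / r ^ 3) * G m r"

definition "Rm m = max (max 2 (R + 1)) (2 * \<bar>\<kappa> m\<bar> / k\<^sup>2)"

lemma dT:
  assumes r: "r \<ge> Rm m"
  shows "\<exists>D. (T m has_real_derivative D) (at r) \<and> D \<ge> 0"
proof -
  have r': "r > R" "r \<ge> 2" "r > 0" "2 * \<bar>\<kappa> m\<bar> / k\<^sup>2 \<le> r" using r by (auto simp: Rm_def)
  then have kr: "2 * \<bar>\<kappa> m\<bar> \<le> k\<^sup>2 * r" using k by (simp add: field_simps)
  \<comment> \<open>The coefficient of \<open>B m r\<close> is 2 (2m + 1)(r - 1) + 3 - 2r, and that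
    of \<open>nX r\<close> is nonnegative since r is at least 2.\<close>
  let ?D = "r ^ p m / r ^ 4 * ((4 * real m * (r - 1) + 1) * B m r + (k\<^sup>2 * r\<^sup>2 + \<kappa> m * (3 - 2 * r)) * n0 r
     + (2 * r - 3) * nX r)"
  have "((\<lambda>r. 1 / r\<^sup>2 - 1 / r ^ 3) has_real_derivative (3 - 2 * r) / r ^ 4) (at r)"
    using r' by (auto intro!: derivative_eq_intros simp: field_simps power2_eq_square power3_eq_cube power4_eq_xxxx)
  from DERIV_mult[OF this dG[OF r'(1), of m]]
  have "(T m has_real_derivative ?D) (at r)"
    unfolding T_def[abs_def]
    apply (rule DERIV_cong)
    using r' unfolding G_def
    by (simp add: field_simps power2_eq_square power3_eq_cube power4_eq_xxxx)
  moreover have "?D \<ge> 0"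
  proof -
    have "\<bar>\<kappa> m * (3 - 2 * r)\<bar> \<le> \<bar>\<kappa> m\<bar> * (2 * r)"
      unfolding abs_mult using r' by (intro mult_left_mono) auto
    also have "\<dots> \<le> k\<^sup>2 * r\<^sup>2" using mult_right_mono[OF kr, of r] r' by (simp add: power2_eq_square mult_ac)
    finally have "k\<^sup>2 * r\<^sup>2 + \<kappa> m * (3 - 2 * r) \<ge> 0" by linarith
    then show ?thesis
      using r' B_nonneg n0_nonneg nX_nonneg by simp
  qed
  ultimately show ?thesis by blast
qed

lemma T_mono: "Rm m \<le> r \<Longrightarrow> r \<le> s \<Longrightarrow> T m r \<le> T m s"
  by (rule DERIV_nonneg_imp_nondecreasing) (auto intro!: dT)

lemma G_mono: 
  assumes "R < r" "r \<le> s" shows "G m r \<le> G m s"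
proof (rule DERIV_nonneg_imp_nondecreasing[OF assms(2)])
  fix x assume "r \<le> x" with assms(1)
  have x: "R < x" "0 < x" using R by auto
  show "\<exists>y. (G m has_real_derivative y) (at x) \<and> 0 \<le> y"
    using dG[OF x(1)] x B_nonneg n0_nonneg by (intro exI conjI) (assumption, simp)
qed

text \<open>\<open>psd\<close> at \<open>- \<beta> m\<close> bounds the mixed term of
  \<open>B m\<close> by the two squares; \<open>- nX\<close> only helps in a bound from
  above.\<close>

lemma G_le_e:
  assumes "r \<ge> 1"
  shows "G m r \<le> r\<^sup>2 * ((2 + 2 * (\<beta> m)\<^sup>2 + \<bar>\<kappa> m\<bar> + k\<^sup>2) * (r ^ (2 * m) * e r))"
proof -
  have B: "B m r \<le> 2 * n1 r + 2 * (\<beta> m)\<^sup>2 * n0 r"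
    using psd[of r "- \<beta> m"] by (simp add: B_def algebra_simps)
  have r2: "r\<^sup>2 \<ge> 1" using assms by simp
  have "B m r + (\<kappa> m + k\<^sup>2 * r\<^sup>2) * n0 r - nX r \<le>
     2 * n1 r + 2 * (\<beta> m)\<^sup>2 * n0 r + (\<bar>\<kappa> m\<bar> + k\<^sup>2 * r\<^sup>2) * n0 r"
    using B nX_nonneg[of r] mult_right_mono[OF abs_ge_self n0_nonneg, of "\<kappa> m" r]
    by (simp add: algebra_simps)
  also have "\<dots> \<le> (2 + 2 * (\<beta> m)\<^sup>2 + \<bar>\<kappa> m\<bar> + k\<^sup>2) * (n1 r + r\<^sup>2 * n0 r)"
  proof -
    have "n0 r \<le> r\<^sup>2 * n0 r" using r2 n0_nonneg[of r] by (simp add: mult_right_mono[of 1 "r\<^sup>2" "n0 r", simplified])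
    then have "(2 * (\<beta> m)\<^sup>2 + \<bar>\<kappa> m\<bar>) * n0 r \<le> (2 * (\<beta> m)\<^sup>2 + \<bar>\<kappa> m\<bar>) * (r\<^sup>2 * n0 r)"
      by (intro mult_left_mono) auto
    moreover have "0 \<le> 2 * (r\<^sup>2 * n0 r)" "0 \<le> (2 * (\<beta> m)\<^sup>2 + \<bar>\<kappa> m\<bar> + k\<^sup>2) * n1 r"
      using n0_nonneg n1_nonneg by simp_all
    ultimately show ?thesis by (simp add: algebra_simps)
  qed
  also have "n1 r + r\<^sup>2 * n0 r = r\<^sup>2 * (n1 r / r\<^sup>2 + n0 r)" using assms by (simp add: field_simps)
  finally have *: "B m r + (\<kappa> m + k\<^sup>2 * r\<^sup>2) * n0 r - nX r \<le>
     (2 + 2 * (\<beta> m)\<^sup>2 + \<bar>\<kappa> m\<bar> + k\<^sup>2) * (r\<^sup>2 * (n1 r / r\<^sup>2 + n0 r))" .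
  have "r ^ p m \<ge> 0" using assms by simp
  from mult_left_mono[OF * this] show ?thesis
    unfolding G_def e_def p_def by (simp add: power_add mult_ac)
qed

text \<open>\<open>Hm m\<close> forces \<open>G m \<le> 0\<close> near infinity, and this improves the decay to \<open>Hm (Suc m)\<close>.\<close>

definition "Hm m \<longleftrightarrow> (\<forall>a>0. \<forall>r0. \<exists>r\<ge>r0. r ^ (2 * m) * e r < a)"

text \<open>If \<open>G m\<close> were positive beyond \<open>Rm m\<close>, the nondecreasing
  \<open>T m\<close> would stay above a positive constant. But
  \<open>T m s \<le> G m s / s\<^sup>2\<close> is at most a constant times
  \<open>s ^ (2 * m) * e s\<close>, which \<open>Hm m\<close> makes arbitrarily small somewhere far
  out.\<close>

lemma Hm_imp_G_le:
  assumes "Hm m" "r \<ge> Rm m"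
  shows "G m r \<le> 0"
proof (rule ccontr)
  assume "\<not> G m r \<le> 0"
  then have G: "G m r > 0" by simp
  have r: "r \<ge> 2" using assms(2) by (simp add: Rm_def)
  have "1 / r\<^sup>2 - 1 / r ^ 3 > 0" using r by (simp add: field_simps power2_eq_square power3_eq_cube)
  with G have T: "T m r > 0" by (simp add: T_def)
  let ?c = "2 + 2 * (\<beta> m)\<^sup>2 + \<bar>\<kappa> m\<bar> + k\<^sup>2"
  have c: "?c > 0" by (smt (verit) zero_le_power2)
  obtain s where s: "s \<ge> r" "s ^ (2 * m) * e s < T m r / ?c"
    using assms(1) T c unfolding Hm_def by (metis divide_pos_pos)
  have s2: "s \<ge> 2" using s r by simp
  have "G m s \<le> s\<^sup>2 * (?c * (s ^ (2 * m) * e s))" using G_le_e s2 by simp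
  also have "\<dots> < s\<^sup>2 * T m r"
    using s c s2 by (intro mult_strict_left_mono) (auto simp: field_simps)
  finally have "G m s < s\<^sup>2 * T m r" .
  moreover have "T m s \<ge> T m r" using T_mono[OF assms(2) s(1)] .
  moreover have "T m s \<le> G m s / s\<^sup>2"
  proof -
    have "G m s \<ge> 0" 
      using G_mono[of r s m] G s assms(2) by (simp add: Rm_def)
    then have "T m s \<le> (1 / s\<^sup>2) * G m s"
      unfolding T_def using s2 by (intro mult_right_mono) auto
    then show ?thesis by simp
  qed
  ultimately have "G m s < s\<^sup>2 * (G m s / s\<^sup>2)"
    using s2 by (smt (verit) mult_left_mono zero_le_power2)
  then show False using s2 by simp
qed

text \<open>If \<open>r ^ (2 * Suc m) * e r\<close> stayed above some a > 0, \<open>dG\<close> would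
  bound the derivative of \<open>G m\<close> below by a multiple of 1/r, and logarithmic growth
  would make \<open>G m\<close> positive.\<close>

lemma G_le_imp_Hm:
  assumes "\<And>r. r \<ge> r1 \<Longrightarrow> G m r \<le> 0"
  shows "Hm (Suc m)"
proof (rule ccontr)
  assume "\<not> Hm (Suc m)"
  then obtain a r0 where a: "a > 0" and e: "\<And>r. r \<ge> r0 \<Longrightarrow> r ^ (2 * Suc m) * e r \<ge> a"
    unfolding Hm_def by (meson not_less)
  define s where "s = max (max r0 r1) (max 1 (R + 1))"
  \<comment> \<open>Bounds n1 + r^2 n0 by the terms in the derivative of \<open>G m\<close>: the
    entry 2 serves for \<open>B m\<close>, the other one for \<open>n0\<close>.\<close>
  define c where "c = max 2 ((2 * (\<beta> m)\<^sup>2 + 1) / k\<^sup>2)"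
  have c: "c \<ge> 2" "2 * (\<beta> m)\<^sup>2 + 1 \<le> c * k\<^sup>2" 
    using k by (auto simp: c_def max_def field_simps)
  have lower: "G m s + 2 * a / c * (ln t - ln s) \<le> G m t" if "t \<ge> s" for t
  proof -
    have "G m s - 2 * a / c * ln s \<le> G m t - 2 * a / c * ln t"
    proof (rule DERIV_nonneg_imp_nondecreasing[OF that])
      fix x assume "s \<le> x" "x \<le> t"
      then have x: "x \<ge> r0" "x \<ge> 1" "x > R" by (auto simp: s_def)
      have x2: "x\<^sup>2 \<ge> 1" using x by simp
      let ?D = "x ^ p m * (2 * (2 * real m + 1) * B m x + 2 * k\<^sup>2 * x\<^sup>2 * n0 x) / x - 2 * a / c * (1 / x)"
      have "((\<lambda>x. G m x - 2 * a / c * ln x) has_real_derivative ?D) (at x)"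
        using x c by (auto intro!: derivative_eq_intros dG)
      moreover have "?D \<ge> 0"
      proof -
        have 1: "n1 x \<le> 2 * B m x + 2 * (\<beta> m)\<^sup>2 * n0 x"
          using psd[of x "2 * \<beta> m"] by (simp add: B_def power2_eq_square algebra_simps)
        have "n1 x + x\<^sup>2 * n0 x \<le> 2 * B m x + (2 * (\<beta> m)\<^sup>2 + 1) * (x\<^sup>2 * n0 x)"
          using 1 mult_right_mono[OF x2 mult_nonneg_nonneg[of "2 * (\<beta> m)\<^sup>2" "n0 x"]] n0_nonneg
          by (simp add: algebra_simps)
        also have "\<dots> \<le> c * B m x + (c * k\<^sup>2) * (x\<^sup>2 * n0 x)"
          using c B_nonneg[of m x] n0_nonneg[of x] by (intro add_mono mult_right_mono) auto
        finally have 2: "n1 x + x\<^sup>2 * n0 x \<le> c * (B m x + k\<^sup>2 * x\<^sup>2 * n0 x)" by (simp add: algebra_simps)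
        have "a \<le> x ^ (2 * Suc m) * e x" using e x by simp
        also have "\<dots> = x ^ p m * (n1 x + x\<^sup>2 * n0 x)"
          using x by (simp add: e_def p_def power_add field_simps power2_eq_square)
        also have "\<dots> \<le> x ^ p m * (c * (B m x + k\<^sup>2 * x\<^sup>2 * n0 x))"
          using 2 x by (intro mult_left_mono) auto
        finally have 3: "a / c \<le> x ^ p m * (B m x + k\<^sup>2 * x\<^sup>2 * n0 x)" using c by (simp add: field_simps)
        also have "\<dots> \<le> x ^ p m * ((2 * real m + 1) * B m x + k\<^sup>2 * x\<^sup>2 * n0 x)"
          using x mult_right_mono[of 1 "2 * real m + 1" "B m x"] B_nonneg[of m x] by (intro mult_left_mono) auto
        finally have "2 * (a / c) / x \<le> 2 * (x ^ p m * ((2 * real m + 1) * B m x + k\<^sup>2 * x\<^sup>2 * n0 x)) / x"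
          using x by (intro divide_right_mono) auto
        then show ?thesis by (simp add: algebra_simps)
      qed
      ultimately show "\<exists>y. ((\<lambda>x. G m x - 2 * a / c * ln x) has_real_derivative y) (at x) \<and> 0 \<le> y" by blast
    qed
    then show ?thesis by (simp add: right_diff_distrib)
  qed
  \<comment> \<open>The logarithmic gain \<open>2 * a / c * L\<close> is then
    \<open>\<bar>G m s\<bar> + 1\<close>, so that \<open>G m\<close> is at least 1 at
    \<open>t\<close>.\<close>
  define L where "L = (\<bar>G m s\<bar> + 1) * c / (2 * a)"
  have L: "L \<ge> 0" using a c by (simp add: L_def)
  define t where "t = s * exp L"
  have s1: "s \<ge> 1" by (simp add: s_def)
  have t: "t \<ge> s" using s1 L by (simp add: t_def)
  have "ln t - ln s = L" using s1 by (simp add: t_def ln_mult)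
  then have "G m s + (\<bar>G m s\<bar> + 1) \<le> G m t"
    using lower[OF t] a c by (simp add: L_def)
  moreover have "G m t \<le> 0" using t by (intro assms) (simp add: s_def)
  ultimately show False by linarith
qed

text \<open>The assumed decay gives r e(r) \<le> 2 C, so e tends to 0: the remainder of the
  far-field expansion is just strong enough to start the induction.\<close>

lemma Hm_0: "Hm 0"
  unfolding Hm_def
proof (intro allI impI)
  fix a r0 :: real assume a: "a > 0"
  define r where "r = max (max r0 (R + 1)) ((2 * \<bar>C\<bar> + 1) / a)"
  have r: "r \<ge> r0" "r > R" "r > 0" "(2 * \<bar>C\<bar> + 1) / a \<le> r" using R by (auto simp: r_def)
  have "r ^ n = r * r ^ (n - 1)" using n by (metis Suc_diff_1 less_le_trans power_Suc zero_less_one)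
  then have "r * e r = r ^ n * n1 r / r\<^sup>2 + r ^ n * n0 r"
    by (simp add: e_def algebra_simps)
  also have "\<dots> \<le> C + C" using decay0[OF r(2)] decay1[OF r(2)] r by (intro add_mono) (simp_all add: field_simps)
  also have "\<dots> < 2 * \<bar>C\<bar> + 1" by linarith
  also have "\<dots> \<le> r * a" using r a by (simp add: field_simps)
  finally have "e r < a" using r by simp
  then show "\<exists>r\<ge>r0. r ^ (2 * 0) * e r < a" using r by auto
qed

lemma Hm: "Hm m"
proof (induction m)
  case (Suc m)
  then show ?case using G_le_imp_Hm Hm_imp_G_le by blast
qed (rule Hm_0)

text \<open>For fixed r, \<open>\<kappa> m\<close> grows like m^2, so a positive \<open>n0 r\<close>
  would outweigh \<open>nX r\<close> in \<open>G m r\<close> for large m. Being nondecreasing,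
  \<open>G m\<close> would remain positive near infinity, against \<open>Hm\<close>.\<close>

lemma n0_zero:
  assumes r: "r > R"
  shows "n0 r = 0"
proof (rule ccontr)
  assume "n0 r \<noteq> 0"
  with n0_nonneg[of r] have n0: "n0 r > 0" by simp
  obtain m :: nat where m: "real m > nX r / n0 r + (real n)\<^sup>2" using reals_Archimedean2 by blast
  have "nX r / n0 r \<ge> 0" using n0 nX_nonneg[of r] by simp
  have "4 * \<kappa> m = 4 * (real m * real m) + 4 * real m - (real n)\<^sup>2 + 4 * real n - 3"
    by (simp add: \<kappa>_def \<beta>_def field_simps power2_eq_square)
  moreover have "real m * real m \<ge> 0" by simp
  moreover have "real n \<ge> 1" using n by (metis of_nat_1 of_nat_le_iff)
  ultimately have "4 * \<kappa> m \<ge> 4 * real m - (real n)\<^sup>2" by linarith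
  moreover have "4 * real m - (real n)\<^sup>2 \<ge> 4 * (nX r / n0 r)" using m \<open>nX r / n0 r \<ge> 0\<close> by (smt (verit) zero_le_power2)
  ultimately have "\<kappa> m \<ge> nX r / n0 r" by linarith
  then have "\<kappa> m * n0 r \<ge> nX r" using n0 by (simp add: field_simps)
  moreover have "k\<^sup>2 * r\<^sup>2 * n0 r > 0" using n0 k R r by simp
  ultimately have "B m r + (\<kappa> m + k\<^sup>2 * r\<^sup>2) * n0 r - nX r > 0"
    using B_nonneg[of m r] by (simp add: algebra_simps)
  then have G: "G m r > 0" using R r by (simp add: G_def)
  have "G m (max r (Rm m)) \<ge> G m r" using G_mono r by simp
  moreover have "G m (max r (Rm m)) \<le> 0" using Hm_imp_G_le[OF Hm] by simp
  ultimately show False using G by simp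
qed

end

section \<open>Spherical means by integration over a thick shell\<close>

lemma continuous_nonneg_integral_0:
  fixes f :: "'a::euclidean_space \<Rightarrow> real"
  assumes cont: "continuous_on UNIV f" and nonneg: "\<And>y. f y \<ge> 0" and int: "integrable lborel f"
    and zero: "(\<integral>y. f y \<partial>lborel) = 0"
  shows "f x = 0"
proof (rule ccontr)
  assume "f x \<noteq> 0"
  with nonneg[of x] have "f x > 0" by simp
  moreover have "isCont f x" using cont by (simp add: continuous_on_eq_continuous_at)
  ultimately have "\<forall>\<^sub>F y in nhds x. f y > 0"
    by (simp add: isCont_def order_tendstoD(1) tendsto_at_iff_tendsto_nhds)
  then obtain d where d: "d > 0" "\<And>y. dist y x < d \<Longrightarrow> f y > 0"
    unfolding eventually_nhds_metric by blast
  have "AE y in lborel. f y = 0"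
    using integral_nonneg_eq_0_iff_AE[OF int] nonneg zero by auto
  then have "AE y in lborel. y \<notin> ball x d"
    by (rule AE_mp[OF _ AE_I2]) (metis d(2) less_irrefl dist_commute mem_ball)
  then have "emeasure lborel (ball x d) = 0"
    by (subst (asm) AE_iff_measurable[OF _ refl]) (auto simp: ball_def)
  then show False using d(1) content_ball_pos[of d x] by (simp add: measure_def)
qed

text \<open>A radial weight supported in 1/2 \<le> |y| \<le> 2 and positive on the unit sphere. As
  it vanishes near 0, the discontinuity of \<open>sgn\<close> does no harm.\<close>

definition shell :: "real^'n::finite \<Rightarrow> real" where
  "shell y = bump 0 (y \<bullet> y - 1/4) * bump 0 (4 - y \<bullet> y)"

text \<open>Normalized such that the gradient of \<open>shell\<close> at y is
  \<open>shell' y *\<^sub>R y\<close>, a radial vector.\<close>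

definition shell' :: "real^'n::finite \<Rightarrow> real" where
  "shell' y = 2 * (bump 1 (y \<bullet> y - 1/4) * bump 0 (4 - y \<bullet> y) - bump 0 (y \<bullet> y - 1/4) * bump 1 (4 - y \<bullet> y))"

lemma shell_nonneg: "shell y \<ge> 0"
  by (simp add: shell_def bump_nonneg)

lemma shell_pos: "norm y = 1 \<Longrightarrow> shell y > 0"
  by (simp add: shell_def bump_pos dot_square_norm)

lemma shell_inner: assumes "norm y \<le> 1/2" shows "shell y = 0" "shell' y = 0"
proof -
  have "(norm y)\<^sup>2 \<le> (1/2)\<^sup>2" using assms by (intro power_mono) auto
  then show "shell y = 0" "shell' y = 0"
    by (simp_all add: shell_def shell'_def bump_zero dot_square_norm power2_eq_square)
qed

lemma shell_outer: assumes "y \<notin> cball 0 2" shows "shell y = 0"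
proof -
  have "(norm y)\<^sup>2 \<ge> 2\<^sup>2" using assms by (intro power_mono) auto
  then show "shell y = 0"
    by (simp add: shell_def bump_zero dot_square_norm)
qed

lemma continuous_shell: "continuous_on A shell" "continuous_on A shell'"
  unfolding shell_def shell'_def
  by (intro continuous_intros continuous_on_compose2[OF continuous_bump]; simp)+

lemma shell_derivative: "(shell has_derivative (\<lambda>v. (shell' y *\<^sub>R y) \<bullet> v)) (at y)"
proof -
  have "((\<lambda>y. y \<bullet> y - 1/4) has_derivative (\<lambda>v. 2 * (y \<bullet> v))) (at y)"
    by (auto intro!: derivative_eq_intros simp: inner_commute)
  from has_derivative_compose[OF this has_field_derivative_imp_has_derivative[OF bump_derivative[of 0]]]
  have 1: "((\<lambda>y. bump 0 (y \<bullet> y - 1/4)) has_derivative (\<lambda>v. bump 1 (y \<bullet> y - 1/4) * (2 * (y \<bullet> v)))) (at y)"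
    by simp
  have "((\<lambda>y. 4 - y \<bullet> y) has_derivative (\<lambda>v. - 2 * (y \<bullet> v))) (at y)"
    by (auto intro!: derivative_eq_intros simp: inner_commute)
  from has_derivative_compose[OF this has_field_derivative_imp_has_derivative[OF bump_derivative[of 0]]]
  have 2: "((\<lambda>y. bump 0 (4 - y \<bullet> y)) has_derivative (\<lambda>v. bump 1 (4 - y \<bullet> y) * (- 2 * (y \<bullet> v)))) (at y)"
    by simp
  show ?thesis unfolding shell_def[abs_def]
    by (rule has_derivative_eq_rhs[OF has_derivative_mult[OF 1 2]])
       (auto simp: shell'_def algebra_simps)
qed

lemma continuous_on_sgn_ne0: "continuous_on (- {0}) (sgn :: 'a::real_normed_vector \<Rightarrow> 'a)"
  unfolding sgn_div_norm[abs_def] by (intro continuous_intros) auto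

text \<open>Up to a constant factor this is the mean over the sphere of radius r. Integrating over a smooth shell in the
  whole space avoids surface measure.\<close>

definition sph :: "(real^'n::finite \<Rightarrow> real) \<Rightarrow> real \<Rightarrow> real" where
  "sph g r = (\<integral>y. shell y * g (r *\<^sub>R sgn y) \<partial>lborel)"

lemma continuous_shell_times:
  fixes g :: "real^'n::finite \<Rightarrow> 'b::real_normed_vector"
  assumes "continuous_on UNIV g"
  shows "continuous_on UNIV (\<lambda>y. shell y *\<^sub>R g (r *\<^sub>R sgn y))"
proof -
  have "continuous_on (ball 0 (1/2)) (\<lambda>y. shell y *\<^sub>R g (r *\<^sub>R sgn y))"
    by (rule continuous_on_eq[of _ "\<lambda>_. 0"]) (auto simp: shell_inner)
  moreover have "continuous_on (- {0}) (\<lambda>y. shell y *\<^sub>R g (r *\<^sub>R sgn y))"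
    by (intro continuous_intros continuous_shell continuous_on_compose2[OF assms] continuous_on_sgn_ne0) auto
  ultimately have "continuous_on (ball 0 (1/2) \<union> - {0}) (\<lambda>y. shell y *\<^sub>R g (r *\<^sub>R sgn y))"
    by (intro continuous_on_open_Un) auto
  moreover have "ball 0 (1/2) \<union> - {0} = (UNIV :: (real^'n) set)" by auto
  ultimately show ?thesis by simp
qed

lemma sph_integrable:
  assumes "continuous_on UNIV g"
  shows "integrable lborel (\<lambda>y. shell y * g (r *\<^sub>R sgn y))"
  by (rule continuous_support_integrable[where c = 0 and R = 2])
     (use continuous_shell_times[OF assms] shell_outer in auto)

lemma sph_add:
  assumes "continuous_on UNIV f" "continuous_on UNIV g"
  shows "sph (\<lambda>x. f x + g x) r = sph f r + sph g r"
  unfolding sph_def using sph_integrable[OF assms(1)] sph_integrable[OF assms(2)]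
  by (simp add: distrib_left)

lemma sph_cmult: "sph (\<lambda>x. c * g x) r = c * sph g r"
proof -
  have "(\<lambda>y. shell y * (c * g (r *\<^sub>R sgn y))) = (\<lambda>y. c * (shell y * g (r *\<^sub>R sgn y)))" by (auto simp: mult_ac)
  then show ?thesis unfolding sph_def by simp
qed

lemma sph_lincomb2:
  assumes "continuous_on UNIV f" "continuous_on UNIV g"
  shows "sph (\<lambda>x. f x + b * g x) r = sph f r + b * sph g r"
  using sph_add[OF assms(1) continuous_on_mult_left[OF assms(2)]] by (simp add: sph_cmult)

lemma sph_lincomb3:
  assumes "continuous_on UNIV f" "continuous_on UNIV g" "continuous_on UNIV h"
  shows "sph (\<lambda>x. f x + b * g x + c * h x) r = sph f r + b * sph g r + c * sph h r"
  using sph_lincomb2[OF continuous_on_add[OF assms(1) continuous_on_mult_left[OF assms(2)]] assms(3)]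
  by (simp add: sph_lincomb2 assms)

lemma sph_lincomb4:
  assumes "continuous_on UNIV f" "continuous_on UNIV g" "continuous_on UNIV h" "continuous_on UNIV l"
  shows "sph (\<lambda>x. f x + b * g x + c * h x + d * l x) r = sph f r + b * sph g r + c * sph h r + d * sph l r"
  using sph_lincomb3[OF continuous_on_add[OF assms(1) continuous_on_mult_left[OF assms(2)]] assms(3,4)]
  by (simp add: sph_lincomb2 assms)

lemma sph_sum:
  assumes "finite I" "\<And>i. i \<in> I \<Longrightarrow> continuous_on UNIV (f i)"
  shows "sph (\<lambda>x. \<Sum>i\<in>I. f i x) r = (\<Sum>i\<in>I. sph (f i) r)"
  using assms
proof (induction I rule: finite_induct)
  case (insert a I)
  then have "sph (\<lambda>x. f a x + (\<Sum>i\<in>I. f i x)) r = sph (f a) r + sph (\<lambda>x. \<Sum>i\<in>I. f i x) r"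
    by (intro sph_add continuous_on_sum) auto
  with insert show ?case by simp
qed (simp add: sph_def)

lemma sph_cong:
  assumes "r \<ge> 0" "\<And>x. norm x = r \<Longrightarrow> f x = g x"
  shows "sph f r = sph g r"
proof -
  have "shell y * f (r *\<^sub>R sgn y) = shell y * g (r *\<^sub>R sgn y)" for y :: "real^'a"
    using assms by (cases "y = 0") (auto simp: shell_inner norm_sgn)
  then show ?thesis unfolding sph_def by (intro Bochner_Integration.integral_cong) auto
qed

lemma sph_mono:
  assumes "r \<ge> 0" "\<And>x. norm x = r \<Longrightarrow> f x \<le> g x" "continuous_on UNIV f" "continuous_on UNIV g"
  shows "sph f r \<le> sph g r"
  unfolding sph_def
proof (intro integral_mono sph_integrable assms)
  show "shell y * f (r *\<^sub>R sgn y) \<le> shell y * g (r *\<^sub>R sgn y)" for y :: "real^'a"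
    using assms(1,2) by (cases "y = 0") (auto simp: shell_inner norm_sgn shell_nonneg mult_left_mono)
qed

lemma sph_nonneg:
  assumes "\<And>x. g x \<ge> 0" shows "sph g r \<ge> 0"
  unfolding sph_def by (intro integral_nonneg_AE AE_I2 mult_nonneg_nonneg shell_nonneg assms)

text \<open>Along the ray through y the derivative in r is the gradient paired with
  \<open>sgn y\<close>, that is, with x / r at the point x =
  \<open>r *\<^sub>R sgn y\<close>.\<close>

lemma sph_deriv:
  fixes g :: "real^'n::finite \<Rightarrow> real"
  assumes der: "\<And>x. (g has_derivative (\<lambda>v. \<gamma> x \<bullet> v)) (at x)" and cont: "continuous_on UNIV \<gamma>" and r: "r > 0"
  shows "(sph g has_real_derivative sph (\<lambda>x. \<gamma> x \<bullet> x) r / r) (at r)"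
proof -
  have contg: "continuous_on UNIV g"
    by (meson der continuous_at_imp_continuous_on has_derivative_continuous)
  have "bounded (\<gamma> ` cball 0 (2 * r))"
    by (intro compact_imp_bounded compact_continuous_image continuous_on_subset[OF cont]) auto
  then obtain L where L: "\<And>x. x \<in> cball 0 (2 * r) \<Longrightarrow> norm (\<gamma> x) \<le> L"
    by (force simp: bounded_iff)
  have eq: "(\<lambda>y. shell y * (\<gamma> (r *\<^sub>R sgn y) \<bullet> sgn y)) = (\<lambda>y. (1 / r) * (shell y * (\<gamma> (r *\<^sub>R sgn y) \<bullet> (r *\<^sub>R sgn y))))"
    using r by auto
  have contg': "continuous_on UNIV (\<lambda>x. \<gamma> x \<bullet> x)" by (intro continuous_intros cont)
  have "(sph g has_derivative (\<lambda>v. (\<integral>y. shell y * (\<gamma> (r *\<^sub>R sgn y) \<bullet> sgn y) \<partial>lborel) \<bullet> v)) (at r)"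
    unfolding sph_def[abs_def]
  proof (rule has_derivative_integral[where r = r and B = "\<lambda>y. \<bar>L\<bar> * shell y"])
    fix t assume t: "t \<in> ball r r"
    show "integrable lborel (\<lambda>y. shell y * g (t *\<^sub>R sgn y))" by (rule sph_integrable[OF contg])
    fix y :: "real^'n"
    have s: "norm (sgn y) \<le> 1" by (simp add: norm_sgn)
    have "\<bar>g (t *\<^sub>R sgn y) - g (r *\<^sub>R sgn y)\<bar> \<le> L * norm (t *\<^sub>R sgn y - r *\<^sub>R sgn y)"
    proof (rule gradient_lipschitz[OF convex_cball der L])
      show "t *\<^sub>R sgn y \<in> cball 0 (2 * r)" "r *\<^sub>R sgn y \<in> cball 0 (2 * r)"
        using s t r mult_mono[of "\<bar>t\<bar>" "2 * r" "norm (sgn y)" 1] by (auto simp: dist_real_def norm_sgn)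
    qed
    also have "\<dots> \<le> \<bar>L\<bar> * norm (t - r)"
    proof -
      have "norm (t *\<^sub>R sgn y - r *\<^sub>R sgn y) \<le> norm (t - r)"
        using s by (simp add: scaleR_left_diff_distrib[symmetric] mult_left_le)
      then show ?thesis by (intro mult_mono) auto
    qed
    finally have "shell y * \<bar>g (t *\<^sub>R sgn y) - g (r *\<^sub>R sgn y)\<bar> \<le> shell y * (\<bar>L\<bar> * norm (t - r))"
      by (rule mult_left_mono[OF _ shell_nonneg])
    then show "\<bar>shell y * g (t *\<^sub>R sgn y) - shell y * g (r *\<^sub>R sgn y)\<bar> \<le> \<bar>L\<bar> * shell y * norm (t - r)"
      by (simp add: right_diff_distrib[symmetric] abs_mult shell_nonneg mult_ac)
  next
    fix y :: "real^'n"
    have "((\<lambda>t. t *\<^sub>R sgn y) has_derivative (\<lambda>t. t *\<^sub>R sgn y)) (at r)" by (auto intro!: derivative_eq_intros)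
    from has_derivative_compose[OF this der]
    have "((\<lambda>t. g (t *\<^sub>R sgn y)) has_derivative (\<lambda>v. \<gamma> (r *\<^sub>R sgn y) \<bullet> (v *\<^sub>R sgn y))) (at r)" .
    then show "((\<lambda>t. shell y * g (t *\<^sub>R sgn y)) has_derivative (\<lambda>v. (shell y * (\<gamma> (r *\<^sub>R sgn y) \<bullet> sgn y)) \<bullet> v)) (at r)"
      by (auto intro!: derivative_eq_intros)
    have "\<bar>\<gamma> (r *\<^sub>R sgn y) \<bullet> sgn y\<bar> \<le> \<bar>L\<bar> * 1"
    proof -
      have "\<bar>\<gamma> (r *\<^sub>R sgn y) \<bullet> sgn y\<bar> \<le> norm (\<gamma> (r *\<^sub>R sgn y)) * norm (sgn y)" by (rule Cauchy_Schwarz_ineq2)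
      also have "\<dots> \<le> \<bar>L\<bar> * 1"
        using r by (intro mult_mono order_trans[OF L]) (auto simp: norm_sgn)
      finally show ?thesis .
    qed
    from mult_left_mono[OF this shell_nonneg[of y]]
    show "norm (shell y * (\<gamma> (r *\<^sub>R sgn y) \<bullet> sgn y)) \<le> \<bar>L\<bar> * shell y"
      by (simp add: abs_mult shell_nonneg mult_ac)
  next
    show "integrable lborel (\<lambda>y::real^'n. \<bar>L\<bar> * shell y)"
      using sph_integrable[of "\<lambda>_::real^'n. 1"] by simp
    show "(\<lambda>y. shell y * (\<gamma> (r *\<^sub>R sgn y) \<bullet> sgn y)) \<in> borel_measurable lborel"
      unfolding eq
      by (intro borel_measurable_times borel_measurable_const borel_measurable_integrable[OF sph_integrable[OF contg']])
  qed (rule r)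
  moreover have "(\<integral>y. shell y * (\<gamma> (r *\<^sub>R sgn y) \<bullet> sgn y) \<partial>lborel) = sph (\<lambda>x. \<gamma> x \<bullet> x) r / r"
    unfolding eq sph_def by (simp only: integral_mult_right_zero) simp
  ultimately show ?thesis by (simp only: has_field_derivative_def inner_real_def)
qed

lemma sgn_has_derivative:
  fixes y :: "'a::real_inner"
  assumes "y \<noteq> 0"
  shows "(sgn has_derivative (\<lambda>v. (v - (sgn y \<bullet> v) *\<^sub>R sgn y) /\<^sub>R norm y)) (at y)"
proof -
  have "((\<lambda>y. inverse (norm y) *\<^sub>R y) has_derivative (\<lambda>v. (v - (sgn y \<bullet> v) *\<^sub>R sgn y) /\<^sub>R norm y)) (at y)"
    using assms by (auto intro!: derivative_eq_intros has_derivative_norm[THEN has_derivative_eq_rhs]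
        simp: sgn_div_norm algebra_simps power2_eq_square inner_commute)
  then show ?thesis by (simp add: sgn_div_norm[abs_def])
qed

text \<open>Infinitesimal rotation invariance, which replaces integration by parts on the sphere.\<close>

lemma sph_rotation:
  fixes h :: "real^'n::finite \<Rightarrow> real"
  assumes der: "\<And>x. (h has_derivative (\<lambda>v. \<gamma> x \<bullet> v)) (at x)" and cont: "continuous_on UNIV \<gamma>" and r: "r > 0"
    and ij: "i \<noteq> j"
  shows "sph (\<lambda>x. x $ i * \<gamma> x $ j - x $ j * \<gamma> x $ i) r = 0"
proof -
  have conth: "continuous_on UNIV h"
    by (meson der continuous_at_imp_continuous_on has_derivative_continuous)
  \<comment> \<open>The values of \<open>h\<close> on the sphere of radius r, extended constantly
    along rays and cut off by \<open>shell\<close>: a compactly supported function on the whole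
    space.\<close>
  define F where "F y = shell y * h (r *\<^sub>R sgn y)" for y :: "real^'n"
  define \<Gamma> where "\<Gamma> y = (h (r *\<^sub>R sgn y) * shell' y) *\<^sub>R y
     + (shell y * (r / norm y)) *\<^sub>R (\<gamma> (r *\<^sub>R sgn y) - (\<gamma> (r *\<^sub>R sgn y) \<bullet> sgn y) *\<^sub>R sgn y)" for y :: "real^'n"
  have FD: "(F has_derivative (\<lambda>v. \<Gamma> y \<bullet> v)) (at y)" for y
  proof (cases "norm y < 1/2")
    case True
    then have "\<Gamma> y = 0" by (simp add: \<Gamma>_def shell_inner)
    moreover have "(F has_derivative (\<lambda>v. 0)) (at y)"
      by (rule has_derivative_transform_within_open[of "\<lambda>_. 0" _ _ _ "ball 0 (1/2)"]) (use True in \<open>auto simp: F_def shell_inner\<close>)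
    ultimately show ?thesis by simp
  next
    case False
    then have y: "y \<noteq> 0" by auto
    have "((\<lambda>y. r *\<^sub>R sgn y) has_derivative (\<lambda>v. r *\<^sub>R ((v - (sgn y \<bullet> v) *\<^sub>R sgn y) /\<^sub>R norm y))) (at y)"
      by (intro derivative_intros sgn_has_derivative y)
    from has_derivative_mult[OF shell_derivative has_derivative_compose[OF this der]]
    have "(F has_derivative (\<lambda>v. shell y * (\<gamma> (r *\<^sub>R sgn y) \<bullet> r *\<^sub>R ((v - (sgn y \<bullet> v) *\<^sub>R sgn y) /\<^sub>R norm y))
        + ((shell' y *\<^sub>R y) \<bullet> v) * h (r *\<^sub>R sgn y))) (at y)"
      unfolding F_def[abs_def] .
    then show ?thesis
      by (rule has_derivative_eq_rhs)
         (auto simp: \<Gamma>_def inner_add_left inner_diff_left inner_diff_right algebra_simps divide_inverse)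
  qed
  have cont\<Gamma>: "continuous_on UNIV \<Gamma>"
  proof -
    have "continuous_on (ball 0 (1/2)) \<Gamma>"
      by (rule continuous_on_eq[of _ "\<lambda>_. 0"]) (auto simp: \<Gamma>_def shell_inner)
    moreover have "continuous_on (- {0}) \<Gamma>"
      unfolding \<Gamma>_def
      by (intro continuous_intros continuous_shell continuous_on_compose2[OF conth]
          continuous_on_compose2[OF cont] continuous_on_sgn_ne0) auto
    ultimately have "continuous_on (ball 0 (1/2) \<union> - {0}) \<Gamma>"
      by (intro continuous_on_open_Un) auto
    moreover have "ball 0 (1/2) \<union> - {0} = (UNIV :: (real^'n) set)" by auto
    ultimately show ?thesis by simp
  qed
  have contF: "continuous_on UNIV F"
    by (meson FD continuous_at_imp_continuous_on has_derivative_continuous)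
  have F0: "F y = 0" if "y \<notin> cball 0 2" for y using shell_outer[OF that] by (simp add: F_def)
  have \<Gamma>0: "\<Gamma> y = 0" if "y \<notin> cball 0 2" for y using gradient_outside_support[OF FD F0 that] .
  \<comment> \<open>The gradient of \<open>y $ a * F y\<close> has integral 0. Its component b is
    \<open>y $ a * \<Gamma> y $ b\<close> alone, because the other term of the product rule sits in
    component a.\<close>
  have part: "integrable lborel (\<lambda>y. y $ a * \<Gamma> y $ b) \<and> (\<integral>y. y $ a * \<Gamma> y $ b \<partial>lborel) = 0" if "a \<noteq> b" for a b
  proof -
    have D: "((\<lambda>y. y $ a * F y) has_derivative (\<lambda>v. (y $ a *\<^sub>R \<Gamma> y + F y *\<^sub>R axis a 1) \<bullet> v)) (at y)" for y
      by (auto intro!: derivative_eq_intros FD bounded_linear_imp_has_derivative bounded_linear_vec_nth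
          simp: inner_add_left inner_axis' algebra_simps)
    have C: "continuous_on UNIV (\<lambda>y. y $ a *\<^sub>R \<Gamma> y + F y *\<^sub>R axis a 1)"
      by (intro continuous_intros cont\<Gamma> contF continuous_on_component)
    have int: "integrable lborel (\<lambda>y. y $ a *\<^sub>R \<Gamma> y + F y *\<^sub>R axis a 1)"
      by (rule continuous_support_integrable[OF C, of 0 2]) (simp add: F0 \<Gamma>0)
    have 0: "(\<integral>y. y $ a *\<^sub>R \<Gamma> y + F y *\<^sub>R axis a 1 \<partial>lborel) = 0"
      by (rule integral_gradient_eq_0[OF D C, of 2]) (simp add: F0)
    show ?thesis
      using integrable_bounded_linear[OF bounded_linear_vec_nth[of b] int]
        integral_bounded_linear[OF bounded_linear_vec_nth[of b] int] 0 that by (simp add: axis_def)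
  qed
  \<comment> \<open>The radial parts of \<open>\<Gamma>\<close> drop out of the antisymmetric
    combination, and r / |y| turns y into \<open>r *\<^sub>R sgn y\<close>.\<close>
  have "shell y * ((r *\<^sub>R sgn y) $ i * \<gamma> (r *\<^sub>R sgn y) $ j - (r *\<^sub>R sgn y) $ j * \<gamma> (r *\<^sub>R sgn y) $ i)
      = y $ i * \<Gamma> y $ j - y $ j * \<Gamma> y $ i" for y
    by (cases "y = 0") (auto simp: shell_inner \<Gamma>_def sgn_div_norm field_simps)
  then show ?thesis
    unfolding sph_def using part[OF ij] part[OF ij[symmetric]] by simp
qed

section \<open>Rellich uniqueness outside a ball\<close>

lemma symmetric_matrix_inner:
  fixes A :: "real^'n^'n"
  assumes "\<And>i j. A $ i $ j = A $ j $ i"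
  shows "(A *v u) \<bullet> v = u \<bullet> (A *v v)"
proof -
  have "(A *v u) \<bullet> v = (\<Sum>i\<in>UNIV. \<Sum>j\<in>UNIV. A $ i $ j * u $ j * v $ i)"
    by (simp add: inner_vec_def matrix_vector_mult_def sum_distrib_right)
  also have "\<dots> = (\<Sum>j\<in>UNIV. \<Sum>i\<in>UNIV. A $ i $ j * u $ j * v $ i)" by (rule sum.swap)
  also have "\<dots> = u \<bullet> (A *v v)"
    using assms by (simp add: inner_vec_def matrix_vector_mult_def sum_distrib_left mult_ac)
  finally show ?thesis .
qed

locale exterior_solution =
  fixes W :: "real^'n::finite \<Rightarrow> real" and G :: "real^'n \<Rightarrow> real^'n" and H :: "real^'n \<Rightarrow> real^'n^'n"
    and R k C :: real
  assumes R: "R > 0" and k: "k > 0"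
    and dW: "\<And>x. (W has_derivative (\<lambda>v. G x \<bullet> v)) (at x)"
    and dG: "\<And>x i. ((\<lambda>x. G x $ i) has_derivative (\<lambda>v. H x $ i \<bullet> v)) (at x)"
    and contH: "continuous_on UNIV H"
    and symH: "\<And>x i j. H x $ i $ j = H x $ j $ i"
    and eq: "\<And>x. norm x > R \<Longrightarrow> (\<Sum>i\<in>UNIV. H x $ i $ i) = - k\<^sup>2 * W x"
    and decayW: "\<And>x. norm x > R \<Longrightarrow> norm x ^ CARD('n) * (W x)\<^sup>2 \<le> C"
    and decayG: "\<And>x. norm x > R \<Longrightarrow> norm x ^ CARD('n) * (norm (G x))\<^sup>2 \<le> C"
begin

lemma contW: "continuous_on UNIV W"
  by (meson dW continuous_at_imp_continuous_on has_derivative_continuous)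

lemma dG_vec: "(G has_derivative (\<lambda>v. H x *v v)) (at x)"
  unfolding has_derivative_componentwise_within[of G]
  by (auto simp: Basis_vec_def inner_axis matrix_vector_mul_component intro!: dG)

lemma contG: "continuous_on UNIV G"
  by (meson dG_vec continuous_at_imp_continuous_on has_derivative_continuous)

lemma contHv: "continuous_on UNIV v \<Longrightarrow> continuous_on UNIV (\<lambda>x. H x *v v x)"
  unfolding matrix_vector_mult_def by (intro continuous_intros continuous_on_vec_lambda contH)

abbreviation "DW x \<equiv> x \<bullet> G x"

lemma dDW: "(DW has_derivative (\<lambda>v. (G x + H x *v x) \<bullet> v)) (at x)"
proof -
  have "(DW has_derivative (\<lambda>v. x \<bullet> (H x *v v) + v \<bullet> G x)) (at x)"
    by (auto intro!: derivative_eq_intros dG_vec)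
  then show ?thesis
    using symmetric_matrix_inner[of "H x", OF symH]
    by (simp add: inner_add_left inner_add_right inner_commute add.commute)
qed

text \<open>Green's formula on the sphere. With the angular derivatives L_ij = x_i d_j - x_j d_i,
  each L_ij (Z L_ij W) has mean 0 by \<open>sph_rotation\<close>. Summed over ordered pairs they are
  twice the integrand: the angular gradients of Z and W paired with each other, plus Z times the
  spherical Laplacian of W, scaled by r^2 and expressed through the Hessian.\<close>

lemma green:
  assumes dZ: "\<And>x. (Z has_derivative (\<lambda>v. \<zeta> x \<bullet> v)) (at x)" and contZ: "continuous_on UNIV \<zeta>" and r: "r > 0"
  shows "sph (\<lambda>x. (x \<bullet> x) * (\<zeta> x \<bullet> G x) - (x \<bullet> \<zeta> x) * DW x +
     Z x * ((x \<bullet> x) * (\<Sum>i\<in>UNIV. H x $ i $ i) - (real CARD('n) - 1) * DW x - x \<bullet> (H x *v x))) r = 0"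
    (is "sph ?g r = 0")
proof -
  have contZ0: "continuous_on UNIV Z"
    by (meson dZ continuous_at_imp_continuous_on has_derivative_continuous)
  define q where "q i j x = (x $ i * G x $ j - x $ j * G x $ i) *\<^sub>R \<zeta> x +
     Z x *\<^sub>R (G x $ j *\<^sub>R axis i 1 + x $ i *\<^sub>R H x $ j - G x $ i *\<^sub>R axis j 1 - x $ j *\<^sub>R H x $ i)" for i j x
  have dq: "((\<lambda>x. Z x * (x $ i * G x $ j - x $ j * G x $ i)) has_derivative (\<lambda>v. q i j x \<bullet> v)) (at x)" for i j x
    unfolding q_def
    by (auto intro!: derivative_eq_intros dZ dG bounded_linear_imp_has_derivative bounded_linear_vec_nth
        simp: inner_add_left inner_diff_left inner_axis' algebra_simps)
  have contq: "continuous_on UNIV (q i j)" for i j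
    unfolding q_def by (intro continuous_intros contZ contZ0 continuous_on_component contG contH)
  define T where "T i j x = x $ i * q i j x $ j - x $ j * q i j x $ i" for i j x
  have contT: "continuous_on UNIV (T i j)" for i j
    unfolding T_def by (intro continuous_intros continuous_on_component contq)
  have T0: "sph (T i j) r = 0" for i j
  proof (cases "i = j")
    case True
    then show ?thesis by (simp add: T_def sph_def)
  next
    case False
    from sph_rotation[OF dq contq r False] show ?thesis unfolding T_def .
  qed
  have "sph (\<lambda>x. \<Sum>i\<in>UNIV. \<Sum>j\<in>UNIV. T i j x) r = (\<Sum>i\<in>UNIV. sph (\<lambda>x. \<Sum>j\<in>UNIV. T i j x) r)"
    by (intro sph_sum continuous_on_sum contT) auto
  also have "\<dots> = (\<Sum>i\<in>UNIV. \<Sum>j\<in>UNIV. sph (T i j) r)"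
    by (intro sum.cong sph_sum contT) auto
  finally have "sph (\<lambda>x. \<Sum>i\<in>UNIV. \<Sum>j\<in>UNIV. T i j x) r = 0" by (simp add: T0)
  moreover have "(\<Sum>i\<in>UNIV. \<Sum>j\<in>UNIV. T i j x) = 2 * ?g x" for x
  proof -
    have "T i j x = (x $ i * x $ i) * (\<zeta> x $ j * G x $ j) - (x $ i * G x $ i) * (x $ j * \<zeta> x $ j)
       - (x $ i * \<zeta> x $ i) * (x $ j * G x $ j) + (\<zeta> x $ i * G x $ i) * (x $ j * x $ j)
       + Z x * ((if j = i then 2 * (x $ i * G x $ i) else 0) + (x $ i * x $ i) * H x $ j $ j
           - (x $ i * G x $ i) * 1 - 1 * (x $ j * G x $ j) + H x $ i $ i * (x $ j * x $ j)
           - x $ i * (H x $ i $ j * x $ j) - x $ i * (H x $ i $ j * x $ j))" for i j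
      using symH[of x i j] by (simp add: T_def q_def axis_def algebra_simps)
    then have "(\<Sum>i\<in>UNIV. \<Sum>j\<in>UNIV. T i j x) = 
       (x \<bullet> x) * (\<zeta> x \<bullet> G x) - DW x * (x \<bullet> \<zeta> x) - (x \<bullet> \<zeta> x) * DW x + (\<zeta> x \<bullet> G x) * (x \<bullet> x)
       + Z x * (2 * DW x + (x \<bullet> x) * (\<Sum>i\<in>UNIV. H x $ i $ i) - DW x * real CARD('n) - real CARD('n) * DW x
         + (\<Sum>i\<in>UNIV. H x $ i $ i) * (x \<bullet> x) - x \<bullet> (H x *v x) - x \<bullet> (H x *v x))"
      by (simp only: sum.distrib sum_subtractf sum_distrib_left[symmetric] sum_distrib_right[symmetric] sum.delta
          finite_UNIV UNIV_I if_True inner_vec_def inner_real_def matrix_vector_mult_def vec_lambda_beta)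
         (simp add: sum_distrib_left)
    then show ?thesis by (simp add: algebra_simps)
  qed
  ultimately have "sph (\<lambda>x. 2 * ?g x) r = 0" by simp
  then show ?thesis unfolding sph_cmult by simp
qed

definition "n0 = sph (\<lambda>x. (W x)\<^sup>2)"
definition "n01 = sph (\<lambda>x. W x * DW x)"
definition "n1 = sph (\<lambda>x. (DW x)\<^sup>2)"
definition "nX = sph (\<lambda>x. (x \<bullet> x) * (G x \<bullet> G x) - (DW x)\<^sup>2)"
text \<open>\<open>nW\<close> and \<open>nD\<close> contain the second radial derivative and are to
  be eliminated by \<open>green\<close>.\<close>

definition "nW = sph (\<lambda>x. W x * (x \<bullet> (H x *v x)))"
definition "nD = sph (\<lambda>x. DW x * (x \<bullet> (H x *v x)))"

lemma contHx: "continuous_on UNIV (\<lambda>x. H x *v x)" "continuous_on UNIV (\<lambda>x. H x *v G x)"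
  by (intro contHv continuous_intros contG)+

lemma dn0: assumes r: "r > 0" shows "(n0 has_real_derivative 2 * n01 r / r) (at r)"
proof -
  have "((\<lambda>x. (W x)\<^sup>2) has_derivative (\<lambda>v. ((2 * W x) *\<^sub>R G x) \<bullet> v)) (at x)" for x
    by (auto intro!: derivative_eq_intros dW simp: algebra_simps)
  moreover have "continuous_on UNIV (\<lambda>x. (2 * W x) *\<^sub>R G x)" by (intro continuous_intros contW contG)
  ultimately have "(n0 has_real_derivative sph (\<lambda>x. ((2 * W x) *\<^sub>R G x) \<bullet> x) r / r) (at r)"
    unfolding n0_def using r by (rule sph_deriv)
  moreover have "sph (\<lambda>x. ((2 * W x) *\<^sub>R G x) \<bullet> x) r = sph (\<lambda>x. 2 * (W x * DW x)) r"
    by (simp add: inner_commute mult_ac)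
  ultimately show ?thesis by (simp add: sph_cmult n01_def)
qed

text \<open>\<open>green\<close> with Z = W, where the equation replaces the trace of the Hessian by
  \<open>- k\<^sup>2 * W x\<close>.\<close>

lemma nW_eq: assumes r: "r > R"
  shows "nW r = nX r - k\<^sup>2 * r\<^sup>2 * n0 r - (real CARD('n) - 1) * n01 r"
proof -
  have r0: "r > 0" using R r by simp
  have "0 = sph (\<lambda>x. (x \<bullet> x) * (G x \<bullet> G x) - DW x * DW x +
     W x * ((x \<bullet> x) * (\<Sum>i\<in>UNIV. H x $ i $ i) - (real CARD('n) - 1) * DW x - x \<bullet> (H x *v x))) r"
    using green[OF dW contG r0] by simp
  also have "\<dots> = sph (\<lambda>x. ((x \<bullet> x) * (G x \<bullet> G x) - (DW x)\<^sup>2) + (- (k\<^sup>2 * r\<^sup>2)) * (W x)\<^sup>2 +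
      (- (real CARD('n) - 1)) * (W x * DW x) + (-1) * (W x * (x \<bullet> (H x *v x)))) r"
    using r r0 eq by (intro sph_cong) (auto simp: dot_square_norm power2_eq_square algebra_simps)
  also have "\<dots> = nX r + - (k\<^sup>2 * r\<^sup>2) * n0 r + - (real CARD('n) - 1) * n01 r + (-1) * nW r"
    unfolding nX_def n0_def n01_def nW_def
    by (rule sph_lincomb4) (intro continuous_intros contW contG contHx)+
  finally show ?thesis by (simp add: algebra_simps)
qed

lemma dn01: assumes r: "r > R"
  shows "(n01 has_real_derivative (n1 r - (real CARD('n) - 2) * n01 r - k\<^sup>2 * r\<^sup>2 * n0 r + nX r) / r) (at r)"
proof -
  have r0: "r > 0" using R r by simp
  have "((\<lambda>x. W x * DW x) has_derivative (\<lambda>v. (DW x *\<^sub>R G x + W x *\<^sub>R (G x + H x *v x)) \<bullet> v)) (at x)" for x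
    by (auto intro!: has_derivative_eq_rhs[OF has_derivative_mult[OF dW dDW]] simp: inner_add_left algebra_simps)
  moreover have "continuous_on UNIV (\<lambda>x. DW x *\<^sub>R G x + W x *\<^sub>R (G x + H x *v x))"
    by (intro continuous_intros contW contG contHx)
  ultimately have "(n01 has_real_derivative sph (\<lambda>x. (DW x *\<^sub>R G x + W x *\<^sub>R (G x + H x *v x)) \<bullet> x) r / r) (at r)"
    unfolding n01_def using r0 by (rule sph_deriv)
  moreover have "sph (\<lambda>x. (DW x *\<^sub>R G x + W x *\<^sub>R (G x + H x *v x)) \<bullet> x) r
      = sph (\<lambda>x. (DW x)\<^sup>2 + 1 * (W x * DW x) + 1 * (W x * (x \<bullet> (H x *v x)))) r"
    by (simp add: inner_add_left inner_commute power2_eq_square algebra_simps)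
  moreover have "\<dots> = n1 r - (real CARD('n) - 2) * n01 r - k\<^sup>2 * r\<^sup>2 * n0 r + nX r"
  proof -
    have "sph (\<lambda>x. (DW x)\<^sup>2 + 1 * (W x * DW x) + 1 * (W x * (x \<bullet> (H x *v x)))) r = n1 r + 1 * n01 r + 1 * nW r"
      unfolding n1_def n01_def nW_def
      by (rule sph_lincomb3) (intro continuous_intros contW contG contHx)+
    then show ?thesis by (simp add: nW_eq[OF r] algebra_simps)
  qed
  ultimately show ?thesis by (simp only:)
qed

text \<open>A Rellich identity on spheres. The derivative of radial minus angular energy contains
  \<open>nD\<close> and a mean with x . (H G); \<open>green\<close> with Z = x . G expresses the
  latter through \<open>nD\<close> in just the proportion that makes both disappear.\<close>

lemma dE: assumes r: "r > R"
  shows "((\<lambda>r. n1 r - nX r) has_real_derivative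
     (- 2 * (real CARD('n) - 2) * n1 r - 2 * k\<^sup>2 * r\<^sup>2 * n01 r) / r) (at r)"
proof -
  have r0: "r > 0" using R r by simp
  define \<gamma> where "\<gamma> x = (4 * DW x) *\<^sub>R (G x + H x *v x) - (2 * (G x \<bullet> G x)) *\<^sub>R x - (2 * (x \<bullet> x)) *\<^sub>R (H x *v G x)" for x
  have d2: "((\<lambda>x. G x \<bullet> G x) has_derivative (\<lambda>v. (2 *\<^sub>R (H x *v G x)) \<bullet> v)) (at x)" for x
    using symmetric_matrix_inner[of "H x", OF symH]
    by (auto intro!: derivative_eq_intros dG_vec simp: inner_commute)
  have d3: "((\<lambda>x. x \<bullet> x) has_derivative (\<lambda>v. (2 *\<^sub>R x) \<bullet> v)) (at x)" for x :: "real^'n"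
    by (auto intro!: derivative_eq_intros simp: inner_commute)
  have d4: "((\<lambda>x. (DW x)\<^sup>2) has_derivative (\<lambda>v. ((2 * DW x) *\<^sub>R (G x + H x *v x)) \<bullet> v)) (at x)" for x
    unfolding power2_eq_square
    by (auto intro!: has_derivative_eq_rhs[OF has_derivative_mult[OF dDW dDW]] simp: inner_add_left algebra_simps)
  have d\<gamma>: "((\<lambda>x. 2 * (DW x)\<^sup>2 - (x \<bullet> x) * (G x \<bullet> G x)) has_derivative (\<lambda>v. \<gamma> x \<bullet> v)) (at x)" for x
    by (auto intro!: has_derivative_eq_rhs[OF has_derivative_diff[OF has_derivative_mult_right[OF d4] has_derivative_mult[OF d3 d2]]]
        simp: \<gamma>_def inner_add_left inner_diff_left algebra_simps)
  have cont\<gamma>: "continuous_on UNIV \<gamma>"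
    unfolding \<gamma>_def by (intro continuous_intros contG contHx)
  have "n1 r' - nX r' = sph (\<lambda>x. 2 * (DW x)\<^sup>2 - (x \<bullet> x) * (G x \<bullet> G x)) r'" for r'
  proof -
    have "sph (\<lambda>x. (DW x)\<^sup>2 + (-1) * ((x \<bullet> x) * (G x \<bullet> G x) - (DW x)\<^sup>2)) r' = n1 r' + (-1) * nX r'"
      unfolding n1_def nX_def
      by (rule sph_lincomb2) (intro continuous_intros contG)+
    moreover have "(\<lambda>x. (DW x)\<^sup>2 + (-1) * ((x \<bullet> x) * (G x \<bullet> G x) - (DW x)\<^sup>2)) = (\<lambda>x. 2 * (DW x)\<^sup>2 - (x \<bullet> x) * (G x \<bullet> G x))"
      by auto
    ultimately show ?thesis by simp
  qed
  with sph_deriv[OF d\<gamma> cont\<gamma> r0]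
  have main: "((\<lambda>r. n1 r - nX r) has_real_derivative sph (\<lambda>x. \<gamma> x \<bullet> x) r / r) (at r)" by simp
  have \<gamma>_eq: "sph (\<lambda>x. \<gamma> x \<bullet> x) r = 4 * n1 r + 4 * nD r + (-2) * sph (\<lambda>x. (x \<bullet> x) * (G x \<bullet> G x + x \<bullet> (H x *v G x))) r"
  proof -
    have "(\<lambda>x. \<gamma> x \<bullet> x) = (\<lambda>x. 4 * (DW x)\<^sup>2 + 4 * (DW x * (x \<bullet> (H x *v x))) + (-2) * ((x \<bullet> x) * (G x \<bullet> G x + x \<bullet> (H x *v G x))))"
      by (auto simp: \<gamma>_def inner_add_left inner_diff_left inner_commute power2_eq_square algebra_simps)
    moreover have "sph \<dots> r = sph (\<lambda>x. 4 * (DW x)\<^sup>2) r + 4 * nD r + (-2) * sph (\<lambda>x. (x \<bullet> x) * (G x \<bullet> G x + x \<bullet> (H x *v G x))) r"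
      unfolding nD_def by (rule sph_lincomb3) (intro continuous_intros contG contHx)+
    ultimately show ?thesis by (simp only: n1_def sph_cmult)
  qed
  have contS: "continuous_on UNIV (\<lambda>x. G x + H x *v x)" by (intro continuous_intros contG contHx)
  have "0 = sph (\<lambda>x. (x \<bullet> x) * ((G x + H x *v x) \<bullet> G x) - (x \<bullet> (G x + H x *v x)) * DW x +
     DW x * ((x \<bullet> x) * (\<Sum>i\<in>UNIV. H x $ i $ i) - (real CARD('n) - 1) * DW x - x \<bullet> (H x *v x))) r"
    using green[OF dDW contS r0] by simp
  also have "\<dots> = sph (\<lambda>x. ((x \<bullet> x) * (G x \<bullet> G x + x \<bullet> (H x *v G x))) + (- real CARD('n)) * (DW x)\<^sup>2 +
      (- (k\<^sup>2 * r\<^sup>2)) * (W x * DW x) + (-2) * (DW x * (x \<bullet> (H x *v x)))) r"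
    using r r0 eq symmetric_matrix_inner[of "H _", OF symH]
    by (intro sph_cong) (auto simp: dot_square_norm power2_eq_square inner_add_left inner_add_right algebra_simps)
  also have "\<dots> = sph (\<lambda>x. (x \<bullet> x) * (G x \<bullet> G x + x \<bullet> (H x *v G x))) r + - real CARD('n) * n1 r +
      - (k\<^sup>2 * r\<^sup>2) * n01 r + (-2) * nD r"
    unfolding n1_def n01_def nD_def
    by (rule sph_lincomb4) (intro continuous_intros contW contG contHx)+
  finally have "sph (\<lambda>x. (x \<bullet> x) * (G x \<bullet> G x + x \<bullet> (H x *v G x))) r = real CARD('n) * n1 r + k\<^sup>2 * r\<^sup>2 * n01 r + 2 * nD r"
    by simp
  then have "sph (\<lambda>x. \<gamma> x \<bullet> x) r = - 2 * (real CARD('n) - 2) * n1 r - 2 * k\<^sup>2 * r\<^sup>2 * n01 r"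
    unfolding \<gamma>_eq by (simp add: algebra_simps)
  with main show ?thesis by simp
qed

lemma decay_sph:
  fixes g :: "real^'n \<Rightarrow> real"
  assumes r: "r > R" and g: "continuous_on UNIV g" "\<And>x. norm x = r \<Longrightarrow> r ^ CARD('n) * g x \<le> C * a"
  shows "r ^ CARD('n) * sph g r \<le> (C * sph (\<lambda>_::real^'n. 1) 1) * a"
proof -
  have "sph (\<lambda>x. r ^ CARD('n) * g x) r \<le> sph (\<lambda>x::real^'n. (C * a) * 1) r"
    using R r g by (intro sph_mono continuous_intros) auto
  also have "\<dots> = (C * a) * sph (\<lambda>_::real^'n. 1) r" by (rule sph_cmult)
  also have "sph (\<lambda>_::real^'n. 1) r = sph (\<lambda>_::real^'n. 1) 1" by (simp add: sph_def)
  finally show ?thesis unfolding sph_cmult by (simp add: mult_ac)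
qed

sublocale radial_energy n0 n01 n1 nX R k "C * sph (\<lambda>_::real^'n. 1) 1" "CARD('n)"
proof
  show "R > 0" "k > 0" by (fact R, fact k)
  show "1 \<le> CARD('n)" using zero_less_card_finite by (metis One_nat_def Suc_leI)
  fix r
  { assume r: "r > R"
    show "(n0 has_real_derivative 2 * n01 r / r) (at r)" using dn0 r R by simp
    show "(n01 has_real_derivative (n1 r - (real CARD('n) - 2) * n01 r - k\<^sup>2 * r\<^sup>2 * n0 r + nX r) / r) (at r)"
      by (rule dn01[OF r])
    show "((\<lambda>r. n1 r - nX r) has_real_derivative
      (- 2 * (real CARD('n) - 2) * n1 r - 2 * k\<^sup>2 * r\<^sup>2 * n01 r) / r) (at r)" by (rule dE[OF r])
    show "r ^ CARD('n) * n0 r \<le> C * sph (\<lambda>_::real^'n. 1) 1"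
      unfolding n0_def using decay_sph[OF r, of "\<lambda>x. (W x)\<^sup>2" 1] decayW r
      by (auto intro!: continuous_intros contW)
    show "r ^ CARD('n) * n1 r \<le> C * sph (\<lambda>_::real^'n. 1) 1 * r\<^sup>2"
      unfolding n1_def
    proof (rule decay_sph[OF r])
      show "continuous_on UNIV (\<lambda>x. (DW x)\<^sup>2)" by (intro continuous_intros contG)
      fix x :: "real^'n" assume x: "norm x = r"
      have "(DW x)\<^sup>2 \<le> r\<^sup>2 * (norm (G x))\<^sup>2"
        using Cauchy_Schwarz_ineq[of x "G x"] x by (simp add: dot_square_norm)
      then have "r ^ CARD('n) * (DW x)\<^sup>2 \<le> r ^ CARD('n) * (r\<^sup>2 * (norm (G x))\<^sup>2)"
        using r R by (intro mult_left_mono) auto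
      also have "\<dots> = (r ^ CARD('n) * (norm (G x))\<^sup>2) * r\<^sup>2" by simp
      also have "\<dots> \<le> C * r\<^sup>2" using decayG[of x] x r by (intro mult_right_mono) auto
      finally show "r ^ CARD('n) * (DW x)\<^sup>2 \<le> C * r\<^sup>2" .
    qed
  }
  show "n0 r \<ge> 0" unfolding n0_def by (rule sph_nonneg) simp
  show "nX r \<ge> 0" unfolding nX_def
    by (rule sph_nonneg) (use Cauchy_Schwarz_ineq in \<open>simp add: power2_eq_square\<close>)
  fix b
  have "0 \<le> sph (\<lambda>x. (DW x + b * W x)\<^sup>2) r" by (rule sph_nonneg) simp
  also have "\<dots> = sph (\<lambda>x. (DW x)\<^sup>2 + (2 * b) * (W x * DW x) + b\<^sup>2 * (W x)\<^sup>2) r"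
    by (simp add: power2_eq_square algebra_simps)
  also have "\<dots> = n1 r + (2 * b) * n01 r + b\<^sup>2 * n0 r"
    unfolding n1_def n01_def n0_def
    by (rule sph_lincomb3) (intro continuous_intros contW contG)+
  finally show "n1 r + 2 * b * n01 r + b\<^sup>2 * n0 r \<ge> 0" by simp
qed

text \<open>\<open>n0\<close> vanishes at r = |x|, hence so does its continuous nonnegative
  integrand, whose weight is positive at \<open>sgn x\<close>.\<close>

lemma rellich_vanishing:
  assumes x: "norm x > R"
  shows "W x = 0"
proof -
  define r where "r = norm x"
  have r: "r > R" "r > 0" using x R by (auto simp: r_def)
  define f where "f y = shell y * (W (r *\<^sub>R sgn y))\<^sup>2" for y
  have contf: "continuous_on UNIV f"
    using continuous_shell_times[of "\<lambda>x. (W x)\<^sup>2" r] contW unfolding f_def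
    by (auto intro: continuous_intros)
  have "integrable lborel f" unfolding f_def
    by (rule sph_integrable) (intro continuous_intros contW)
  moreover have "(\<integral>y. f y \<partial>lborel) = 0" using n0_zero[OF r(1)] by (simp add: n0_def sph_def f_def)
  ultimately have "f (sgn x) = 0"
    by (intro continuous_nonneg_integral_0[OF contf]) (auto simp: f_def shell_nonneg)
  moreover have "x = r *\<^sub>R sgn x" using r by (simp add: r_def sgn_div_norm)
  moreover have "norm (sgn x) = 1" using r by (auto simp: r_def norm_sgn)
  moreover from this have "sgn (sgn x) = sgn x" by (simp add: sgn_div_norm[of "sgn x"])
  ultimately show ?thesis
    using shell_pos[of "sgn x"] by (simp add: f_def)
qed

end

section \<open>Unique continuation up to a convex set\<close>

lemma norm_convolution_le:
  fixes w :: "'a::euclidean_space \<Rightarrow> real" and \<kappa> :: "'a \<Rightarrow> 'b::euclidean_space"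
  assumes w: "continuous_on UNIV w" and \<kappa>: "continuous_on UNIV \<kappa>"
    and supp: "\<And>x. x \<notin> cball 0 \<delta> \<Longrightarrow> \<kappa> x = 0" and L: "\<And>x. norm (\<kappa> x) \<le> L"
    and S: "\<And>y. y \<in> cball x \<delta> \<Longrightarrow> \<bar>w y\<bar> \<le> S" "S \<ge> 0"
  shows "norm (\<integral>y. w y *\<^sub>R \<kappa> (x - y) \<partial>lborel) \<le> S * (L * measure lborel (cball (0::'a) \<delta>))"
proof -
  have L0: "L \<ge> 0" using L[of 0] norm_ge_zero order_trans by blast
  have le: "norm (w y *\<^sub>R \<kappa> (x - y)) \<le> indicator (cball x \<delta>) y * (S * L)" for y
  proof (cases "y \<in> cball x \<delta>")
    case True
    then show ?thesis using S L by (simp add: mult_mono')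
  next
    case False
    then have "x - y \<notin> cball 0 \<delta>" by (simp add: dist_norm norm_minus_commute)
    then show ?thesis using supp S(2) L0 by simp
  qed
  have int: "integrable lborel (\<lambda>y. indicator (cball x \<delta>) y * (S * L))"
    by (intro integrable_mult_left integrable_real_indicator) (use emeasure_lborel_cball_finite in auto)
  have "norm (\<integral>y. w y *\<^sub>R \<kappa> (x - y) \<partial>lborel) \<le> (\<integral>y. norm (w y *\<^sub>R \<kappa> (x - y)) \<partial>lborel)"
    by (rule integral_norm_bound)
  also have "\<dots> \<le> (\<integral>y. indicator (cball x \<delta>) y * (S * L) \<partial>lborel)"
  proof (rule integral_mono[OF _ int le])
    have "continuous_on UNIV (\<lambda>y. w y *\<^sub>R \<kappa> (x - y))"
      by (intro continuous_intros w continuous_on_compose2[OF \<kappa>]) (auto intro!: continuous_intros)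
    then have "integrable lborel (\<lambda>y. w y *\<^sub>R \<kappa> (x - y))"
    proof (rule continuous_support_integrable)
      fix y assume "y \<notin> cball x \<delta>"
      then have "x - y \<notin> cball 0 \<delta>" by (simp add: dist_norm norm_minus_commute)
      then show "w y *\<^sub>R \<kappa> (x - y) = 0" using supp by simp
    qed
    then show "integrable lborel (\<lambda>y. norm (w y *\<^sub>R \<kappa> (x - y)))" by (rule integrable_norm)
  qed
  also have "\<dots> = S * (L * measure lborel (cball (0::'a) \<delta>))"
    using emeasure_lborel_cball_finite[of x \<delta>] by (cases "\<delta> \<ge> 0") (auto simp: content_cball mult_ac)
  finally show ?thesis .
qed

lemma smooth_continuous: "smooth f \<Longrightarrow> continuous_on UNIV f"
  using Ck_continuous by (auto simp: smooth_def)

lemma smooth_gradient_continuous: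
  assumes "smooth f"
  obtains g where "\<And>x. (f has_derivative (\<lambda>v. g x \<bullet> v)) (at x)" "continuous_on UNIV g"
proof -
  obtain g where g: "\<And>x. (f has_derivative (\<lambda>v. g x \<bullet> v)) (at x)"
    using smooth_has_gradient[OF assms] by blast
  have "continuous_on UNIV (\<lambda>x. \<chi> i. g x $ i)"
    by (intro continuous_on_vec_lambda smooth_continuous smooth_gradient[OF assms g])
  then have c: "continuous_on UNIV g" by simp
  show ?thesis by (rule that[OF g c])
qed

lemma continuous_convolution:
  assumes w: "continuous_on UNIV w" and \<kappa>: "smooth \<kappa>" and supp: "\<And>x. x \<notin> cball 0 R \<Longrightarrow> \<kappa> x = 0"
  shows "continuous_on UNIV (\<lambda>x. \<integral>y. w y * \<kappa> (x - y) \<partial>lborel)"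
proof -
  obtain g where g: "\<And>x. (\<kappa> has_derivative (\<lambda>v. g x \<bullet> v)) (at x)" "continuous_on UNIV g"
    using smooth_gradient_continuous[OF \<kappa>] by blast
  show ?thesis
    using has_derivative_convolution[OF w g supp]
    by (meson continuous_at_imp_continuous_on has_derivative_continuous)
qed

section \<open>A smooth kernel supported in a ball\<close>

context
  fixes \<delta> :: real
begin

text \<open>The kernel is not normalized: only its sign, support and derivatives matter.
  \<open>moll j\<close> uses the derivative of order j of the profile; \<open>moll1\<close> and
  \<open>moll2\<close> are gradient and Hessian of \<open>moll 0\<close>.\<close>

definition moll :: "nat \<Rightarrow> real^'n::finite \<Rightarrow> real" where
  "moll j x = bump j (\<delta>\<^sup>2 - x \<bullet> x)"

definition moll1 :: "real^'n::finite \<Rightarrow> real^'n" where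
  "moll1 x = (-2 * moll 1 x) *\<^sub>R x"

definition moll2 :: "real^'n::finite \<Rightarrow> real^'n^'n" where
  "moll2 x = (\<chi> i. (4 * moll 2 x * x $ i) *\<^sub>R x + (-2 * moll 1 x) *\<^sub>R axis i 1)"

lemma smooth_moll: "smooth (moll j :: real^'n::finite \<Rightarrow> real)"
proof (rule smoothI)
  fix m
  have "Ck m (\<lambda>x::real^'n. \<delta>\<^sup>2 - (x - 0) \<bullet> (x - 0))" for m
    by (intro Ck_diff Ck_const Ck_dist_sq)
  then show "Ck m (moll j :: real^'n \<Rightarrow> real)"
    unfolding moll_def[abs_def] by (intro Ck_bump) simp
qed

lemma moll_derivative: "(moll j has_derivative (\<lambda>v. ((-2 * moll (Suc j) x) *\<^sub>R x) \<bullet> v)) (at x)"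
proof -
  have "((\<lambda>x. \<delta>\<^sup>2 - x \<bullet> x) has_derivative (\<lambda>v. - 2 * (x \<bullet> v))) (at x)"
    by (auto intro!: derivative_eq_intros simp: inner_commute)
  from has_derivative_compose[OF this has_field_derivative_imp_has_derivative[OF bump_derivative[of j]]]
  show ?thesis unfolding moll_def[abs_def] by (simp add: mult_ac)
qed

lemma moll1_derivative: "((\<lambda>x. moll1 x $ i) has_derivative (\<lambda>v. moll2 x $ i \<bullet> v)) (at x)"
proof -
  have "((\<lambda>x. -2 * moll 1 x * x $ i) has_derivative
      (\<lambda>v. -2 * moll 1 x * v $ i + (-2 * (((-2 * moll (Suc 1) x) *\<^sub>R x) \<bullet> v)) * x $ i)) (at x)"
    by (rule has_derivative_mult[OF has_derivative_mult_right[OF moll_derivative]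
        bounded_linear_imp_has_derivative[OF bounded_linear_vec_nth]])
  then show ?thesis
    by (simp add: moll1_def moll2_def inner_add_left inner_axis' numeral_2_eq_2 algebra_simps)
qed

lemma smooth_moll1: "smooth (\<lambda>x. moll1 x $ i)"
  unfolding moll1_def using smooth_moll
  by (auto intro!: smoothI Ck_mult Ck_const Ck_component Ck_uminus simp: smooth_def)

lemma smooth_moll2: "smooth (\<lambda>x. moll2 x $ i $ j)"
  unfolding moll2_def using smooth_moll
  by (auto intro!: smoothI Ck_mult Ck_add Ck_diff Ck_const Ck_component Ck_uminus simp: smooth_def)

lemma moll_sym: "moll2 x $ i $ j = moll2 x $ j $ i"
  by (simp add: moll2_def axis_def)

text \<open>Lets a convolution, with argument x - y, be read as a test with the kernel centered at
  x, a function of y - x.\<close>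

lemma moll_even: "moll j (x - y) = moll j (y - x)" "moll2 (x - y) = moll2 (y - x)"
proof -
  show *: "moll j (x - y) = moll j (y - x)" for j
    unfolding moll_def by (metis inner_minus_left inner_minus_right minus_diff_eq minus_minus)
  show "moll2 (x - y) = moll2 (y - x)"
    unfolding moll2_def *[of 1] *[of 2] by (simp add: vec_eq_iff algebra_simps)
qed

end

lemma moll_outside:
  assumes "norm x \<ge> \<delta>" "\<delta> > 0"
  shows "moll \<delta> j x = 0" "moll1 \<delta> x = 0" "moll2 \<delta> x = 0"
proof -
  have "\<delta>\<^sup>2 \<le> (norm x)\<^sup>2" using assms by (intro power_mono) auto
  then show "moll \<delta> j x = 0" for j by (simp add: moll_def bump_zero dot_square_norm)
  then show "moll1 \<delta> x = 0" "moll2 \<delta> x = 0" by (simp_all add: moll1_def moll2_def vec_eq_iff)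
qed

lemma continuous_moll: "continuous_on UNIV (moll \<delta> j :: real^'n::finite \<Rightarrow> real)"
   "continuous_on UNIV (moll1 \<delta> :: real^'n \<Rightarrow> _)" "continuous_on UNIV (moll2 \<delta> :: real^'n \<Rightarrow> _)"
   "continuous_on UNIV (\<lambda>x::real^'n. moll2 \<delta> x $ i)"
proof -
  have "continuous_on UNIV (\<lambda>x::real^'n. \<chi> i. moll1 \<delta> x $ i)"
     "continuous_on UNIV (\<lambda>x::real^'n. \<chi> i j. moll2 \<delta> x $ i $ j)"
     "continuous_on UNIV (\<lambda>x::real^'n. \<chi> j. moll2 \<delta> x $ i $ j)"
    by (intro continuous_on_vec_lambda smooth_continuous smooth_moll1 smooth_moll2)+
  then show "continuous_on UNIV (moll1 \<delta> :: real^'n \<Rightarrow> _)" "continuous_on UNIV (moll2 \<delta> :: real^'n \<Rightarrow> _)"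
     "continuous_on UNIV (\<lambda>x::real^'n. moll2 \<delta> x $ i)" by simp_all
  show "continuous_on UNIV (moll \<delta> j :: real^'n \<Rightarrow> real)"
    by (intro smooth_continuous smooth_moll)
qed

text \<open>Testing with the kernel centered at x shows that the mollification satisfies the
  equation classically. It and its gradient inherit their decay from that of \<open>w\<close> on
  balls of radius \<open>\<delta>\<close>. Recentered at \<open>x0\<close> they form an
  \<open>exterior_solution\<close>.\<close>

lemma vanishes_outside_ball:
  fixes w :: "real^'n::finite \<Rightarrow> real"
  assumes w: "continuous_on UNIV w" and k: "k > 0" and R: "R > 0" and \<delta>: "\<delta> > 0"
    and decay: "\<And>x. norm x \<ge> R0 \<Longrightarrow> norm x ^ CARD('n) * (w x)\<^sup>2 \<le> C"
    and eq: "\<And>x. norm (x - x0) > R \<Longrightarrow> (\<integral>y. w y * ((\<Sum>i\<in>UNIV. moll2 \<delta> (y - x) $ i $ i) + k\<^sup>2 * moll \<delta> 0 (y - x)) \<partial>lborel) = 0"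
    and x: "norm (x - x0) > R"
  shows "(\<integral>y. w y * moll \<delta> 0 (x - y) \<partial>lborel) = 0"
proof -
  have out: "z \<notin> cball 0 \<delta> \<Longrightarrow> moll \<delta> j z = 0" "z \<notin> cball 0 \<delta> \<Longrightarrow> moll1 \<delta> z = 0" "z \<notin> cball 0 \<delta> \<Longrightarrow> moll2 \<delta> z = 0" for z :: "real^'n" and j
    using moll_outside[OF _ \<delta>, of z] by auto
  define W where "W x = (\<integral>y. w y * moll \<delta> 0 (x - y) \<partial>lborel)" for x
  define G where "G x = (\<integral>y. w y *\<^sub>R moll1 \<delta> (x - y) \<partial>lborel)" for x
  define H where "H x = (\<chi> i. \<integral>y. w y *\<^sub>R moll2 \<delta> (x - y) $ i \<partial>lborel)" for x
  have int: "integrable lborel (\<lambda>y. w y *\<^sub>R \<kappa> (x - y))" 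
    if "continuous_on UNIV \<kappa>" "\<And>x. x \<notin> cball 0 \<delta> \<Longrightarrow> \<kappa> x = 0" for x and \<kappa> :: "real^'n \<Rightarrow> 'z::euclidean_space"
  proof (rule continuous_support_integrable[where c = x and R = \<delta>])
    show "continuous_on UNIV (\<lambda>y. w y *\<^sub>R \<kappa> (x - y))"
      by (intro continuous_intros w continuous_on_compose2[OF that(1)]) (auto intro!: continuous_intros)
    fix y assume "y \<notin> cball x \<delta>"
    then have "x - y \<notin> cball 0 \<delta>" by (simp add: dist_norm norm_minus_commute)
    then show "w y *\<^sub>R \<kappa> (x - y) = 0" using that(2) by simp
  qed
  have dmoll0: "(moll \<delta> 0 has_derivative (\<lambda>v. moll1 \<delta> x \<bullet> v)) (at x)" for x :: "real^'n"
    using moll_derivative[of \<delta> 0 x] by (simp add: moll1_def)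
  have dW: "(W has_derivative (\<lambda>v. G x \<bullet> v)) (at x)" for x
    unfolding W_def[abs_def] G_def
    by (rule has_derivative_convolution[OF w dmoll0 continuous_moll(2) out(1)])
  have G_comp: "G x $ i = (\<integral>y. w y * moll1 \<delta> (x - y) $ i \<partial>lborel)" for x i
    unfolding G_def
    using integral_bounded_linear[OF bounded_linear_vec_nth[of i] int[OF continuous_moll(2) out(2), of x]] by simp
  have dG: "((\<lambda>x. G x $ i) has_derivative (\<lambda>v. H x $ i \<bullet> v)) (at x)" for x i
    unfolding G_comp H_def vec_lambda_beta
    by (rule has_derivative_convolution[OF w moll1_derivative continuous_moll(4), where R = \<delta>]) (use out(2) in auto)
  have H_comp: "H x $ i $ j = (\<integral>y. w y * moll2 \<delta> (x - y) $ i $ j \<partial>lborel)" for x i j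
    unfolding H_def vec_lambda_beta
    using integral_bounded_linear[OF bounded_linear_vec_nth[of j] int[OF continuous_moll(4)[of \<delta> i], of x]] out(3) by simp
  have contH: "continuous_on UNIV H"
  proof -
    have "continuous_on UNIV (\<lambda>x. \<chi> i j. H x $ i $ j)"
      unfolding H_comp by (intro continuous_on_vec_lambda continuous_convolution[OF w smooth_moll2, where R = \<delta>]) (use out(3) in auto)
    then show ?thesis by simp
  qed
  have contW: "continuous_on UNIV W"
    by (meson dW continuous_at_imp_continuous_on has_derivative_continuous)
  have contG: "continuous_on UNIV G"
  proof -
    have "continuous_on UNIV (\<lambda>x. \<chi> i. G x $ i)"
      unfolding G_comp by (intro continuous_on_vec_lambda continuous_convolution[OF w smooth_moll1, where R = \<delta>]) (use out(2) in auto)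
    then show ?thesis by simp
  qed
  have pde: "(\<Sum>i\<in>UNIV. H x $ i $ i) = - k\<^sup>2 * W x" if "norm (x - x0) > R" for x
  proof -
    have i1: "integrable lborel (\<lambda>y. w y * moll2 \<delta> (x - y) $ i $ i)" for i
      using integrable_bounded_linear[OF bounded_linear_vec_nth[of i] int[OF continuous_moll(4)[of \<delta> i], of x]] out(3) by simp
    have i2: "integrable lborel (\<lambda>y. w y * moll \<delta> 0 (x - y))"
      using int[OF continuous_moll(1)[of \<delta> 0], of x] out(1) by simp
    have "(\<Sum>i\<in>UNIV. H x $ i $ i) + k\<^sup>2 * W x =
       (\<integral>y. (\<Sum>i\<in>UNIV. w y * moll2 \<delta> (x - y) $ i $ i) + k\<^sup>2 * (w y * moll \<delta> 0 (x - y)) \<partial>lborel)"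
      unfolding H_comp W_def using i1 i2 by simp
    also have "\<dots> = (\<integral>y. w y * ((\<Sum>i\<in>UNIV. moll2 \<delta> (y - x) $ i $ i) + k\<^sup>2 * moll \<delta> 0 (y - x)) \<partial>lborel)"
      by (simp add: moll_even[of \<delta> 0 x] moll_even(2)[of \<delta> x] sum_distrib_left algebra_simps)
    also have "\<dots> = 0" by (rule eq[OF that])
    finally show ?thesis by simp
  qed
  obtain L0 where L0: "L0 \<ge> 0" "\<And>x::real^'n. norm (moll \<delta> 0 x) \<le> L0"
    using continuous_support_bounded[OF continuous_moll(1) out(1)] by blast
  obtain L1 where L1: "L1 \<ge> 0" "\<And>x::real^'n. norm (moll1 \<delta> x) \<le> L1"
    using continuous_support_bounded[OF continuous_moll(2) out(2)] by blast
  define V where "V = measure lborel (cball (0::real^'n) \<delta>)"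
  define M where "M = max (L0 * V) (L1 * V)"
  have M0: "M \<ge> 0" using L0 by (simp add: M_def V_def le_max_iff_disj)
  define n where "n = CARD('n)"
  \<comment> \<open>For |x| \<ge> \<open>R2\<close> every y within \<open>\<delta>\<close> of x0 + x
    has |y| \<ge> |x| / 2 \<ge> \<open>R0\<close>; this costs a factor 2^n in the decay.\<close>
  define R2 where "R2 = max 1 (max (2 * \<bar>R0\<bar>) (2 * (norm x0 + \<delta>)))"
  have far: "norm x ^ n * (W (x0 + x))\<^sup>2 \<le> M\<^sup>2 * (2 ^ n * C) \<and> norm x ^ n * (norm (G (x0 + x)))\<^sup>2 \<le> M\<^sup>2 * (2 ^ n * C)" if x: "norm x \<ge> R2" for x
  proof -
    have nx: "norm x \<ge> 1" "2 * \<bar>R0\<bar> \<le> norm x" "2 * (norm x0 + \<delta>) \<le> norm x" using x by (simp_all add: R2_def)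
    define S where "S = sqrt (2 ^ n * C / norm x ^ n)"
    have C: "C \<ge> 0"
    proof -
      have "norm x \<ge> R0" using nx by linarith
      from decay[OF this] show ?thesis by (smt (verit) mult_nonneg_nonneg norm_ge_zero zero_le_power zero_le_power2)
    qed
    then have S2: "S\<^sup>2 = 2 ^ n * C / norm x ^ n" by (simp add: S_def)
    have S0: "S \<ge> 0" using C by (simp add: S_def)
    have S: "\<bar>w y\<bar> \<le> S" if y: "y \<in> cball (x0 + x) \<delta>" for y
    proof -
      have "norm x \<le> norm y + norm (x - y)" using norm_triangle_ineq[of y "x - y"] by simp
      moreover have "norm (x - y) \<le> norm (x0 + x - y) + norm x0" using norm_triangle_ineq4[of "x0 + x - y" x0] by (simp add: algebra_simps)
      moreover have "norm (x0 + x - y) \<le> \<delta>" using y by (simp add: dist_norm)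
      ultimately have "norm x \<le> norm y + (\<delta> + norm x0)" by linarith
      then have "norm x \<le> norm y + norm x / 2" using nx(3) by (simp add: field_simps)
      then have "norm x / 2 \<le> norm y" by (simp add: field_simps)
      moreover have "norm x / 2 \<ge> R0" using nx by linarith
      ultimately have y: "norm y \<ge> R0" "norm x / 2 \<le> norm y" by auto
      have "(norm x / 2) ^ n * (w y)\<^sup>2 \<le> norm y ^ n * (w y)\<^sup>2"
        using y by (intro mult_right_mono power_mono) auto
      also have "\<dots> \<le> C" unfolding n_def by (rule decay[OF y(1)])
      finally have *: "(norm x / 2) ^ n * (w y)\<^sup>2 \<le> C" .
      have pos: "norm x ^ n > 0" using nx(1) by (intro zero_less_power) linarith
      have "(w y)\<^sup>2 \<le> S\<^sup>2" unfolding S2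
        by (subst pos_le_divide_eq[OF pos]) (use * in \<open>simp add: power_divide field_simps\<close>)
      then show ?thesis using S0 by (simp add: abs_le_square_iff[symmetric])
    qed
    have "norm x ^ n * S\<^sup>2 = 2 ^ n * C" unfolding S2 using nx by auto
    moreover have "\<bar>W (x0 + x)\<bar> \<le> S * M"
    proof -
      have "norm (\<integral>y. w y *\<^sub>R moll \<delta> 0 (x0 + x - y) \<partial>lborel) \<le> S * (L0 * V)"
        unfolding V_def by (rule norm_convolution_le[OF w continuous_moll(1) out(1) L0(2) S S0])
      also have "\<dots> \<le> S * M" using S0 by (intro mult_left_mono) (auto simp: M_def)
      finally show ?thesis by (simp add: W_def)
    qed
    then have "(W (x0 + x))\<^sup>2 \<le> (S * M)\<^sup>2" by (simp add: abs_le_square_iff[symmetric] S0 M0)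
    moreover have "norm (G (x0 + x)) \<le> S * M"
    proof -
      have "norm (\<integral>y. w y *\<^sub>R moll1 \<delta> (x0 + x - y) \<partial>lborel) \<le> S * (L1 * V)"
        unfolding V_def by (rule norm_convolution_le[OF w continuous_moll(2) out(2) L1(2) S S0])
      also have "\<dots> \<le> S * M" using S0 by (intro mult_left_mono) (auto simp: M_def)
      finally show ?thesis by (simp add: G_def)
    qed
    then have "(norm (G (x0 + x)))\<^sup>2 \<le> (S * M)\<^sup>2" by (intro power_mono) auto
    moreover have "norm x ^ n * a \<le> M\<^sup>2 * (2 ^ n * C)" if "a \<le> (S * M)\<^sup>2" "norm x ^ n * S\<^sup>2 = 2 ^ n * C" for a
    proof -
      have "norm x ^ n * a \<le> norm x ^ n * (S * M)\<^sup>2" using that(1) by (rule mult_left_mono) simp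
      also have "\<dots> = M\<^sup>2 * (norm x ^ n * S\<^sup>2)" by (simp add: power_mult_distrib)
      finally show ?thesis unfolding that(2) .
    qed
    ultimately show ?thesis by blast
  qed
  have contWx: "continuous_on UNIV (\<lambda>x. W (x0 + x))" "continuous_on UNIV (\<lambda>x. G (x0 + x))" "continuous_on UNIV (\<lambda>x. H (x0 + x))"
    by (rule continuous_on_compose2[OF contW] continuous_on_compose2[OF contG] continuous_on_compose2[OF contH];
        auto intro!: continuous_intros)+
  \<comment> \<open>The locale wants its bounds from radius \<open>R\<close> on; in the intermediate
    region they come from compactness.\<close>
  have "\<exists>B. \<forall>x\<in>cball 0 R2. g x \<le> B" if "continuous_on UNIV g" for g :: "real^'n \<Rightarrow> real"
  proof -
    have "bounded (g ` cball 0 R2)"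
      by (intro compact_imp_bounded compact_continuous_image continuous_on_subset[OF that]) auto
    then show ?thesis unfolding bounded_iff by (force intro: order_trans[OF abs_ge_self])
  qed
  note bdd = this
  have "continuous_on UNIV (\<lambda>x. norm x ^ n * (W (x0 + x))\<^sup>2)"
    "continuous_on UNIV (\<lambda>x. norm x ^ n * (norm (G (x0 + x)))\<^sup>2)"
    by (intro continuous_intros contWx)+
  from this[THEN bdd] obtain B1 B2 where "\<forall>x\<in>cball 0 R2. norm x ^ n * (W (x0 + x))\<^sup>2 \<le> B1"
      "\<forall>x\<in>cball 0 R2. norm x ^ n * (norm (G (x0 + x)))\<^sup>2 \<le> B2"
    by blast
  then have B: "\<And>x. norm x \<le> R2 \<Longrightarrow> norm x ^ n * (W (x0 + x))\<^sup>2 \<le> B1"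
      "\<And>x. norm x \<le> R2 \<Longrightarrow> norm x ^ n * (norm (G (x0 + x)))\<^sup>2 \<le> B2"
    by auto
  interpret exterior_solution "\<lambda>x. W (x0 + x)" "\<lambda>x. G (x0 + x)" "\<lambda>x. H (x0 + x)" R k "max (M\<^sup>2 * (2 ^ n * C)) (max B1 B2)"
  proof
    show "R > 0" "k > 0" by (fact R k)+
    fix x :: "real^'n" and i j
    have shift: "((\<lambda>x. x0 + x) has_derivative (\<lambda>v. v)) (at x)" by (auto intro!: derivative_eq_intros)
    show "((\<lambda>x. W (x0 + x)) has_derivative (\<lambda>v. G (x0 + x) \<bullet> v)) (at x)"
      by (rule has_derivative_compose[OF shift dW])
    show "((\<lambda>x. G (x0 + x) $ i) has_derivative (\<lambda>v. H (x0 + x) $ i \<bullet> v)) (at x)"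
      by (rule has_derivative_compose[OF shift dG])
    show "continuous_on UNIV (\<lambda>x. H (x0 + x))" by (fact contWx)
    show "H (x0 + x) $ i $ j = H (x0 + x) $ j $ i" unfolding H_comp by (simp add: moll_sym)
    show "norm x > R \<Longrightarrow> (\<Sum>i\<in>UNIV. H (x0 + x) $ i $ i) = - k\<^sup>2 * W (x0 + x)"
      by (rule pde) simp
    show "norm x ^ CARD('n) * (W (x0 + x))\<^sup>2 \<le> max (M\<^sup>2 * (2 ^ n * C)) (max B1 B2)"
       "norm x ^ CARD('n) * (norm (G (x0 + x)))\<^sup>2 \<le> max (M\<^sup>2 * (2 ^ n * C)) (max B1 B2)"
      using far[of x] B[of x] unfolding n_def[symmetric] by (cases "norm x \<le> R2"; auto)+
  qed
  show ?thesis using rellich_vanishing[of "x - x0"] x by (simp add: W_def)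
qed

text \<open>The center lies far behind the point p of Q nearest to x, at p - T (x - p). With d = |x
  - p| and D a bound for |y - p| on Q, the half-space property of p gives |y - x0|^2 \<le> D^2 + T^2
  d^2, whereas |x - x0|^2 = (1 + T)^2 d^2 is larger because T d^2 = D^2. The gap between r and R
  leaves room for mollification.\<close>

lemma compact_convex_ball_separation:
  fixes Q :: "'a::euclidean_space set"
  assumes Q: "compact Q" "convex Q" "Q \<noteq> {}" and x: "x \<notin> Q"
  obtains x0 r R where "0 < r" "r < R" "R < norm (x - x0)" "Q \<subseteq> cball x0 r"
proof -
  define p where "p = closest_point Q x"
  have p: "p \<in> Q" "\<And>y. y \<in> Q \<Longrightarrow> (x - p) \<bullet> (y - p) \<le> 0"
    using closest_point_in_set[OF compact_imp_closed[OF Q(1)] Q(3)] closest_point_dot[OF Q(2) compact_imp_closed[OF Q(1)]]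
    by (auto simp: p_def)
  define d where "d = norm (x - p)"
  have d: "d > 0" using p x by (auto simp: d_def)
  obtain B where B: "\<And>y. y \<in> Q \<Longrightarrow> norm y \<le> B" using compact_imp_bounded[OF Q(1)] by (auto simp: bounded_iff)
  define D where "D = 2 * \<bar>B\<bar> + 1"
  have D: "norm (y - p) \<le> D" if "y \<in> Q" for y
    using norm_triangle_ineq4[of y p] B[OF that] B[OF p(1)] by (simp add: D_def)
  define T where "T = D\<^sup>2 / d\<^sup>2"
  have T: "T \<ge> 0" by (simp add: T_def)
  have Td: "T * d\<^sup>2 = D\<^sup>2" using d by (simp add: T_def)
  define x0 where "x0 = p - T *\<^sub>R (x - p)"
  define r where "r = sqrt (D\<^sup>2 + T\<^sup>2 * d\<^sup>2)"
  have "D > 0" by (simp add: D_def)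
  then have r0: "r > 0" by (simp add: r_def add_pos_nonneg)
  have "Q \<subseteq> cball x0 r"
  proof
    fix y assume y: "y \<in> Q"
    have "(norm (y - x0))\<^sup>2 = (norm (y - p))\<^sup>2 + 2 * T * ((x - p) \<bullet> (y - p)) + T\<^sup>2 * d\<^sup>2"
      unfolding x0_def d_def power2_norm_eq_inner
      by (simp add: inner_diff_left inner_diff_right inner_add_left inner_add_right inner_commute algebra_simps power2_eq_square)
    also have "\<dots> \<le> D\<^sup>2 + 0 + T\<^sup>2 * d\<^sup>2"
      using D[OF y] p(2)[OF y] T by (intro add_mono power_mono) (auto simp: mult_nonneg_nonpos)
    finally have "norm (y - x0) \<le> r" unfolding r_def by (simp add: real_le_rsqrt)
    then show "y \<in> cball x0 r" by (simp add: dist_norm norm_minus_commute)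
  qed
  moreover have "r < norm (x - x0)"
  proof -
    have "x - x0 = (1 + T) *\<^sub>R (x - p)" by (simp add: x0_def algebra_simps)
    then have "(norm (x - x0))\<^sup>2 = (1 + T)\<^sup>2 * d\<^sup>2" by (simp add: d_def power_mult_distrib)
    also have "\<dots> = d\<^sup>2 + 2 * D\<^sup>2 + T\<^sup>2 * d\<^sup>2" unfolding Td[symmetric] by (simp add: power2_eq_square algebra_simps)
    finally have "(norm (x - x0))\<^sup>2 > D\<^sup>2 + T\<^sup>2 * d\<^sup>2" using d by (simp add: add_nonneg_pos)
    then show ?thesis unfolding r_def by (simp add: real_less_lsqrt)
  qed
  ultimately show ?thesis
    using that[of r "(r + norm (x - x0)) / 2" x0] r0 by simp
qed

text \<open>If w(x) were nonzero, a kernel so narrow that w keeps its sign on the support would give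
  a nonzero mollification at x, although x lies outside a ball containing Q off which mollifications
  vanish.\<close>

lemma vanishes_outside_convex_real:
  fixes w :: "real^'n::finite \<Rightarrow> real"
  assumes w: "continuous_on UNIV w" and k: "k > 0" 
    and Q: "compact Q" "convex Q" "Q \<noteq> {}"
    and decay: "\<And>x. norm x \<ge> R0 \<Longrightarrow> norm x ^ CARD('n) * (w x)\<^sup>2 \<le> C"
    and eq: "\<And>x \<delta>. \<delta> > 0 \<Longrightarrow> Q \<inter> cball x \<delta> = {} \<Longrightarrow> 
       (\<integral>y. w y * ((\<Sum>i\<in>UNIV. moll2 \<delta> (y - x) $ i $ i) + k\<^sup>2 * moll \<delta> 0 (y - x)) \<partial>lborel) = 0"
    and x: "x \<notin> Q"
  shows "w x = 0"
proof (rule ccontr)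
  assume ne: "w x \<noteq> 0"
  obtain x0 r R where R: "0 < r" "r < R" "R < norm (x - x0)" "Q \<subseteq> cball x0 r"
    by (rule compact_convex_ball_separation[OF Q x]) (rule that)
  have "isCont w x" using w by (simp add: continuous_on_eq_continuous_at)
  then have "((\<lambda>y. w x * w y) \<longlongrightarrow> w x * w x) (nhds x)"
    unfolding isCont_def tendsto_at_iff_tendsto_nhds by (intro tendsto_intros)
  moreover have "w x * w x > 0" using ne by (simp add: zero_less_mult_iff linorder_neq_iff disj_commute)
  ultimately have "\<forall>\<^sub>F y in nhds x. w x * w y > 0" by (rule order_tendstoD(1))
  then obtain d where d: "d > 0" "\<And>y. dist y x < d \<Longrightarrow> w x * w y > 0"
    unfolding eventually_nhds_metric by blast
  \<comment> \<open>\<open>d\<close> keeps the sign of \<open>w\<close>; \<open>R - r\<close> keeps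
    kernels centered outside the ball of radius \<open>R\<close> off Q.\<close>
  define \<delta> where "\<delta> = min d (R - r)"
  have \<delta>: "\<delta> > 0" using d R by (simp add: \<delta>_def)
  have zero: "(\<integral>y. w y * moll \<delta> 0 (x - y) \<partial>lborel) = 0"
  proof (rule vanishes_outside_ball[OF w k _ \<delta> decay _ R(3)])
    show "R > 0" using R by simp
    fix z assume z: "norm (z - x0) > R"
    show "(\<integral>y. w y * ((\<Sum>i\<in>UNIV. moll2 \<delta> (y - z) $ i $ i) + k\<^sup>2 * moll \<delta> 0 (y - z)) \<partial>lborel) = 0"
    proof (rule eq[OF \<delta>])
      have False if "y \<in> Q" "y \<in> cball z \<delta>" for y
      proof -
        have "norm (z - x0) \<le> norm (z - y) + norm (y - x0)" using norm_triangle_ineq[of "z - y" "y - x0"] by simp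
        also have "\<dots> \<le> \<delta> + r" using that R(4) by (intro add_mono) (auto simp: dist_norm norm_minus_commute)
        also have "\<dots> \<le> R" by (simp add: \<delta>_def)
        finally show False using z by simp
      qed
      then show "Q \<inter> cball z \<delta> = {}" by blast
    qed
  qed
  define f where "f y = w x * (w y * moll \<delta> 0 (x - y))" for y
  have contf: "continuous_on UNIV f" unfolding f_def
    by (intro continuous_intros w continuous_on_compose2[OF continuous_moll(1)]) (auto intro!: continuous_intros)
  have "f y \<ge> 0 \<and> (y \<notin> cball x \<delta> \<longrightarrow> f y = 0)" for y
  proof (cases "norm (x - y) < \<delta>")
    case True
    then have "w x * w y > 0" using d(2)[of y] by (simp add: \<delta>_def dist_norm norm_minus_commute)
    then show ?thesis using True
      by (auto simp: f_def moll_def bump_nonneg mult.assoc[symmetric] dist_norm)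
  next
    case False
    then have "moll \<delta> 0 (x - y) = 0" using moll_outside(1)[OF _ \<delta>, of "x - y" 0] by simp
    then show ?thesis by (simp add: f_def)
  qed
  note f = this
  have "integrable lborel f" by (rule continuous_support_integrable[OF contf, of x \<delta>]) (use f in blast)
  moreover have "(\<integral>y. f y \<partial>lborel) = 0" using zero by (simp add: f_def)
  ultimately have "f x = 0"
    by (intro continuous_nonneg_integral_0[OF contf]) (use f in blast)+
  then show False using ne \<delta> bump_pos[of "\<delta>\<^sup>2"] by (simp add: f_def moll_def)
qed

section \<open>Vertices of convex polytopes\<close>

text \<open>Otherwise v would be redundant as a generator, but an extreme point of a hull belongs to
  every generating set.\<close>

lemma extreme_point_not_in_rest_hull:
  assumes "v extreme_point_of (convex hull T)"
  shows "v \<notin> convex hull (T - {v})"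
proof
  assume v: "v \<in> convex hull (T - {v})"
  have "v \<in> T" using extreme_point_of_convex_hull[OF assms] .
  then have "convex hull T = convex hull (T - {v})"
    using hull_redundant[OF v] by (simp add: insert_absorb)
  with assms have "v extreme_point_of (convex hull (T - {v}))" by simp
  then show False using extreme_point_of_convex_hull by blast
qed

lemma convex_pointed_cone:
  fixes d :: "'a::real_inner"
  assumes "c \<ge> 0"
  shows "convex {x. c * norm (x - v) \<le> d \<bullet> (x - v)}"
proof (rule convexI)
  fix x y u w assume xy: "x \<in> {x. c * norm (x - v) \<le> d \<bullet> (x - v)}" "y \<in> {x. c * norm (x - v) \<le> d \<bullet> (x - v)}"
    and uw: "(0::real) \<le> u" "0 \<le> w" "u + w = 1"
  have eq: "u *\<^sub>R x + w *\<^sub>R y - v = u *\<^sub>R (x - v) + w *\<^sub>R (y - v)"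
    using uw(3) by (simp add: algebra_simps scaleR_left_distrib[symmetric])
  have "c * norm (u *\<^sub>R x + w *\<^sub>R y - v) \<le> c * (u * norm (x - v) + w * norm (y - v))"
    unfolding eq using assms uw by (intro mult_left_mono order_trans[OF norm_triangle_ineq]) auto
  also have "\<dots> \<le> u * (d \<bullet> (x - v)) + w * (d \<bullet> (y - v))"
    using mult_left_mono[of "c * norm (x - v)" "d \<bullet> (x - v)" u] mult_left_mono[of "c * norm (y - v)" "d \<bullet> (y - v)" w] xy uw
    by (simp add: algebra_simps)
  also have "\<dots> = d \<bullet> (u *\<^sub>R x + w *\<^sub>R y - v)" unfolding eq by (simp add: inner_add_right)
  finally show "u *\<^sub>R x + w *\<^sub>R y \<in> {x. c * norm (x - v) \<le> d \<bullet> (x - v)}" by simp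
qed

text \<open>A vertex is strictly separated from the hull of the other points; dividing the gap by a
  bound for their distances from v turns it into an opening angle, and the resulting cone is
  convex.\<close>

lemma vertex_supporting_cone:
  fixes T :: "'a::euclidean_space set"
  assumes T: "finite T" and v: "v extreme_point_of (convex hull T)"
  obtains d c where "c > 0" "\<And>x. x \<in> convex hull T \<Longrightarrow> c * norm (x - v) \<le> d \<bullet> (x - v)"
proof -
  let ?T = "convex hull (T - {v})"
  have "closed ?T" using T by (intro compact_imp_closed finite_imp_compact_convex_hull) auto
  from separating_hyperplane_closed_point[OF convex_convex_hull this extreme_point_not_in_rest_hull[OF v]]
  obtain d b where d: "d \<bullet> v < b" "\<And>x. x \<in> ?T \<Longrightarrow> d \<bullet> x > b" by blast
  obtain D where D: "\<And>x. x \<in> T \<Longrightarrow> norm (x - v) \<le> D"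
  proof -
    have "bounded ((\<lambda>x. x - v) ` T)" using T by (intro finite_imp_bounded) auto
    then show ?thesis using that unfolding bounded_iff by auto
  qed
  define c where "c = (b - d \<bullet> v) / (\<bar>D\<bar> + 1)"
  have c: "c > 0" using d(1) by (simp add: c_def)
  have "T \<subseteq> {x. c * norm (x - v) \<le> d \<bullet> (x - v)}"
  proof
    fix x assume x: "x \<in> T"
    show "x \<in> {x. c * norm (x - v) \<le> d \<bullet> (x - v)}"
    proof (cases "x = v")
      case False
      then have "d \<bullet> x > b" using x by (intro d(2) hull_inc) auto
      moreover have "c * norm (x - v) \<le> c * (\<bar>D\<bar> + 1)" using D[OF x] c by (intro mult_left_mono) auto
      moreover have "c * (\<bar>D\<bar> + 1) = b - d \<bullet> v" by (simp add: c_def)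
      ultimately show ?thesis by (simp add: inner_diff_right)
    qed simp
  qed
  then have "convex hull T \<subseteq> {x. c * norm (x - v) \<le> d \<bullet> (x - v)}"
    using c by (intro hull_minimal convex_pointed_cone) auto
  then show ?thesis using that[OF c] by blast
qed

text \<open>Each point of the hull lies on a segment from v to the hull of the other generators,
  whose distance from v is at least \<open>\<rho>\<close>; rescaling keeps it on that segment while
  it is closer to v than \<open>\<rho>\<close>. Rescaling a whole neighborhood gives membership in
  the interior.\<close>

lemma polytope_locally_conic:
  fixes S :: "'a::euclidean_space set"
  assumes S: "finite S" and P: "P = interior (convex hull S)" "P \<noteq> {}" and v: "v extreme_point_of (convex hull S)"
  obtains r where "r > 0" "\<And>x t. x \<in> P \<Longrightarrow> t > 0 \<Longrightarrow> norm (t *\<^sub>R (x - v)) < r \<Longrightarrow> v + t *\<^sub>R (x - v) \<in> P"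
proof -
  let ?T = "convex hull (S - {v})"
  have vS: "v \<in> S" using extreme_point_of_convex_hull[OF v] .
  have ne: "S - {v} \<noteq> {}"
  proof
    assume "S - {v} = {}"
    with vS have "S = {v}" by auto
    then show False using P by simp
  qed
  have "closed ?T" using S by (intro compact_imp_closed finite_imp_compact_convex_hull) auto
  from separate_point_closed[OF this extreme_point_not_in_rest_hull[OF v]]
  obtain \<rho> where \<rho>: "\<rho> > 0" "\<And>z. z \<in> ?T \<Longrightarrow> \<rho> \<le> dist v z" by blast
  have hull: "convex hull S = {(1 - u) *\<^sub>R v + u *\<^sub>R x |x u. 0 \<le> u \<and> u \<le> 1 \<and> x \<in> ?T}"
    using convex_hull_insert_alt[of v "S - {v}"] ne vS by (simp add: insert_absorb)
  have in_hull: "v + t *\<^sub>R (x - v) \<in> convex hull S" if x: "x \<in> P" and t: "t > 0" "norm (t *\<^sub>R (x - v)) < \<rho>" for x t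
  proof -
    have "x \<in> convex hull S" using x P interior_subset by blast
    then obtain z u where z: "x = (1 - u) *\<^sub>R v + u *\<^sub>R z" "0 \<le> u" "u \<le> 1" "z \<in> ?T" unfolding hull by blast
    have xv: "x - v = u *\<^sub>R (z - v)" unfolding z(1) by (simp add: algebra_simps)
    have "(t * u) * norm (z - v) < \<rho>" using t z(2) by (simp add: xv mult_ac)
    also have "\<rho> \<le> norm (z - v)" using \<rho>(2)[OF z(4)] by (simp add: dist_norm norm_minus_commute)
    finally have "t * u < 1" using \<rho> by (smt (verit) mult_less_cancel_right2 norm_ge_zero)
    then have "(1 - t * u) *\<^sub>R v + (t * u) *\<^sub>R z \<in> convex hull S"
      unfolding hull using z t by (intro CollectI exI[of _ z] exI[of _ "t * u"]) auto
    then show ?thesis unfolding xv by (simp add: algebra_simps)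
  qed
  have "v + t *\<^sub>R (x - v) \<in> P" if x: "x \<in> P" and t: "t > 0" "norm (t *\<^sub>R (x - v)) < \<rho>" for x t
  proof -
    define U where "U = {y \<in> P. norm (t *\<^sub>R (y - v)) < \<rho>}"
    have "U = P \<inter> {y. norm (t *\<^sub>R (y - v)) < \<rho>}" by (auto simp: U_def)
    moreover have "open {y. norm (t *\<^sub>R (y - v)) < \<rho>}" by (intro open_Collect_less continuous_intros)
    ultimately have "open U" using P(1) by (simp add: open_Int)
    then have "open ((\<lambda>y. (v - t *\<^sub>R v) + t *\<^sub>R y) ` U)" using t by (intro open_affinity) auto
    moreover have "(\<lambda>y. (v - t *\<^sub>R v) + t *\<^sub>R y) ` U \<subseteq> convex hull S"
      using in_hull t(1) by (auto simp: U_def algebra_simps)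
    moreover have "v + t *\<^sub>R (x - v) \<in> (\<lambda>y. (v - t *\<^sub>R v) + t *\<^sub>R y) ` U"
      using x t by (intro image_eqI[of _ _ x]) (auto simp: U_def algebra_simps)
    ultimately show ?thesis unfolding P(1) interior_def by blast
  qed
  with \<rho>(1) show ?thesis using that by blast
qed

text \<open>The cone \<open>K\<close> spanned by P at v meets the set \<open>B\<close> of its
  strictly positive functionals. Otherwise a separating vector a is \<le> 0 on \<open>B\<close> and
  \<ge> 0 on \<open>K\<close>; then a + s d is in \<open>B\<close> for every s > 0, so a . a + s (a
  . d) \<le> 0, and small s forces a = 0. Such a direction e gives the dipole a sign on the
  cone.\<close>

lemma convex_interior_dual_direction:
  fixes P :: "'a::euclidean_space set"
  assumes P: "convex P" "P \<noteq> {}" and d: "c > 0" "\<And>x. x \<in> P \<Longrightarrow> c * norm (x - v) \<le> d \<bullet> (x - v)"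
  obtains e c' where "v + e \<in> P" "c' > 0" "\<And>x. x \<in> P \<Longrightarrow> c' * norm (x - v) \<le> e \<bullet> (x - v)"
proof -
  define K where "K = {t *\<^sub>R (x - v) |t x. t > 0 \<and> x \<in> P}"
  define B where "B = {d. \<exists>c>0. \<forall>x\<in>P. c * norm (x - v) \<le> d \<bullet> (x - v)}"
  have convK: "convex K"
  proof (rule convexI)
    fix x y u w assume "x \<in> K" "y \<in> K" and uw: "(0::real) \<le> u" "0 \<le> w" "u + w = 1"
    then obtain s p t q where pq: "x = s *\<^sub>R (p - v)" "s > 0" "p \<in> P" "y = t *\<^sub>R (q - v)" "t > 0" "q \<in> P"
      unfolding K_def by blast
    define a where "a = u * s + w * t"
    have a: "a > 0" using uw pq by (cases "u = 0") (auto simp: a_def intro: add_pos_nonneg)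
    have "((u * s) / a) *\<^sub>R p + ((w * t) / a) *\<^sub>R q \<in> P"
      using a uw pq by (intro convexD[OF P(1)]) (auto simp: a_def add_divide_distrib[symmetric])
    moreover have "u *\<^sub>R x + w *\<^sub>R y = a *\<^sub>R (((u * s) / a) *\<^sub>R p + ((w * t) / a) *\<^sub>R q - v)"
    proof -
      have "a *\<^sub>R (((u * s) / a) *\<^sub>R p + ((w * t) / a) *\<^sub>R q - v) = (u * s) *\<^sub>R p + (w * t) *\<^sub>R q - a *\<^sub>R v"
        using a by (simp add: algebra_simps)
      then show ?thesis unfolding pq a_def by (simp add: algebra_simps)
    qed
    ultimately show "u *\<^sub>R x + w *\<^sub>R y \<in> K" unfolding K_def using a by blast
  qed
  have convB: "convex B"
  proof (rule convexI)
    fix x y u w assume "x \<in> B" "y \<in> B" and uw: "(0::real) \<le> u" "0 \<le> w" "u + w = 1"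
    then obtain a b where ab: "a > 0" "b > 0" "\<And>z. z \<in> P \<Longrightarrow> a * norm (z - v) \<le> x \<bullet> (z - v)"
      "\<And>z. z \<in> P \<Longrightarrow> b * norm (z - v) \<le> y \<bullet> (z - v)" unfolding B_def by blast
    have "u * a + w * b > 0" using uw ab by (cases "u = 0") (auto intro: add_pos_nonneg)
    moreover have "(u * a + w * b) * norm (z - v) \<le> (u *\<^sub>R x + w *\<^sub>R y) \<bullet> (z - v)" if "z \<in> P" for z
      using mult_left_mono[OF ab(3)[OF that] uw(1)] mult_left_mono[OF ab(4)[OF that] uw(2)]
      by (simp add: inner_add_left algebra_simps)
    ultimately show "u *\<^sub>R x + w *\<^sub>R y \<in> B" unfolding B_def by blast
  qed
  have PK: "x - v \<in> K" if "x \<in> P" for x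
    unfolding K_def using that by (intro CollectI exI[of _ 1] exI[of _ x]) auto
  have dB: "d \<in> B" using d unfolding B_def by blast
  have K_scale: "s *\<^sub>R x \<in> K" if "x \<in> K" "s > 0" for x s
    using that unfolding K_def by (force intro: exI[of _ "s * _"])
  have B_scale: "s *\<^sub>R x \<in> B" if "x \<in> B" "s > 0" for x s
  proof -
    from that(1) obtain a where a: "a > 0 \<and> (\<forall>z\<in>P. a * norm (z - v) \<le> x \<bullet> (z - v))"
      unfolding B_def by (elim CollectE exE) (rule that)
    then have "s * a > 0 \<and> (\<forall>z\<in>P. (s * a) * norm (z - v) \<le> (s *\<^sub>R x) \<bullet> (z - v))"
      using that(2) by (auto simp: mult.assoc)
    then show ?thesis unfolding B_def by (intro CollectI exI[of _ "s * a"])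
  qed
  have "K \<inter> B \<noteq> {}"
  proof
    assume "K \<inter> B = {}"
    moreover have "K \<noteq> {}" using P(2) PK by blast
    moreover have "B \<noteq> {}" using dB by blast
    ultimately obtain a b where ab: "a \<noteq> 0" "\<And>x. x \<in> B \<Longrightarrow> a \<bullet> x \<le> b" "\<And>x. x \<in> K \<Longrightarrow> a \<bullet> x \<ge> b"
      using separating_hyperplane_sets[OF convB convK] by (metis Int_commute)
    have aB: "a \<bullet> x \<le> 0" if "x \<in> B" for x
    proof (rule ccontr)
      assume "\<not> a \<bullet> x \<le> 0"
      then have "a \<bullet> ((((\<bar>b\<bar> + 1) / (a \<bullet> x))) *\<^sub>R x) \<le> b" using that by (intro ab(2) B_scale) auto
      then show False using \<open>\<not> a \<bullet> x \<le> 0\<close> by simp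
    qed
    have aK: "a \<bullet> x \<ge> 0" if "x \<in> K" for x
    proof (rule ccontr)
      assume n: "\<not> a \<bullet> x \<ge> 0"
      then have "(\<bar>b\<bar> + 1) / (- (a \<bullet> x)) > 0" by (intro divide_pos_pos) auto
      then have "a \<bullet> ((((\<bar>b\<bar> + 1) / (- (a \<bullet> x)))) *\<^sub>R x) \<ge> b" using that by (intro ab(3) K_scale) auto
      moreover have "a \<bullet> ((((\<bar>b\<bar> + 1) / (- (a \<bullet> x)))) *\<^sub>R x) = - (\<bar>b\<bar> + 1)" using n by simp
      ultimately show False by linarith
    qed
    have "a + s *\<^sub>R d \<in> B" if "s > 0" for s
    proof -
      have "(s * c) * norm (z - v) \<le> (a + s *\<^sub>R d) \<bullet> (z - v)" if "z \<in> P" for z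
      proof -
        have "0 \<le> a \<bullet> (z - v)" using that by (intro aK PK)
        moreover have "s * (c * norm (z - v)) \<le> s * (d \<bullet> (z - v))" using d(2)[OF that] \<open>s > 0\<close> by (intro mult_left_mono) auto
        ultimately show ?thesis by (simp add: inner_add_left)
      qed
      then show ?thesis using that d(1) unfolding B_def by (intro CollectI exI[of _ "s * c"]) auto
    qed
    then have le: "a \<bullet> a + s * (a \<bullet> d) \<le> 0" if "s > 0" for s using aB that by (fastforce simp: inner_add_right)
    have aa: "a \<bullet> a > 0" using ab(1) by simp
    \<comment> \<open>Small enough for \<open>s * \<bar>a \<bullet> d\<bar>\<close> to be at most
      half of \<open>a \<bullet> a\<close>.\<close>
    define s where "s = (a \<bullet> a) / (2 * (\<bar>a \<bullet> d\<bar> + 1))"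
    have s: "s > 0" using aa by (simp add: s_def add_nonneg_pos)
    have "s * \<bar>a \<bullet> d\<bar> \<le> s * (\<bar>a \<bullet> d\<bar> + 1)" using s by (intro mult_left_mono) auto
    also have "\<dots> = (a \<bullet> a) / 2" unfolding s_def by (simp add: field_simps)
    finally have "s * \<bar>a \<bullet> d\<bar> \<le> (a \<bullet> a) / 2" .
    moreover have "s * (a \<bullet> d) \<ge> - (s * \<bar>a \<bullet> d\<bar>)" using s
      by (metis abs_ge_minus_self abs_mult abs_of_pos minus_le_iff)
    ultimately show False using le[OF s] aa by linarith
  qed
  then obtain t x where tx: "t > 0" "x \<in> P" "t *\<^sub>R (x - v) \<in> B" unfolding K_def by blast
  have "(1 / t) *\<^sub>R (t *\<^sub>R (x - v)) \<in> B" by (rule B_scale[OF tx(3)]) (use tx(1) in simp)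
  then have "x - v \<in> B" using tx by simp
  then obtain c' where "c' > 0" "\<And>z. z \<in> P \<Longrightarrow> c' * norm (z - v) \<le> (x - v) \<bullet> (z - v)" unfolding B_def by blast
  with tx(2) show ?thesis using that[of "x - v" c'] by simp
qed

section \<open>Regularized dipole potentials\<close>

lemma smooth_cutoff:
  fixes r :: real
  assumes r: "r > 0"
  obtains \<eta> :: "real^'n::finite \<Rightarrow> real" where "smooth \<eta>" "\<And>z. 0 \<le> \<eta> z" "\<And>z. \<eta> z \<le> 1"
    "\<And>z. norm z \<le> r / 2 \<Longrightarrow> \<eta> z = 1" "\<And>z. norm z \<ge> r \<Longrightarrow> \<eta> z = 0"
proof -
  define A :: "real^'n \<Rightarrow> real" where "A z = bump 0 (r\<^sup>2 - (z - 0) \<bullet> (z - 0))" for z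
  define B :: "real^'n \<Rightarrow> real" where "B z = bump 0 ((z - 0) \<bullet> (z - 0) - (r/2)\<^sup>2)" for z
  \<comment> \<open>The quotient A / (A + B) in the form to which \<open>Ck_powr\<close> applies; A
    and B have no common zero.\<close>
  define \<eta> where "\<eta> z = A z * (A z + B z) powr (- 1)" for z
  have nonneg: "A z \<ge> 0" "B z \<ge> 0" for z by (simp_all add: A_def B_def bump_nonneg)
  have pos: "A z + B z > 0" for z
  proof (cases "norm z < r")
    case True
    then have "(norm z)\<^sup>2 < r\<^sup>2" by (intro power_strict_mono) auto
    then have "A z > 0" unfolding A_def by (intro bump_pos) (simp add: dot_square_norm)
    then show ?thesis using nonneg[of z] by simp
  next
    case False
    then have "(r/2)\<^sup>2 < (norm z)\<^sup>2" using r by (intro power_strict_mono) auto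
    then have "B z > 0" unfolding B_def by (intro bump_pos) (simp add: dot_square_norm)
    then show ?thesis using nonneg[of z] by simp
  qed
  have CA: "Ck m A" "Ck m B" for m
    unfolding A_def[abs_def] B_def[abs_def] by (intro Ck_bump Ck_diff Ck_const Ck_dist_sq)+
  have "smooth \<eta>" unfolding \<eta>_def[abs_def]
    by (intro smoothI Ck_mult CA Ck_powr Ck_add pos)
  moreover have eq: "\<eta> z = A z / (A z + B z)" for z
    using pos[of z] by (simp add: \<eta>_def powr_minus divide_inverse)
  then have "0 \<le> \<eta> z" "\<eta> z \<le> 1" for z
    using nonneg[of z] pos[of z] by (simp_all add: divide_le_eq)
  moreover have "\<eta> z = 1" if "norm z \<le> r / 2" for z
  proof -
    have "(norm z)\<^sup>2 \<le> (r/2)\<^sup>2" using that by (intro power_mono) auto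
    then have "B z = 0" unfolding B_def by (intro bump_zero) (simp add: dot_square_norm)
    then show ?thesis using pos[of z] by (simp add: eq)
  qed
  moreover have "\<eta> z = 0" if "norm z \<ge> r" for z
  proof -
    have "r\<^sup>2 \<le> (norm z)\<^sup>2" using that r by (intro power_mono) auto
    then have "A z = 0" unfolding A_def by (intro bump_zero) (simp add: dot_square_norm)
    then show ?thesis by (simp add: eq)
  qed
  ultimately show ?thesis using that by blast
qed

text \<open>A smooth substitute for |y|^(-m), comparable to it where |y| \<ge>
  \<open>\<delta>\<close>.\<close>

definition sig :: "real \<Rightarrow> nat \<Rightarrow> real^'n::finite \<Rightarrow> real" where
  "sig \<delta> m y = (y \<bullet> y + \<delta>\<^sup>2) powr (- real m / 2)"

context
  fixes \<delta> :: real
  assumes \<delta>: "\<delta> > 0"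
begin

lemma sig_base_pos: "y \<bullet> y + \<delta>\<^sup>2 > 0"
  using \<delta> by (simp add: add_nonneg_pos)

lemma sig_pos: "sig \<delta> m y > 0"
  using sig_base_pos[of y] by (simp add: sig_def less_imp_neq[symmetric])

lemma smooth_sig: "smooth (\<lambda>z. sig \<delta> m (z + a))"
proof (rule smoothI)
  fix j
  have "Ck j (\<lambda>z. ((z - (- a)) \<bullet> (z - (- a)) + \<delta>\<^sup>2) powr (- real m / 2))"
    by (intro Ck_powr Ck_add Ck_dist_sq Ck_const sig_base_pos)
  then show "Ck j (\<lambda>z. sig \<delta> m (z + a))" by (simp add: sig_def)
qed

lemma sig_derivative:
  "(sig \<delta> m has_derivative (\<lambda>v. ((- real m * sig \<delta> (m + 2) y) *\<^sub>R y) \<bullet> v)) (at y)"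
proof -
  have "((\<lambda>y. y \<bullet> y + \<delta>\<^sup>2) has_derivative (\<lambda>v. 2 * (y \<bullet> v))) (at y)"
    by (auto intro!: derivative_eq_intros simp: inner_commute)
  from has_derivative_compose[OF this has_field_derivative_imp_has_derivative[OF
        has_real_derivative_powr[OF sig_base_pos]]]
  have "(sig \<delta> m has_derivative (\<lambda>v. (- real m / 2) * (y \<bullet> y + \<delta>\<^sup>2) powr (- real m / 2 - 1) * (2 * (y \<bullet> v)))) (at y)"
    unfolding sig_def[abs_def] .
  moreover have "(y \<bullet> y + \<delta>\<^sup>2) powr (- real m / 2 - 1) = sig \<delta> (m + 2) y"
    unfolding sig_def by (rule arg_cong[where f = "\<lambda>p. _ powr p"]) (simp add: field_simps)
  ultimately show ?thesis by (simp add: mult_ac)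
qed

lemma sig_square: "(y \<bullet> y + \<delta>\<^sup>2) * sig \<delta> (m + 2) y = sig \<delta> m y"
proof -
  have "(y \<bullet> y + \<delta>\<^sup>2) * sig \<delta> (m + 2) y = (y \<bullet> y + \<delta>\<^sup>2) powr (1 + (- real (m + 2) / 2))"
    unfolding sig_def powr_add using sig_base_pos[of y] by simp
  also have "1 + (- real (m + 2) / 2) = - real m / 2" by (simp add: field_simps)
  finally show ?thesis by (simp add: sig_def)
qed

lemma norm_sig: "norm y * sig \<delta> (Suc m) y \<le> sig \<delta> m y"
proof -
  have "norm y \<le> sqrt (y \<bullet> y + \<delta>\<^sup>2)"
    by (rule real_le_rsqrt) (simp add: dot_square_norm)
  also have "\<dots> = (y \<bullet> y + \<delta>\<^sup>2) powr (1/2)"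
    using sig_base_pos[of y] by (simp add: powr_half_sqrt)
  finally have "norm y * sig \<delta> (Suc m) y \<le> (y \<bullet> y + \<delta>\<^sup>2) powr (1/2) * sig \<delta> (Suc m) y"
    using sig_pos[of "Suc m" y] by (intro mult_right_mono) auto
  also have "\<dots> = (y \<bullet> y + \<delta>\<^sup>2) powr (1/2 + (- real (Suc m) / 2))"
    unfolding sig_def powr_add by simp
  also have "1/2 + (- real (Suc m) / 2) = - real m / 2" by (simp add: field_simps)
  finally show ?thesis by (simp add: sig_def)
qed

lemma norm_sig2: "norm y * norm y * sig \<delta> (Suc (Suc m)) y \<le> sig \<delta> m y"
  using order_trans[OF mult_left_mono[OF norm_sig[of y "Suc m"], of "norm y"] norm_sig[of y m]]
  by (simp add: mult.assoc)

lemma sig_le: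
  assumes b: "0 < b" "b \<le> norm y"
  shows "sig \<delta> m y \<le> (1 / b) ^ m"
proof -
  have "b\<^sup>2 \<le> y \<bullet> y" using b power_mono[of b "norm y" 2] by (simp add: dot_square_norm)
  then have "sig \<delta> m y \<le> (b\<^sup>2) powr (- real m / 2)"
    unfolding sig_def using b \<delta> by (intro powr_mono2') (auto intro: add_increasing2)
  also have "\<dots> = (b powr 2) powr (- real m / 2)" using b by simp
  also have "\<dots> = b powr (- real m)" unfolding powr_powr by simp
  also have "\<dots> = (1 / b) ^ m" using b by (simp add: powr_minus powr_realpow power_one_over inverse_eq_divide)
  finally show ?thesis .
qed

lemma sig_ge:
  assumes B: "0 < B" "norm y \<le> B" "\<delta> \<le> B"
  shows "(1 / (2 * B)) ^ m \<le> sig \<delta> m y"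
proof -
  have "y \<bullet> y \<le> B\<^sup>2" "\<delta>\<^sup>2 \<le> B\<^sup>2" using B \<delta> power_mono[of "norm y" B 2] power_mono[of \<delta> B 2] by (simp_all add: dot_square_norm)
  moreover have "0 \<le> B\<^sup>2" by simp
  moreover have "(2 * B)\<^sup>2 = 4 * B\<^sup>2" by (simp add: power2_eq_square)
  ultimately have "y \<bullet> y + \<delta>\<^sup>2 \<le> (2 * B)\<^sup>2" by linarith
  then have "((2 * B)\<^sup>2) powr (- real m / 2) \<le> sig \<delta> m y"
    unfolding sig_def using sig_base_pos[of y] by (intro powr_mono2') auto
  moreover have "((2 * B)\<^sup>2) powr (- real m / 2) = ((2 * B) powr 2) powr (- real m / 2)" using B by simp
  moreover have "\<dots> = (2 * B) powr (- real m)" unfolding powr_powr by simp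
  moreover have "\<dots> = (1 / (2 * B)) ^ m" using B by (simp add: powr_minus powr_realpow power_one_over inverse_eq_divide)
  ultimately show ?thesis by simp
qed

end

context
  fixes \<delta> :: real and e :: "real^'n::finite"
  assumes \<delta>: "\<delta> > 0"
begin

text \<open>Up to a factor, pot is the derivative in direction e of the fundamental solution
  of the Laplacian, with the singularity at 0 smoothed at scale delta.\<close>

definition pot :: "real^'n \<Rightarrow> real" where
  "pot y = - (e \<bullet> y) * sig \<delta> CARD('n) y"

definition pot1 :: "real^'n \<Rightarrow> real^'n" where
  "pot1 y = (real CARD('n) * (e \<bullet> y) * sig \<delta> (CARD('n) + 2) y) *\<^sub>R y - sig \<delta> CARD('n) y *\<^sub>R e"

definition pot2 :: "real^'n \<Rightarrow> real^'n^'n" where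
  "pot2 y = (\<chi> i. (real CARD('n) * sig \<delta> (CARD('n) + 2) y * e $ i) *\<^sub>R y
     + (real CARD('n) * sig \<delta> (CARD('n) + 2) y * y $ i) *\<^sub>R e
     + (real CARD('n) * (e \<bullet> y) * sig \<delta> (CARD('n) + 2) y) *\<^sub>R axis i 1
     - (real CARD('n) * (real CARD('n) + 2) * (e \<bullet> y) * sig \<delta> (CARD('n) + 4) y * y $ i) *\<^sub>R y)"

lemma smooth_pot: "smooth (\<lambda>z. pot (z + a))"
proof (rule smoothI)
  fix m
  have "Ck m (\<lambda>z. - (e \<bullet> z + e \<bullet> a) * sig \<delta> CARD('n) (z + a))"
    by (intro Ck_mult Ck_uminus Ck_affine smooth_sig[OF \<delta>, unfolded smooth_def, rule_format])
  then show "Ck m (\<lambda>z. pot (z + a))" by (simp add: pot_def inner_add_right)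
qed

lemma pot_derivative: "(pot has_derivative (\<lambda>v. pot1 y \<bullet> v)) (at y)"
proof -
  have "((\<lambda>y. - (e \<bullet> y)) has_derivative (\<lambda>v. - (e \<bullet> v))) (at y)" by (auto intro!: derivative_eq_intros)
  from has_derivative_mult[OF this sig_derivative[OF \<delta>]]
  show ?thesis unfolding pot_def[abs_def]
    by (rule has_derivative_eq_rhs) (auto simp: pot1_def inner_diff_left algebra_simps)
qed

lemma pot1_derivative: "((\<lambda>y. pot1 y $ i) has_derivative (\<lambda>v. pot2 y $ i \<bullet> v)) (at y)"
proof -
  have 1: "((\<lambda>y. real CARD('n) * (e \<bullet> y)) has_derivative (\<lambda>v. real CARD('n) * (e \<bullet> v))) (at y)"
    by (auto intro!: derivative_eq_intros)
  have 2: "((\<lambda>y::real^'n. y $ i) has_derivative (\<lambda>v. v $ i)) (at y)"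
    by (rule bounded_linear_imp_has_derivative[OF bounded_linear_vec_nth])
  note 3 = has_derivative_mult[OF has_derivative_mult[OF 1 sig_derivative[OF \<delta>, of "CARD('n) + 2"]] 2]
  note 4 = has_derivative_mult[OF sig_derivative[OF \<delta>, of "CARD('n)"] has_derivative_const[of "e $ i"]]
  have "(\<lambda>y. pot1 y $ i) = (\<lambda>y. real CARD('n) * (e \<bullet> y) * sig \<delta> (CARD('n) + 2) y * y $ i - sig \<delta> CARD('n) y * e $ i)"
    by (auto simp: pot1_def)
  moreover have c4: "CARD('n) + 4 = Suc (Suc (Suc (Suc CARD('n))))" by simp
  ultimately show ?thesis
    by (simp only:) (rule has_derivative_eq_rhs[OF has_derivative_diff[OF 3 4]],
       auto simp: pot2_def c4 inner_diff_left inner_add_left inner_axis' algebra_simps)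
qed

text \<open>The dipole without smoothing is harmonic off its pole, so what is left of the Laplacian
  carries the factor \<open>\<delta>\<^sup>2\<close>.\<close>

lemma pot_trace: "(\<Sum>i\<in>UNIV. pot2 y $ i $ i) = real CARD('n) * (real CARD('n) + 2) * (e \<bullet> y) * \<delta>\<^sup>2 * sig \<delta> (CARD('n) + 4) y"
proof -
  let ?n = "real CARD('n)" and ?s = "sig \<delta> (CARD('n) + 2) y" and ?t = "sig \<delta> (CARD('n) + 4) y"
  have "(\<Sum>i\<in>UNIV. pot2 y $ i $ i) = (\<Sum>i\<in>UNIV. (2 * ?n * ?s) * (e $ i * y $ i) + ?n * (e \<bullet> y) * ?s
      - (?n * (?n + 2) * (e \<bullet> y) * ?t) * (y $ i * y $ i))"
    by (intro sum.cong refl) (simp add: pot2_def algebra_simps)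
  also have "\<dots> = (2 * ?n * ?s) * (e \<bullet> y) + ?n * (?n * (e \<bullet> y) * ?s) - (?n * (?n + 2) * (e \<bullet> y) * ?t) * (y \<bullet> y)"
    by (simp only: sum.distrib sum_subtractf sum_distrib_left[symmetric]) (simp add: inner_vec_def)
  also have "\<dots> = ?n * (?n + 2) * (e \<bullet> y) * (?s - (y \<bullet> y) * ?t)" by (simp add: algebra_simps)
  also have "?s = (y \<bullet> y + \<delta>\<^sup>2) * ?t"
    using sig_square[OF \<delta>, of y "CARD('n) + 2"] by (simp add: numeral_eq_Suc)
  finally show ?thesis by (simp add: algebra_simps)
qed

text \<open>Every factor |y| in a numerator is traded by \<open>norm_sig\<close> for one power of
  the denominator. Thus the dipole, its gradient and its Hessian have the orders n - 1, n and n + 1,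
  uniformly in \<open>\<delta>\<close>.\<close>

lemma norm_pot1: "norm (pot1 y) \<le> (real CARD('n) + 1) * norm e * sig \<delta> CARD('n) y"
proof -
  let ?n = "real CARD('n)" and ?s = "sig \<delta> (CARD('n) + 2) y"
  have s: "?s > 0" "sig \<delta> CARD('n) y > 0" by (rule sig_pos[OF \<delta>])+
  have "norm (pot1 y) \<le> \<bar>?n * (e \<bullet> y) * ?s\<bar> * norm y + sig \<delta> CARD('n) y * norm e"
    unfolding pot1_def using s by (intro order_trans[OF norm_triangle_ineq4]) simp
  moreover have "\<bar>?n * (e \<bullet> y) * ?s\<bar> * norm y \<le> (?n * norm e) * sig \<delta> CARD('n) y"
  proof -
    have "\<bar>?n * (e \<bullet> y) * ?s\<bar> * norm y = (?n * ?s) * (\<bar>e \<bullet> y\<bar> * norm y)" using s by (simp add: abs_mult)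
    also have "\<dots> \<le> (?n * ?s) * (norm e * norm y * norm y)"
      using s by (intro mult_left_mono mult_right_mono Cauchy_Schwarz_ineq2) auto
    also have "\<dots> = (?n * norm e) * (norm y * norm y * ?s)" by simp
    also have "\<dots> \<le> (?n * norm e) * sig \<delta> CARD('n) y"
      using norm_sig2[OF \<delta>, of y "CARD('n)"] by (intro mult_left_mono) (auto simp: numeral_eq_Suc)
    finally show ?thesis .
  qed
  ultimately show ?thesis by (simp add: algebra_simps)
qed

lemma norm_pot2: "norm (pot2 y $ i) \<le> (3 * real CARD('n) + real CARD('n) * (real CARD('n) + 2)) * norm e * sig \<delta> (CARD('n) + 1) y"
proof -
  let ?n = "real CARD('n)" and ?s = "sig \<delta> (CARD('n) + 2) y" and ?t = "sig \<delta> (CARD('n) + 4) y"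
  have s: "?s > 0" "?t > 0" by (rule sig_pos[OF \<delta>])+
  have ei: "\<bar>e $ i\<bar> \<le> norm e" "\<bar>y $ i\<bar> \<le> norm y" "\<bar>e \<bullet> y\<bar> \<le> norm e * norm y"
    by (rule component_le_norm_cart Cauchy_Schwarz_ineq2)+
  have 1: "norm y * ?s \<le> sig \<delta> (CARD('n) + 1) y"
    using norm_sig[OF \<delta>, of y "CARD('n) + 1"] by (simp add: numeral_eq_Suc)
  have 2: "norm y * norm y * norm y * ?t \<le> sig \<delta> (CARD('n) + 1) y"
    using order_trans[OF mult_left_mono[OF norm_sig2[OF \<delta>, of y "CARD('n) + 2"], of "norm y"] 1]
    by (simp add: numeral_eq_Suc mult_ac)
  have "norm (pot2 y $ i) \<le> \<bar>?n * ?s * e $ i\<bar> * norm y + \<bar>?n * ?s * y $ i\<bar> * norm e + \<bar>?n * (e \<bullet> y) * ?s\<bar> * norm (axis i 1 :: real^'n)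
      + \<bar>?n * (?n + 2) * (e \<bullet> y) * ?t * y $ i\<bar> * norm y"
    unfolding pot2_def vec_lambda_beta
    by (intro order_trans[OF norm_triangle_ineq4] order_trans[OF norm_triangle_ineq] add_mono) auto
  also have "\<dots> \<le> (?n * ?s) * (norm e * norm y) + (?n * ?s) * (norm y * norm e) + (?n * ?s) * (norm e * norm y)
      + (?n * (?n + 2) * ?t) * (norm e * norm y * norm y * norm y)"
  proof (intro add_mono)
    show "\<bar>?n * ?s * e $ i\<bar> * norm y \<le> (?n * ?s) * (norm e * norm y)"
      using s mult_left_mono[OF mult_right_mono[OF ei(1), of "norm y"], of "?n * ?s"] by (simp add: abs_mult)
    show "\<bar>?n * ?s * y $ i\<bar> * norm e \<le> (?n * ?s) * (norm y * norm e)"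
      using s mult_left_mono[OF mult_right_mono[OF ei(2), of "norm e"], of "?n * ?s"] by (simp add: abs_mult)
    show "\<bar>?n * (e \<bullet> y) * ?s\<bar> * norm (axis i 1 :: real^'n) \<le> (?n * ?s) * (norm e * norm y)"
      using s mult_left_mono[OF ei(3), of "?n * ?s"] by (simp add: abs_mult mult_ac)
    have "\<bar>e \<bullet> y\<bar> * \<bar>y $ i\<bar> * norm y \<le> norm e * norm y * norm y * norm y"
      using ei by (intro mult_mono) auto
    then have "(?n * (?n + 2) * ?t) * (\<bar>e \<bullet> y\<bar> * \<bar>y $ i\<bar> * norm y) \<le> (?n * (?n + 2) * ?t) * (norm e * norm y * norm y * norm y)"
      using s by (intro mult_left_mono) auto
    moreover have "\<bar>?n * (?n + 2) * (e \<bullet> y) * ?t * y $ i\<bar> * norm y = (?n * (?n + 2) * ?t) * (\<bar>e \<bullet> y\<bar> * \<bar>y $ i\<bar> * norm y)"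
      using s by (simp add: abs_mult)
    ultimately show "\<bar>?n * (?n + 2) * (e \<bullet> y) * ?t * y $ i\<bar> * norm y \<le> (?n * (?n + 2) * ?t) * (norm e * norm y * norm y * norm y)"
      by (simp only:)
  qed
  also have "\<dots> = (3 * ?n * norm e) * (norm y * ?s) + (?n * (?n + 2) * norm e) * (norm y * norm y * norm y * ?t)"
    by (simp add: algebra_simps)
  also have "\<dots> \<le> (3 * ?n * norm e) * sig \<delta> (CARD('n) + 1) y + (?n * (?n + 2) * norm e) * sig \<delta> (CARD('n) + 1) y"
    using 1 2 by (intro add_mono mult_left_mono) auto
  finally show ?thesis by (simp add: algebra_simps)
qed

lemma abs_pot: "\<bar>pot y\<bar> \<le> norm e * sig \<delta> (CARD('n) - 1) y"
proof -
  have "\<bar>pot y\<bar> \<le> (norm e * norm y) * sig \<delta> CARD('n) y"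
    unfolding pot_def abs_mult abs_minus_cancel
    using sig_pos[OF \<delta>, of "CARD('n)" y] Cauchy_Schwarz_ineq2[of e y] by (intro mult_mono) auto
  also have "\<dots> = norm e * (norm y * sig \<delta> (Suc (CARD('n) - 1)) y)" using zero_less_card_finite[where 'a='n] by (simp)
  also have "\<dots> \<le> norm e * sig \<delta> (CARD('n) - 1) y" by (intro mult_left_mono norm_sig[OF \<delta>]) auto
  finally show ?thesis .
qed

end

section \<open>The corner argument\<close>

locale open_cone =
  fixes K :: "(real^'n::finite) set" and e :: "real^'n" and c :: real
  assumes n2: "CARD('n) \<ge> 2" and openK: "open K"
    and coneK: "\<And>z t. z \<in> K \<Longrightarrow> t > 0 \<Longrightarrow> t *\<^sub>R z \<in> K"
    and addK: "\<And>x y. x \<in> K \<Longrightarrow> y \<in> K \<Longrightarrow> x + y \<in> K"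
    and eK: "e \<in> K" and c: "c > 0" and eKc: "\<And>z. z \<in> K \<Longrightarrow> c * norm z \<le> e \<bullet> z"
begin

lemma e0: "norm e > 0"
proof (rule ccontr)
  assume "\<not> norm e > 0"
  then have "e = 0" by simp
  obtain r where r: "r > 0" "ball e r \<subseteq> K" using openK eK open_contains_ball by blast
  obtain x :: "real^'n" where x: "norm x = r / 2" using r(1) vector_choose_size[of "r/2"] by auto
  then have "x \<in> ball e r" using r(1) \<open>e = 0\<close> by simp
  then have "c * norm x \<le> 0" using r(2) eKc[of x] \<open>e = 0\<close> by auto
  then show False using c x r(1) by (simp add: mult_le_0_iff)
qed

text \<open>The part of the layer between K and its translate by
  \<open>\<epsilon> *\<^sub>R e\<close> at distance of order \<open>s * \<epsilon>\<close> from the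
  vertex; \<open>\<rho>\<close> and \<open>C\<close> stay fixed while \<open>s\<close> runs through
  powers.\<close>

definition layer :: "real \<Rightarrow> real \<Rightarrow> real \<Rightarrow> real \<Rightarrow> (real^'n) set" where
  "layer \<rho> C s \<epsilon> = {z \<in> K. z - \<epsilon> *\<^sub>R e \<notin> K \<and> \<rho> * s * \<epsilon> \<le> norm z \<and> norm z \<le> C * s * \<epsilon>}"

lemma layer_measurable: "layer \<rho> C s \<epsilon> \<in> lmeasurable" "layer \<rho> C s \<epsilon> \<in> sets borel"
proof -
  have o: "open {z. z - \<epsilon> *\<^sub>R e \<in> K}"
    using open_vimage[OF openK, of "\<lambda>z. z - \<epsilon> *\<^sub>R e"] by (simp add: vimage_def continuous_intros)
  have "layer \<rho> C s \<epsilon> = K \<inter> - {z. z - \<epsilon> *\<^sub>R e \<in> K} \<inter> {z. \<rho> * s * \<epsilon> \<le> norm z} \<inter> {z. norm z \<le> C * s * \<epsilon>}"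
    by (auto simp: layer_def)
  moreover have "{z::real^'n. \<rho> * s * \<epsilon> \<le> norm z} \<in> sets borel" "{z::real^'n. norm z \<le> C * s * \<epsilon>} \<in> sets borel"
    by (intro borel_closed closed_Collect_le continuous_intros)+
  ultimately show b: "layer \<rho> C s \<epsilon> \<in> sets borel"
    using openK o by (auto intro!: sets.Int borel_open)
  have "bounded (layer \<rho> C s \<epsilon>)" by (rule bounded_subset[OF bounded_cball[of 0 "C * s * \<epsilon>"]]) (auto simp: layer_def)
  then show "layer \<rho> C s \<epsilon> \<in> lmeasurable" using b by (intro bounded_set_imp_lmeasurable) auto
qed

text \<open>A ball of radius proportional to N eps in K is cut by the translates of K by multiples of eps e
  into at most N pieces, each of which is a translate of a part of the layer.\<close>

lemma layer_volume:
  obtains \<rho> C \<omega> where "\<rho> > 0" "C > 0" "\<omega> > 0"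
    "\<And>N \<epsilon>. N \<ge> 1 \<Longrightarrow> \<epsilon> > 0 \<Longrightarrow> \<omega> * \<epsilon> ^ CARD('n) * real N ^ (CARD('n) - 1) \<le> measure lebesgue (layer \<rho> C (real N) \<epsilon>)"
proof -
  \<comment> \<open>A point y with e . y < e . e is moved out of K by - e, because e is nonnegative
    on K.\<close>
  define O1 where "O1 = {x \<in> K. e \<bullet> x < e \<bullet> e}"
  have "O1 = K \<inter> {x. e \<bullet> x < e \<bullet> e}" by (auto simp: O1_def)
  then have openO: "open O1" using openK by (simp add: open_Int open_halfspace_lt)
  have "(1/2) *\<^sub>R e \<in> O1" using eK e0 coneK[OF eK, of "1/2"] by (auto simp: O1_def dot_square_norm)
  \<comment> \<open>A center off the line through e keeps all points shifted along e at a positive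
    distance from the origin; in dimension at least 2 the open set \<open>O1\<close> contains
    one.\<close>
  moreover have "interior (span {e}) = {}"
  proof (rule empty_interior_lowdim)
    have "dim (span {e}) = dim {e}" by (rule dim_span)
    also have "\<dots> \<le> 1" by (simp add: dim_singleton)
    finally show "dim (span {e}) < DIM(real^'n)" using n2 by simp
  qed
  ultimately have "\<not> O1 \<subseteq> span {e}" using openO by (metis empty_iff interior_maximal subsetD)
  then obtain b where b: "b \<in> O1" "b \<notin> span {e}" by blast
  obtain \<rho>' where \<rho>': "\<rho>' > 0" "\<And>y. y \<in> span {e} \<Longrightarrow> \<rho>' \<le> dist b y"
    using separate_point_closed[OF closed_span b(2)] by blast
  obtain r' where r': "r' > 0" "ball b r' \<subseteq> O1" using openO b(1) open_contains_ball by blast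
  define \<rho> where "\<rho> = \<rho>' / 2"
  define r where "r = min r' \<rho>"
  define C where "C = norm b + r + norm e"
  have r: "r > 0" "ball b r \<subseteq> O1" "r \<le> \<rho>" using r' \<rho>'(1) by (auto simp: r_def \<rho>_def)
  define \<omega> where "\<omega> = measure lebesgue (ball b r)"
  have \<omega>: "\<omega> > 0" using r(1) content_ball_pos[of r b] by (simp add: \<omega>_def)
  have C: "C > 0" using e0 r(1) by (simp add: C_def add_nonneg_pos)
  have main: "\<omega> * \<epsilon> ^ CARD('n) * real N ^ (CARD('n) - 1) \<le> measure lebesgue (layer \<rho> C (real N) \<epsilon>)"
    if N: "N \<ge> 1" and \<epsilon>: "\<epsilon> > 0" for N :: nat and \<epsilon> :: real
  proof -
    let ?A = "layer \<rho> C (real N) \<epsilon>"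
    define t where "t = real N * \<epsilon>"
    have t: "t > 0" using N \<epsilon> by (simp add: t_def)
    have sub: "ball (t *\<^sub>R b) (t * r) \<subseteq> (\<Union>j\<in>{..<N}. (+) ((real j * \<epsilon>) *\<^sub>R e) ` ?A)"
    proof
      fix x assume x: "x \<in> ball (t *\<^sub>R b) (t * r)"
      define y where "y = (1 / t) *\<^sub>R x"
      have xy: "x = t *\<^sub>R y" using t by (simp add: y_def)
      have "t * dist b y = dist (t *\<^sub>R b) x" using t by (simp add: xy dist_norm scaleR_diff_right[symmetric])
      then have "t * dist b y < t * r" using x by (simp only: mem_ball)
      then have y: "dist b y < r" using t by (simp only: mult_less_cancel_left_pos)
      then have yO: "y \<in> O1" using r(2) by auto
      then have xK: "x \<in> K" using coneK t by (auto simp: xy O1_def)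
      have xN: "x - (real N * \<epsilon>) *\<^sub>R e \<notin> K"
      proof
        assume "x - (real N * \<epsilon>) *\<^sub>R e \<in> K"
        moreover have "x - (real N * \<epsilon>) *\<^sub>R e = t *\<^sub>R (y - e)" by (simp add: xy t_def scaleR_diff_right)
        ultimately have "t *\<^sub>R (y - e) \<in> K" by (simp only:)
        from eKc[OF this] have "c * norm (t *\<^sub>R (y - e)) \<le> e \<bullet> (t *\<^sub>R (y - e))" .
        moreover have "0 \<le> c * norm (t *\<^sub>R (y - e))" using c by simp
        ultimately have "0 \<le> t * (e \<bullet> y - e \<bullet> e)" by (simp add: inner_diff_right)
        then show False using yO t by (simp add: O1_def zero_le_mult_iff)
      qed
      \<comment> \<open>The first multiple of the shift at which x leaves K, reached within N steps
        by the choice of \<open>O1\<close>; the position just before lies in the layer.\<close>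
      define j where "j = (LEAST j. x - (real j * \<epsilon>) *\<^sub>R e \<notin> K)"
      have j1: "x - (real j * \<epsilon>) *\<^sub>R e \<notin> K" unfolding j_def using xN by (rule LeastI)
      have j2: "j \<le> N" unfolding j_def using xN by (rule Least_le)
      have "j \<noteq> 0" using j1 xK by (intro notI) simp
      then obtain i where i: "j = Suc i" using not0_implies_Suc by blast
      define z where "z = x - (real i * \<epsilon>) *\<^sub>R e"
      have zK: "z \<in> K" using not_less_Least[of i "\<lambda>j. x - (real j * \<epsilon>) *\<^sub>R e \<notin> K"] i by (auto simp: j_def z_def)
      have zn: "z - \<epsilon> *\<^sub>R e \<notin> K" using j1 by (simp add: z_def i algebra_simps)
      define s where "s = real i / real N"
      have z_eq: "z = t *\<^sub>R (y - s *\<^sub>R e)" using N by (simp add: z_def xy t_def s_def algebra_simps)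
      have s: "0 \<le> s" "s \<le> 1" using j2 i N by (auto simp: s_def)
      have "\<rho> \<le> norm (y - s *\<^sub>R e)"
      proof -
        have "\<rho>' \<le> dist b (s *\<^sub>R e)" by (intro \<rho>'(2) span_mul span_base) simp
        also have "\<dots> \<le> dist b y + dist y (s *\<^sub>R e)" by (rule dist_triangle)
        finally show ?thesis using y r(3) by (simp add: \<rho>_def dist_norm)
      qed
      then have "t * \<rho> \<le> t * norm (y - s *\<^sub>R e)" using t by (intro mult_left_mono) auto
      moreover have nz: "norm z = t * norm (y - s *\<^sub>R e)" using t by (simp add: z_eq)
      ultimately have lo: "\<rho> * real N * \<epsilon> \<le> norm z" by (simp add: t_def mult_ac)
      have "norm (y - s *\<^sub>R e) \<le> C"
      proof -
        have "norm y \<le> norm b + norm (y - b)" using norm_triangle_ineq[of b "y - b"] by simp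
        moreover have "norm (y - s *\<^sub>R e) \<le> norm y + s * norm e" using norm_triangle_ineq4[of y "s *\<^sub>R e"] s by simp
        moreover have "s * norm e \<le> 1 * norm e" using s by (intro mult_right_mono) auto
        ultimately show ?thesis using y by (simp add: C_def dist_norm norm_minus_commute)
      qed
      then have "t * norm (y - s *\<^sub>R e) \<le> t * C" using t by (intro mult_left_mono) auto
      then have "norm z \<le> C * real N * \<epsilon>" unfolding nz by (simp add: t_def mult_ac)
      with zK zn lo have "z \<in> ?A" by (simp add: layer_def)
      moreover have "x = (real i * \<epsilon>) *\<^sub>R e + z" by (simp add: z_def)
      moreover have "i < N" using j2 i by simp
      ultimately show "x \<in> (\<Union>j\<in>{..<N}. (+) ((real j * \<epsilon>) *\<^sub>R e) ` ?A)" by blast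
    qed
    have tm: "(+) a ` ?A \<in> lmeasurable" for a using layer_measurable(1) by (rule measurable_translation)
    have "measure lebesgue (ball (t *\<^sub>R b) (t * r)) \<le> measure lebesgue (\<Union>j\<in>{..<N}. (+) ((real j * \<epsilon>) *\<^sub>R e) ` ?A)"
      by (intro measure_mono_fmeasurable sub fmeasurable.finite_UN tm) auto
    also have "\<dots> \<le> (\<Sum>j\<in>{..<N}. measure lebesgue ((+) ((real j * \<epsilon>) *\<^sub>R e) ` ?A))"
      by (intro measure_UNION_le) (auto intro: fmeasurableD tm)
    also have "\<dots> = real N * measure lebesgue ?A" by (simp add: measure_translation)
    finally have "measure lebesgue (ball (t *\<^sub>R b) (t * r)) \<le> real N * measure lebesgue ?A" .
    moreover have "measure lebesgue (ball (t *\<^sub>R b) (t * r)) = t ^ CARD('n) * \<omega>"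
      using t r(1) by (simp add: \<omega>_def content_ball power_mult_distrib)
    \<comment> \<open>The first factor N cancels against the number of pieces.\<close>
    moreover have "t ^ CARD('n) = real N * (real N ^ (CARD('n) - 1) * \<epsilon> ^ CARD('n))"
      using n2 by (cases "CARD('n)") (auto simp: t_def power_mult_distrib)
    ultimately have "real N * (\<omega> * \<epsilon> ^ CARD('n) * real N ^ (CARD('n) - 1)) \<le> real N * measure lebesgue ?A"
      by (simp add: mult_ac)
    then show ?thesis using N by simp
  qed
  have "\<rho> > 0" using \<rho>'(1) by (simp add: \<rho>_def)
  then show ?thesis using that C \<omega> main by blast
qed

end

text \<open>The vertex sits at the origin. Q carries \<open>w\<close> and \<open>f\<close> and lies
  in the pointed cone of d; K is the cone of the cell, on which \<open>f\<close> has the limit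
  \<open>F0\<close>, while on the rest of Q the limit is 0.\<close>

locale corner = open_cone K e c
  for K :: "(real^'n::finite) set" and e c +
  fixes w f :: "real^'n \<Rightarrow> real" and F0 r0 :: real and Q :: "(real^'n) set" and d :: "real^'n"
  assumes r0: "r0 > 0"
    and w: "continuous_on UNIV w" and w0: "\<And>z. z \<notin> Q \<Longrightarrow> w z = 0" and f0: "\<And>z. z \<notin> Q \<Longrightarrow> f z = 0"
    and fint: "set_integrable lebesgue (cball 0 r0) f"
    and near: "\<And>\<nu>. \<nu> > 0 \<Longrightarrow> \<exists>r>0. \<forall>z\<in>Q. norm z < r \<longrightarrow> \<bar>f z - F0 * indicator K z\<bar> \<le> \<nu>"
    and KQ: "K \<inter> ball 0 r0 \<subseteq> Q"
    and dQ: "\<And>z. z \<in> Q \<Longrightarrow> c * norm z \<le> d \<bullet> z"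
    and weak: "\<And>F F1 F2. smooth F \<Longrightarrow> (\<And>z. (F has_derivative (\<lambda>v. F1 z \<bullet> v)) (at z)) \<Longrightarrow>
        (\<And>z i. ((\<lambda>z. F1 z $ i) has_derivative (\<lambda>v. F2 z $ i \<bullet> v)) (at z)) \<Longrightarrow>
        (\<And>z. norm z \<ge> r0 \<Longrightarrow> F z = 0) \<Longrightarrow>
        (LINT z|lebesgue. w z * (\<Sum>i\<in>UNIV. F2 z $ i $ i)) = (LINT z|lebesgue. f z * F z)"
begin

lemma de: "c * norm e \<le> d \<bullet> e"
proof -
  define t where "t = r0 / (2 * norm e)"
  have t: "t > 0" using r0 e0 by (simp add: t_def)
  have "t *\<^sub>R e \<in> K \<inter> ball 0 r0" using coneK[OF eK t] t r0 e0 by (simp add: t_def)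
  then have "c * norm (t *\<^sub>R e) \<le> d \<bullet> (t *\<^sub>R e)" using KQ dQ by blast
  then have "t * (c * norm e) \<le> t * (d \<bullet> e)" using t by (simp add: mult_ac)
  then show ?thesis using t by simp
qed

text \<open>No cancellation occurs between z and the shift: one linear form, d on Q and e on K,
  dominates a multiple of the norm both at z and at e.\<close>

lemma shifted_norm_lower:
  obtains c1 where "c1 > 0" "\<And>z \<epsilon> s. z \<in> Q \<union> K \<Longrightarrow> \<epsilon> > 0 \<Longrightarrow> 1 \<le> s \<Longrightarrow> c1 * (norm z + \<epsilon>) \<le> norm (z + (s * \<epsilon>) *\<^sub>R e)"
proof -
  define a where "a = min c (c * norm e)"
  have a: "a > 0" "a \<le> c" "a \<le> c * norm e" using c e0 by (auto simp: a_def)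
  define D where "D = norm d + norm e"
  have D: "D > 0" using e0 by (simp add: D_def add_nonneg_pos)
  have le: "a * (norm z + \<epsilon>) \<le> norm b * norm (z + (s * \<epsilon>) *\<^sub>R e)"
    if "c * norm z \<le> b \<bullet> z" "c * norm e \<le> b \<bullet> e" "\<epsilon> > 0" "1 \<le> s" for z \<epsilon> s b
  proof -
    have "a * norm z \<le> b \<bullet> z" using mult_right_mono[OF a(2), of "norm z"] that(1) by simp
    moreover have "a * \<epsilon> \<le> (s * \<epsilon>) * (b \<bullet> e)"
    proof -
      have "\<epsilon> * a \<le> (s * \<epsilon>) * (b \<bullet> e)" using that a by (intro mult_mono) auto
      then show ?thesis by (simp add: mult.commute)
    qed
    moreover have "b \<bullet> (z + (s * \<epsilon>) *\<^sub>R e) \<le> norm b * norm (z + (s * \<epsilon>) *\<^sub>R e)" by (rule norm_cauchy_schwarz)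
    ultimately show ?thesis by (simp add: inner_add_right distrib_left)
  qed
  have "a / D * (norm z + \<epsilon>) \<le> norm (z + (s * \<epsilon>) *\<^sub>R e)" if z: "z \<in> Q \<union> K" and "\<epsilon> > 0" "1 \<le> s" for z \<epsilon> s
  proof -
    have "a * (norm z + \<epsilon>) \<le> D * norm (z + (s * \<epsilon>) *\<^sub>R e)"
    proof (cases "z \<in> Q")
      case True
      have "a * (norm z + \<epsilon>) \<le> norm d * norm (z + (s * \<epsilon>) *\<^sub>R e)" by (rule le[OF dQ[OF True] de that(2,3)])
      also have "\<dots> \<le> D * norm (z + (s * \<epsilon>) *\<^sub>R e)" by (intro mult_right_mono) (auto simp: D_def)
      finally show ?thesis .
    next
      case False
      then have "z \<in> K" using z by simp
      have "a * (norm z + \<epsilon>) \<le> norm e * norm (z + (s * \<epsilon>) *\<^sub>R e)" by (rule le[OF eKc[OF \<open>z \<in> K\<close>] eKc[OF eK] that(2,3)])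
      also have "\<dots> \<le> D * norm (z + (s * \<epsilon>) *\<^sub>R e)" by (intro mult_right_mono) (auto simp: D_def)
      finally show ?thesis .
    qed
    then show ?thesis using D by (simp add: field_simps)
  qed
  moreover have "a / D > 0" using a D by simp
  ultimately show ?thesis using that by blast
qed

text \<open>The segment consists of shifts with factors between 1 and 2, so one lower bound serves
  for the mean value inequality.\<close>

lemma segment_shifted_norm_lower:
  assumes c1: "\<forall>z\<in>Q \<union> K. \<forall>\<epsilon>>0. \<forall>s\<ge>1. c1 * (norm z + \<epsilon>) \<le> norm (z + (s * \<epsilon>) *\<^sub>R e)"
    and z: "z \<in> Q \<union> K" and \<epsilon>: "\<epsilon> > 0" and y: "y \<in> closed_segment (z + \<epsilon> *\<^sub>R e) (z + (2 * \<epsilon>) *\<^sub>R e)"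
  shows "c1 * (norm z + \<epsilon>) \<le> norm y"
proof -
  obtain u where u: "0 \<le> u" "y = (1 - u) *\<^sub>R (z + \<epsilon> *\<^sub>R e) + u *\<^sub>R (z + (2 * \<epsilon>) *\<^sub>R e)"
    using y unfolding closed_segment_def by blast
  have "y = ((1 - u) + u) *\<^sub>R z + ((1 - u) * \<epsilon> + u * (2 * \<epsilon>)) *\<^sub>R e"
    unfolding u(2) by (simp only: scaleR_add_right scaleR_left_distrib scaleR_scaleR add_ac)
  also have "(1 - u) * \<epsilon> + u * (2 * \<epsilon>) = (1 + u) * \<epsilon>" by (simp add: algebra_simps)
  finally have "y = z + ((1 + u) * \<epsilon>) *\<^sub>R e" by simp
  moreover have "c1 * (norm z + \<epsilon>) \<le> norm (z + ((1 + u) * \<epsilon>) *\<^sub>R e)"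
    using c1 z \<epsilon> u(1) by auto
  ultimately show ?thesis by (simp only:)
qed

text \<open>Taking a difference gains a factor \<open>\<epsilon> / (\<bar>z\<bar> + \<epsilon>)\<close> in the decay, so that errors that tend to 0 at
  the vertex contribute only \<open>o(\<epsilon> log (1/\<epsilon>))\<close>.\<close>

definition dpot :: "real \<Rightarrow> real \<Rightarrow> real^'n \<Rightarrow> real" where
  "dpot \<delta> \<epsilon> z = pot \<delta> e (z + \<epsilon> *\<^sub>R e) - pot \<delta> e (z + (2 * \<epsilon>) *\<^sub>R e)"

text \<open>The first two bounds are the mean value inequality along the segment of shifts. The
  third is the smoothing error, to be beaten by the choice of \<open>\<delta>\<close>, and the last
  is the size of a single shift on K.\<close>

lemma dpot_bounds:
  obtains C0 where "C0 > 0"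
    "\<And>z \<epsilon> \<delta>. z \<in> Q \<union> K \<Longrightarrow> \<epsilon> > 0 \<Longrightarrow> \<delta> > 0 \<Longrightarrow> \<bar>dpot \<delta> \<epsilon> z\<bar> \<le> C0 * \<epsilon> * (1 / (norm z + \<epsilon>)) ^ CARD('n)"
    "\<And>z \<epsilon> \<delta> i. z \<in> Q \<union> K \<Longrightarrow> \<epsilon> > 0 \<Longrightarrow> \<delta> > 0 \<Longrightarrow>
       \<bar>pot1 \<delta> e (z + \<epsilon> *\<^sub>R e) $ i - pot1 \<delta> e (z + (2 * \<epsilon>) *\<^sub>R e) $ i\<bar> \<le> C0 * \<epsilon> * (1 / (norm z + \<epsilon>)) ^ (CARD('n) + 1)"
    "\<And>z \<epsilon> \<delta> s. z \<in> Q \<union> K \<Longrightarrow> \<epsilon> > 0 \<Longrightarrow> \<delta> > 0 \<Longrightarrow> 1 \<le> s \<Longrightarrow>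
       \<bar>\<Sum>i\<in>UNIV. pot2 \<delta> e (z + (s * \<epsilon>) *\<^sub>R e) $ i $ i\<bar> \<le> C0 * \<delta>\<^sup>2 * (1 / \<epsilon>) ^ (CARD('n) + 3)"
    "\<And>z \<epsilon> \<delta>. z \<in> K \<Longrightarrow> \<epsilon> > 0 \<Longrightarrow> \<delta> > 0 \<Longrightarrow> \<bar>pot \<delta> e (z + \<epsilon> *\<^sub>R e)\<bar> \<le> C0 * (1 / (norm z + \<epsilon>)) ^ (CARD('n) - 1)"
proof -
  obtain c1 where c1: "c1 > 0" "\<And>z \<epsilon> s. z \<in> Q \<union> K \<Longrightarrow> \<epsilon> > 0 \<Longrightarrow> 1 \<le> s \<Longrightarrow> c1 * (norm z + \<epsilon>) \<le> norm (z + (s * \<epsilon>) *\<^sub>R e)"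
    using shifted_norm_lower by blast
  then have "\<forall>z\<in>Q \<union> K. \<forall>\<epsilon>>0. \<forall>s\<ge>1. c1 * (norm z + \<epsilon>) \<le> norm (z + (s * \<epsilon>) *\<^sub>R e)" by blast
  note seg = segment_shifted_norm_lower[OF this]
  let ?n = "CARD('n)"
  define a1 where "a1 = (real ?n + 1) * norm e * (1 / c1) ^ ?n * norm e"
  define a2 where "a2 = (3 * real ?n + real ?n * (real ?n + 2)) * norm e * (1 / c1) ^ (?n + 1) * norm e"
  define a3 where "a3 = real ?n * (real ?n + 2) * norm e * (1 / c1) ^ (?n + 3)"
  define a4 where "a4 = norm e * (1 / c1) ^ (?n - 1)"
  define C0 where "C0 = max (max a1 a2) (max a3 a4)"
  have "a4 > 0" using e0 c1 by (simp add: a4_def)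
  then have C0: "C0 > 0" "a1 \<le> C0" "a2 \<le> C0" "a3 \<le> C0" "a4 \<le> C0" by (auto simp: C0_def)
  have len: "norm ((z + \<epsilon> *\<^sub>R e) - (z + (2 * \<epsilon>) *\<^sub>R e)) = \<epsilon> * norm e" if "\<epsilon> > 0" for z \<epsilon>
  proof -
    have "(z + \<epsilon> *\<^sub>R e) - (z + (2 * \<epsilon>) *\<^sub>R e) = (\<epsilon> - 2 * \<epsilon>) *\<^sub>R e"
      by (simp only: scaleR_left_diff_distrib add_diff_cancel_left)
    moreover have "norm ((\<epsilon> - 2 * \<epsilon>) *\<^sub>R e) = \<epsilon> * norm e" using that by (simp only: norm_scaleR) simp
    ultimately show ?thesis by (simp only:)
  qed
  have sig: "sig \<delta> m y \<le> (1 / c1) ^ m * (1 / (norm z + \<epsilon>)) ^ m"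
    if "c1 * (norm z + \<epsilon>) \<le> norm y" "\<epsilon> > 0" "\<delta> > 0" for y z \<epsilon> \<delta> m
  proof -
    have "0 < c1 * (norm z + \<epsilon>)" using c1(1) that(2) by (intro mult_pos_pos add_nonneg_pos) auto
    from sig_le[OF that(3) this that(1), of m] show ?thesis by (simp add: power_mult_distrib[symmetric])
  qed
  have b1: "\<bar>dpot \<delta> \<epsilon> z\<bar> \<le> C0 * \<epsilon> * (1 / (norm z + \<epsilon>)) ^ ?n" if z: "z \<in> Q \<union> K" and \<epsilon>: "\<epsilon> > 0" and \<delta>: "\<delta> > 0" for z \<epsilon> \<delta>
  proof -
    have "\<bar>dpot \<delta> \<epsilon> z\<bar> \<le> ((real ?n + 1) * norm e * ((1 / c1) ^ ?n * (1 / (norm z + \<epsilon>)) ^ ?n)) * norm ((z + \<epsilon> *\<^sub>R e) - (z + (2 * \<epsilon>) *\<^sub>R e))"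
      unfolding dpot_def
    proof (rule gradient_lipschitz[OF convex_closed_segment pot_derivative[OF \<delta>]])
      fix y assume "y \<in> closed_segment (z + \<epsilon> *\<^sub>R e) (z + (2 * \<epsilon>) *\<^sub>R e)"
      from sig[OF seg[OF z \<epsilon> this] \<epsilon> \<delta>, of ?n]
      show "norm (pot1 \<delta> e y) \<le> (real ?n + 1) * norm e * ((1 / c1) ^ ?n * (1 / (norm z + \<epsilon>)) ^ ?n)"
        by (intro order_trans[OF norm_pot1[OF \<delta>]] mult_left_mono) auto
    qed auto
    also have "\<dots> = a1 * (\<epsilon> * (1 / (norm z + \<epsilon>)) ^ ?n)" unfolding len[OF \<epsilon>] by (simp add: a1_def)
    also have "\<dots> \<le> C0 * (\<epsilon> * (1 / (norm z + \<epsilon>)) ^ ?n)" using C0 \<epsilon> by (intro mult_right_mono) auto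
    finally show ?thesis by simp
  qed
  have b2: "\<bar>pot1 \<delta> e (z + \<epsilon> *\<^sub>R e) $ i - pot1 \<delta> e (z + (2 * \<epsilon>) *\<^sub>R e) $ i\<bar> \<le> C0 * \<epsilon> * (1 / (norm z + \<epsilon>)) ^ (?n + 1)"
    if z: "z \<in> Q \<union> K" and \<epsilon>: "\<epsilon> > 0" and \<delta>: "\<delta> > 0" for z \<epsilon> \<delta> i
  proof -
    have "\<bar>pot1 \<delta> e (z + \<epsilon> *\<^sub>R e) $ i - pot1 \<delta> e (z + (2 * \<epsilon>) *\<^sub>R e) $ i\<bar> \<le> ((3 * real ?n + real ?n * (real ?n + 2)) * norm e * ((1 / c1) ^ (?n + 1) * (1 / (norm z + \<epsilon>)) ^ (?n + 1))) * norm ((z + \<epsilon> *\<^sub>R e) - (z + (2 * \<epsilon>) *\<^sub>R e))"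
    proof (rule gradient_lipschitz[OF convex_closed_segment pot1_derivative[OF \<delta>]])
      fix y assume "y \<in> closed_segment (z + \<epsilon> *\<^sub>R e) (z + (2 * \<epsilon>) *\<^sub>R e)"
      from sig[OF seg[OF z \<epsilon> this] \<epsilon> \<delta>, of "?n + 1"]
      show "norm (pot2 \<delta> e y $ i) \<le> (3 * real ?n + real ?n * (real ?n + 2)) * norm e * ((1 / c1) ^ (?n + 1) * (1 / (norm z + \<epsilon>)) ^ (?n + 1))"
        by (intro order_trans[OF norm_pot2[OF \<delta>]] mult_left_mono) auto
    qed auto
    also have "\<dots> = a2 * (\<epsilon> * (1 / (norm z + \<epsilon>)) ^ (?n + 1))" unfolding len[OF \<epsilon>] by (simp add: a2_def)
    also have "\<dots> \<le> C0 * (\<epsilon> * (1 / (norm z + \<epsilon>)) ^ (?n + 1))" using C0 \<epsilon> by (intro mult_right_mono) auto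
    finally show ?thesis by simp
  qed
  have b3: "\<bar>\<Sum>i\<in>UNIV. pot2 \<delta> e (z + (s * \<epsilon>) *\<^sub>R e) $ i $ i\<bar> \<le> C0 * \<delta>\<^sup>2 * (1 / \<epsilon>) ^ (?n + 3)"
    if z: "z \<in> Q \<union> K" and \<epsilon>: "\<epsilon> > 0" and \<delta>: "\<delta> > 0" and s: "1 \<le> s" for z \<epsilon> \<delta> s
  proof -
    let ?y = "z + (s * \<epsilon>) *\<^sub>R e"
    have "c1 * (norm z + \<epsilon>) \<le> norm ?y" by (rule c1(2)[OF z \<epsilon> s])
    moreover have "c1 * \<epsilon> \<le> c1 * (norm z + \<epsilon>)" using c1(1) by simp
    ultimately have y: "c1 * \<epsilon> \<le> norm ?y" by linarith
    have "0 < c1 * \<epsilon>" using c1(1) \<epsilon> by simp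
    from sig_le[OF \<delta> this y, of "?n + 3"] have sg: "sig \<delta> (?n + 3) ?y \<le> (1 / c1) ^ (?n + 3) * (1 / \<epsilon>) ^ (?n + 3)"
      by (simp add: power_mult_distrib[symmetric])
    have p: "sig \<delta> (?n + 4) ?y > 0" by (rule sig_pos[OF \<delta>])
    have "\<bar>\<Sum>i\<in>UNIV. pot2 \<delta> e ?y $ i $ i\<bar> = real ?n * (real ?n + 2) * \<delta>\<^sup>2 * (\<bar>e \<bullet> ?y\<bar> * sig \<delta> (?n + 4) ?y)"
      unfolding pot_trace[OF \<delta>] using p by (simp add: abs_mult)
    also have "\<dots> \<le> real ?n * (real ?n + 2) * \<delta>\<^sup>2 * ((norm e * norm ?y) * sig \<delta> (?n + 4) ?y)"
      using p by (intro mult_left_mono mult_right_mono Cauchy_Schwarz_ineq2) auto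
    also have "\<dots> = real ?n * (real ?n + 2) * \<delta>\<^sup>2 * norm e * (norm ?y * sig \<delta> (Suc (?n + 3)) ?y)" by (simp add: numeral_eq_Suc)
    also have "\<dots> \<le> real ?n * (real ?n + 2) * \<delta>\<^sup>2 * norm e * ((1 / c1) ^ (?n + 3) * (1 / \<epsilon>) ^ (?n + 3))"
      using order_trans[OF norm_sig[OF \<delta>] sg] by (intro mult_left_mono) auto
    also have "\<dots> = a3 * (\<delta>\<^sup>2 * (1 / \<epsilon>) ^ (?n + 3))" by (simp add: a3_def)
    also have "\<dots> \<le> C0 * (\<delta>\<^sup>2 * (1 / \<epsilon>) ^ (?n + 3))" using C0 \<epsilon> by (intro mult_right_mono) auto
    finally show ?thesis by simp
  qed
  have b4: "\<bar>pot \<delta> e (z + \<epsilon> *\<^sub>R e)\<bar> \<le> C0 * (1 / (norm z + \<epsilon>)) ^ (?n - 1)" if z: "z \<in> K" and \<epsilon>: "\<epsilon> > 0" and \<delta>: "\<delta> > 0" for z \<epsilon> \<delta>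
  proof -
    have "c1 * (norm z + \<epsilon>) \<le> norm (z + \<epsilon> *\<^sub>R e)" using c1(2)[of z \<epsilon> 1] z \<epsilon> by simp
    from sig[OF this \<epsilon> \<delta>, of "?n - 1"]
    have "\<bar>pot \<delta> e (z + \<epsilon> *\<^sub>R e)\<bar> \<le> norm e * ((1 / c1) ^ (?n - 1) * (1 / (norm z + \<epsilon>)) ^ (?n - 1))"
      by (intro order_trans[OF abs_pot[OF \<delta>]] mult_left_mono) auto
    also have "\<dots> = a4 * (1 / (norm z + \<epsilon>)) ^ (?n - 1)" by (simp add: a4_def)
    also have "\<dots> \<le> C0 * (1 / (norm z + \<epsilon>)) ^ (?n - 1)" using C0 \<epsilon> by (intro mult_right_mono) auto
    finally show ?thesis .
  qed
  show ?thesis using that[OF C0(1) b1 b2 b3 b4] by blast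
qed

end

text \<open>A function that is not integrable has integral 0 by convention, so the bound holds in
  that case too.\<close>

lemma abs_integral_le:
  fixes f g :: "'a \<Rightarrow> real"
  assumes g: "integrable M g" and le: "\<And>x. \<bar>f x\<bar> \<le> g x"
  shows "\<bar>\<integral>x. f x \<partial>M\<bar> \<le> (\<integral>x. g x \<partial>M)"
proof (cases "integrable M f")
  case True
  have "\<bar>\<integral>x. f x \<partial>M\<bar> \<le> (\<integral>x. \<bar>f x\<bar> \<partial>M)" by (rule integral_abs_bound)
  also have "\<dots> \<le> (\<integral>x. g x \<partial>M)" using True g le by (intro integral_mono) auto
  finally show ?thesis .
next
  case False
  have "0 \<le> (\<integral>x. g x \<partial>M)" using le by (intro integral_nonneg_AE AE_I2) (meson abs_ge_zero order_trans)
  with False show ?thesis by (simp add: not_integrable_integral_eq)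
qed

text \<open>The weight (|z| + \<epsilon>)^(-n) is dominated by a sum over J + 1 balls of radii
  \<open>\<epsilon> * real l ^ i\<close>, all with the same weighted volume. Its integral therefore
  grows like J, that is, like log(1/\<epsilon>).\<close>

lemma radial_weight_integral:
  fixes l J :: nat and r0 :: real
  assumes l: "l \<ge> 2" and r0: "r0 > 0"
  defines "\<epsilon> \<equiv> r0 / real l ^ J"
  obtains g :: "real^'n::finite \<Rightarrow> real" where "integrable lborel g" 
    "\<And>z. norm z \<le> r0 \<Longrightarrow> (1 / (norm z + \<epsilon>)) ^ CARD('n) \<le> g z" "\<And>z. g z \<ge> 0"
    "(\<integral>z. g z \<partial>lborel) = real (J + 1) * real l ^ CARD('n) * unit_ball_vol (real CARD('n))"
proof -
  let ?n = "CARD('n)"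
  have e: "\<epsilon> > 0" using l r0 by (simp add: \<epsilon>_def)
  have eJ: "\<epsilon> * real l ^ J = r0" using l by (simp add: \<epsilon>_def)
  define b where "b i = (real l / (\<epsilon> * real l ^ i)) ^ ?n" for i
  have b: "b i \<ge> 0" for i using e by (simp add: b_def)
  define g where "g z = (\<Sum>i\<le>J. b i * indicator (cball 0 (\<epsilon> * real l ^ i)) z)" for z :: "real^'n"
  have g0: "g z \<ge> 0" for z unfolding g_def using b by (intro sum_nonneg) (auto simp: indicator_def)
  have int: "integrable lborel (\<lambda>z::real^'n. b i * indicator (cball 0 (\<epsilon> * real l ^ i)) z)" for i
    by (intro integrable_mult_right integrable_real_indicator) (use emeasure_lborel_cball_finite in auto)
  have "integrable lborel g" unfolding g_def by (intro Bochner_Integration.integrable_sum int)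
  moreover have "(1 / (norm z + \<epsilon>)) ^ ?n \<le> g z" if z: "norm z \<le> r0" for z
  proof -
    define i where "i = (LEAST i. norm z \<le> \<epsilon> * real l ^ i)"
    have zJ: "norm z \<le> \<epsilon> * real l ^ J" using z by (simp add: eJ)
    have i: "norm z \<le> \<epsilon> * real l ^ i" "i \<le> J" unfolding i_def using zJ by (rule LeastI, rule Least_le)
    have "1 / (norm z + \<epsilon>) \<le> real l / (\<epsilon> * real l ^ i)"
    proof (cases i)
      case 0
      have "1 / (norm z + \<epsilon>) \<le> 1 / \<epsilon>" using e by (intro divide_left_mono mult_pos_pos add_nonneg_pos) auto
      also have "\<dots> \<le> real l / \<epsilon>" using l e by (intro divide_right_mono) auto
      finally show ?thesis by (simp add: 0)
    next
      case (Suc j)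
      have "\<not> norm z \<le> \<epsilon> * real l ^ j" using not_less_Least[of j "\<lambda>i. norm z \<le> \<epsilon> * real l ^ i"] Suc by (simp add: i_def)
      then have "\<epsilon> * real l ^ j \<le> norm z + \<epsilon>" using e by simp
      moreover have "0 < \<epsilon> * real l ^ j" using e l by simp
      ultimately have "1 / (norm z + \<epsilon>) \<le> 1 / (\<epsilon> * real l ^ j)" using e l
        by (intro divide_left_mono mult_pos_pos add_nonneg_pos) auto
      then show ?thesis using l by (simp add: Suc)
    qed
    then have "(1 / (norm z + \<epsilon>)) ^ ?n \<le> b i" unfolding b_def using e by (intro power_mono) auto
    also have "\<dots> = b i * indicator (cball 0 (\<epsilon> * real l ^ i)) z" using i by simp
    also have "\<dots> \<le> g z" unfolding g_def using i(2) b
      by (intro member_le_sum[where f = "\<lambda>i. b i * indicator (cball 0 (\<epsilon> * real l ^ i)) z"]) (auto simp: indicator_def)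
    finally show ?thesis .
  qed
  moreover have "(\<integral>z. g z \<partial>lborel) = real (J + 1) * real l ^ ?n * unit_ball_vol (real ?n)"
  proof -
    have "(\<integral>z. g z \<partial>lborel) = (\<Sum>i\<le>J. b i * measure lborel (cball (0::real^'n) (\<epsilon> * real l ^ i)))"
      unfolding g_def by (subst Bochner_Integration.integral_sum[OF int]) simp
    also have "\<dots> = (\<Sum>i\<le>J. real l ^ ?n * unit_ball_vol (real ?n))"
    proof (intro sum.cong refl)
      fix i
      have p: "\<epsilon> * real l ^ i > 0" using e l by simp
      have "b i * measure lborel (cball (0::real^'n) (\<epsilon> * real l ^ i)) = ((real l / (\<epsilon> * real l ^ i)) * (\<epsilon> * real l ^ i)) ^ ?n * unit_ball_vol (real ?n)"
        using p unfolding b_def power_mult_distrib by (simp add: content_cball power_mult_distrib)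
      also have "(real l / (\<epsilon> * real l ^ i)) * (\<epsilon> * real l ^ i) = real l"
        using less_imp_neq[OF p] by (metis nonzero_eq_divide_eq)
      finally show "b i * measure lborel (cball (0::real^'n) (\<epsilon> * real l ^ i)) = real l ^ ?n * unit_ball_vol (real ?n)" .
    qed
    also have "\<dots> = real (J + 1) * real l ^ ?n * unit_ball_vol (real ?n)" by simp
    finally show ?thesis .
  qed
  ultimately show ?thesis using that[of g] g0 by blast
qed

section \<open>The tested equation at the corner: main term, left side, comparison\<close>

context corner
begin

text \<open>On K + \<epsilon> e the factor e . y is at least a multiple of |z| + \<epsilon>, because
  e lies in K and is strictly positive on it; so the dipole has one sign and full size. With
  \<open>\<delta> \<le> \<epsilon>\<close> the smoothing changes this by constants only.\<close>

lemma minus_pot_lower: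
  obtains a where "a > 0" "\<And>z \<epsilon> \<delta>. z \<in> K \<Longrightarrow> 0 < \<delta> \<Longrightarrow> \<delta> \<le> \<epsilon> \<Longrightarrow> a * (1 / (norm z + \<epsilon>)) ^ (CARD('n) - 1) \<le> - pot \<delta> e (z + \<epsilon> *\<^sub>R e)"
proof -
  define b where "b = min c (norm e * norm e)"
  have b: "b > 0" "b \<le> c" "b \<le> norm e * norm e" using c e0 by (auto simp: b_def)
  define D where "D = 1 + norm e"
  have D: "D > 0" using e0 unfolding D_def by linarith
  define a where "a = b * (1 / (2 * D)) ^ CARD('n)"
  have "a * (1 / (norm z + \<epsilon>)) ^ (CARD('n) - 1) \<le> - pot \<delta> e (z + \<epsilon> *\<^sub>R e)" if z: "z \<in> K" and d: "0 < \<delta>" "\<delta> \<le> \<epsilon>" for z \<epsilon> \<delta>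
  proof -
    define A where "A = norm z + \<epsilon>"
    have A: "A > 0" "\<delta> \<le> A" using d by (auto simp: A_def add_nonneg_pos add_increasing)
    have "b * A \<le> e \<bullet> (z + \<epsilon> *\<^sub>R e)"
    proof -
      have "b * norm z \<le> e \<bullet> z" using mult_right_mono[OF b(2), of "norm z"] eKc[OF z] by simp
      moreover have "b * \<epsilon> \<le> \<epsilon> * (e \<bullet> e)" using mult_right_mono[OF b(3), of \<epsilon>] d by (simp add: dot_square_norm power2_eq_square mult_ac)
      ultimately show ?thesis by (simp add: A_def inner_add_right distrib_left)
    qed
    moreover have "(1 / (2 * (D * A))) ^ CARD('n) \<le> sig \<delta> CARD('n) (z + \<epsilon> *\<^sub>R e)"
    proof (rule sig_ge[OF d(1)])
      show "0 < D * A" using D A by simp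
      have "norm (z + \<epsilon> *\<^sub>R e) \<le> norm z + \<epsilon> * norm e" using norm_triangle_ineq[of z "\<epsilon> *\<^sub>R e"] d by simp
      also have "\<dots> \<le> D * A" using d e0 by (simp add: D_def A_def algebra_simps)
      finally show "norm (z + \<epsilon> *\<^sub>R e) \<le> D * A" .
      have "1 * A \<le> D * A" using A by (intro mult_right_mono) (auto simp: D_def)
      then show "\<delta> \<le> D * A" using A(2) by simp
    qed
    moreover have "0 \<le> e \<bullet> (z + \<epsilon> *\<^sub>R e)"
    proof -
      have "0 \<le> b * A" using b(1) A(1) by simp
      then show ?thesis using \<open>b * A \<le> e \<bullet> (z + \<epsilon> *\<^sub>R e)\<close> by (rule order_trans)
    qed
    moreover have "0 \<le> (1 / (2 * (D * A))) ^ CARD('n)" using D A(1) by (intro zero_le_power) simp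
    ultimately have "(b * A) * (1 / (2 * (D * A))) ^ CARD('n) \<le> (e \<bullet> (z + \<epsilon> *\<^sub>R e)) * sig \<delta> CARD('n) (z + \<epsilon> *\<^sub>R e)"
      by (rule mult_mono)
    moreover have "(b * A) * (1 / (2 * (D * A))) ^ CARD('n) = a * (1 / A) ^ (CARD('n) - 1)"
    proof -
      have "(1 / (2 * (D * A))) ^ CARD('n) = (1 / (2 * D)) ^ CARD('n) * (1 / A) ^ CARD('n)"
        by (simp add: power_mult_distrib[symmetric] mult.assoc)
      moreover have "A * (1 / A) ^ CARD('n) = (1 / A) ^ (CARD('n) - 1)"
        using A n2 by (cases "CARD('n)") auto
      ultimately show ?thesis by (simp add: a_def mult_ac)
    qed
    ultimately show ?thesis by (simp add: pot_def[OF d(1)] A_def)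
  qed
  moreover have "a > 0" using b D by (simp add: a_def)
  ultimately show ?thesis using that by blast
qed

text \<open>Translating the second shift trades the difference of kernels for a difference of
  domains. Where K and its translate overlap only the increment of \<open>\<eta>\<close> survives,
  O(\<epsilon>) and away from the vertex. The rest is the dipole over the layer; it is nonpositive
  there, and each of J - J0 scales contributes at most \<open>- c5 * \<epsilon>\<close>.\<close>

lemma corner_integral_le:
  fixes \<eta> :: "real^'n \<Rightarrow> real"
  assumes \<eta>: "smooth \<eta>" "\<And>z. 0 \<le> \<eta> z" "\<And>z. \<eta> z \<le> 1" "\<And>z. norm z \<le> r0 / 2 \<Longrightarrow> \<eta> z = 1" "\<And>z. norm z \<ge> r0 \<Longrightarrow> \<eta> z = 0"
  obtains l :: nat and c5 Cs :: real and J0 :: nat where "l \<ge> 2" "c5 > 0"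
    "\<And>J \<delta>. J \<ge> J0 \<Longrightarrow> 0 < \<delta> \<Longrightarrow> \<delta> \<le> r0 / real l ^ J \<Longrightarrow>
      (\<integral>z. indicator K z * (\<eta> z * dpot \<delta> (r0 / real l ^ J) z) \<partial>lborel) \<le> (Cs - real (J - J0) * c5) * (r0 / real l ^ J)"
proof -
  let ?n = "CARD('n)"
  obtain \<rho> C \<omega> where vol: "\<rho> > 0" "C > 0" "\<omega> > 0"
    "\<And>N \<epsilon>. N \<ge> 1 \<Longrightarrow> \<epsilon> > 0 \<Longrightarrow> \<omega> * \<epsilon> ^ CARD('n) * real N ^ (CARD('n) - 1) \<le> measure lebesgue (layer \<rho> C (real N) \<epsilon>)"
    using layer_volume by blast
  obtain a where a: "a > 0" "\<And>z \<epsilon> \<delta>. z \<in> K \<Longrightarrow> 0 < \<delta> \<Longrightarrow> \<delta> \<le> \<epsilon> \<Longrightarrow> a * (1 / (norm z + \<epsilon>)) ^ (?n - 1) \<le> - pot \<delta> e (z + \<epsilon> *\<^sub>R e)"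
    using minus_pot_lower by blast
  obtain C0 where C0: "C0 > 0" "\<And>z \<epsilon> \<delta>. z \<in> K \<Longrightarrow> \<epsilon> > 0 \<Longrightarrow> \<delta> > 0 \<Longrightarrow> \<bar>pot \<delta> e (z + \<epsilon> *\<^sub>R e)\<bar> \<le> C0 * (1 / (norm z + \<epsilon>)) ^ (?n - 1)"
    using dpot_bounds by metis
  \<comment> \<open>A ratio above \<open>C / \<rho>\<close> makes the pieces of the layer
    disjoint.\<close>
  obtain l0 :: nat where "real l0 > C / \<rho>" using reals_Archimedean2 by blast
  define l where "l = max 2 l0"
  have "real l > C / \<rho>" using \<open>real l0 > C / \<rho>\<close> by (simp add: l_def)
  then have l: "l \<ge> 2" "C < \<rho> * real l" using vol(1) by (auto simp: l_def field_simps)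
  \<comment> \<open>Dropping the \<open>J0\<close> outermost scales keeps the pieces, and the length
    of the shift, within r0 / 4, so that \<open>\<eta>\<close> is 1 there.\<close>
  obtain J0 where J0: "4 * (C + 1) + 4 * norm e < real l ^ J0" using real_arch_pow[of "real l"] l(1) by auto
  obtain g\<eta> where g\<eta>: "\<And>x. (\<eta> has_derivative (\<lambda>v. g\<eta> x \<bullet> v)) (at x)" using smooth_has_gradient[OF \<eta>(1)] by blast
  have "continuous_on UNIV (\<lambda>x. \<chi> i. g\<eta> x $ i)"
    using smooth_gradient[OF \<eta>(1) g\<eta>] Ck_continuous by (intro continuous_on_vec_lambda) (auto simp: smooth_def)
  then have cont_g\<eta>: "continuous_on UNIV g\<eta>" by simp
  have \<eta>out: "\<eta> z = 0" if "z \<notin> cball 0 r0" for z using \<eta>(5)[of z] that by simp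
  have cont\<eta>: "continuous_on UNIV \<eta>" using \<eta>(1) Ck_continuous by (auto simp: smooth_def)
  have gout: "g\<eta> z = 0" if "z \<notin> cball 0 r0" for z
    using gradient_outside_support[OF g\<eta> \<eta>out that] .
  obtain L where L: "L \<ge> 0" "\<And>x. norm (g\<eta> x) \<le> L"
    using continuous_support_bounded[OF cont_g\<eta> gout] by blast
  have lip: "\<bar>\<eta> x - \<eta> y\<bar> \<le> L * norm (x - y)" for x y
    using gradient_lipschitz[OF convex_UNIV g\<eta> L(2)] by simp
  define V where "V = measure lborel (cball (0::real^'n) (2 * r0))"
  define Cs' where "Cs' = L * norm e * (C0 * (4 / r0) ^ (?n - 1))"
  have Cs': "Cs' \<ge> 0" using L C0 r0 by (simp add: Cs'_def)
  define c5 where "c5 = a * (1 / (C + 1)) ^ (?n - 1) * \<omega>"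
  have c5: "c5 > 0" using a vol by (simp add: c5_def)
  have main: "(\<integral>z. indicator K z * (\<eta> z * dpot \<delta> (r0 / real l ^ J) z) \<partial>lborel) \<le> (Cs' * V - real (J - J0) * c5) * (r0 / real l ^ J)"
    if J: "J \<ge> J0" and \<delta>: "0 < \<delta>" "\<delta> \<le> r0 / real l ^ J" for J \<delta>
  proof -
    define \<epsilon> where "\<epsilon> = r0 / real l ^ J"
    have \<epsilon>: "\<epsilon> > 0" "\<delta> \<le> \<epsilon>" using r0 l \<delta> by (auto simp: \<epsilon>_def)
    have eJ: "\<epsilon> * real l ^ J = r0" using l by (simp add: \<epsilon>_def)
    have small: "\<epsilon> * (4 * (C + 1) + 4 * norm e) \<le> r0"
    proof -
      have "\<epsilon> * (4 * (C + 1) + 4 * norm e) \<le> \<epsilon> * real l ^ J0" using J0 \<epsilon> by (intro mult_left_mono) auto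
      also have "\<dots> \<le> \<epsilon> * real l ^ J" using J l \<epsilon> by (intro mult_left_mono power_increasing) auto
      finally show ?thesis using eJ by simp
    qed
    have ee: "\<epsilon> * norm e \<le> r0 / 4"
    proof -
      have "0 \<le> \<epsilon> * (4 * (C + 1))" using \<epsilon> vol by simp
      then show ?thesis using small by (simp add: distrib_left)
    qed
    define A where "A i = layer \<rho> C (real (l ^ i)) \<epsilon>" for i
    define b where "b i = a * (1 / ((C + 1) * (real l ^ i * \<epsilon>))) ^ (?n - 1)" for i
    have b: "b i \<ge> 0" for i using a vol \<epsilon> by (simp add: b_def)
    have A_unique: "i = j" if "z \<in> A i" "z \<in> A j" for z i j
    proof -
      have False if "i < j" "z \<in> A i" "z \<in> A j" for i j
      proof -
        have "real l * real l ^ i \<le> real l ^ j" using power_increasing[of "Suc i" j "real l"] that(1) l by simp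
        then have "\<rho> * (real l * real l ^ i) * \<epsilon> \<le> \<rho> * real l ^ j * \<epsilon>" using vol \<epsilon> by (intro mult_right_mono mult_left_mono) auto
        also have "\<dots> \<le> C * real l ^ i * \<epsilon>" using that by (auto simp: A_def layer_def)
        finally have "(\<rho> * real l) * (real l ^ i * \<epsilon>) \<le> C * (real l ^ i * \<epsilon>)" by (simp add: mult_ac)
        moreover have "0 < real l ^ i * \<epsilon>" using l \<epsilon> by simp
        ultimately show False using l(2) by (simp only: mult_le_cancel_right_pos)
      qed
      then show ?thesis using that by (metis linorder_neqE_nat)
    qed
    have A_bound: "norm z \<le> r0 / 4 \<and> b i \<le> - pot \<delta> e (z + \<epsilon> *\<^sub>R e) \<and> z \<in> K \<and> z - \<epsilon> *\<^sub>R e \<notin> K"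
      if z: "z \<in> A i" and i: "i < J - J0" for z i
    proof -
      define X where "X = real l ^ i * \<epsilon>"
      define Y where "Y = real l ^ J0"
      have zK: "z \<in> K" "z - \<epsilon> *\<^sub>R e \<notin> K" and nz: "norm z \<le> C * X" using z by (auto simp: A_def layer_def X_def)
      have p: "0 < X" using l \<epsilon> by (simp add: X_def)
      have eX: "\<epsilon> \<le> X"
      proof -
        have "1 * \<epsilon> \<le> X" unfolding X_def using l \<epsilon> by (intro mult_right_mono one_le_power) auto
        then show ?thesis by simp
      qed
      have "real l ^ i * real l ^ J0 \<le> real l ^ J"
        unfolding power_add[symmetric] using i l by (intro power_increasing) auto
      then have "\<epsilon> * (real l ^ i * real l ^ J0) \<le> \<epsilon> * real l ^ J" using \<epsilon> by (intro mult_left_mono) auto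
      then have 1: "X * Y \<le> r0" using eJ by (simp add: X_def Y_def mult_ac)
      have "4 * C \<le> Y" using J0 e0 unfolding Y_def[symmetric] by argo
      then have "X * (4 * C) \<le> X * Y" using p by (intro mult_left_mono) auto
      then have "X * (4 * C) \<le> r0" using 1 by (rule order_trans)
      moreover have "4 * norm z \<le> X * (4 * C)" using nz by (simp add: mult.commute)
      ultimately have "4 * norm z \<le> r0" by (rule order_trans[rotated])
      then have n4: "norm z \<le> r0 / 4" by simp
      have "norm z + \<epsilon> \<le> (C + 1) * X" using nz eX by (simp only: distrib_right mult_1 add_mono)
      then have "1 / ((C + 1) * X) \<le> 1 / (norm z + \<epsilon>)"
        using \<epsilon> p vol by (intro divide_left_mono mult_pos_pos add_nonneg_pos) auto
      then have "b i \<le> a * (1 / (norm z + \<epsilon>)) ^ (?n - 1)"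
        unfolding b_def X_def[symmetric] using a(1) p vol by (intro mult_left_mono power_mono) auto
      then have "b i \<le> - pot \<delta> e (z + \<epsilon> *\<^sub>R e)" using a(2)[OF zK(1) \<delta>(1) \<epsilon>(2)] by linarith
      then show ?thesis using zK n4 by blast
    qed
    define D where "D z = (indicator K z * \<eta> z - indicator K (z - \<epsilon> *\<^sub>R e) * \<eta> (z - \<epsilon> *\<^sub>R e)) * pot \<delta> e (z + \<epsilon> *\<^sub>R e)" for z
    \<comment> \<open>A majorant of \<open>D\<close>: the guaranteed negative values on the pieces,
      plus the effect of the cut-off.\<close>
    define U where "U z = - (\<Sum>i<J - J0. b i * indicator (A i) z) + (Cs' * \<epsilon>) * indicator (cball 0 (2 * r0)) z" for z :: "real^'n"
    have Ui: "integrable lborel (\<lambda>z. b i * indicator (A i) z)" for i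
      using layer_measurable[of \<rho> C "real (l ^ i)" \<epsilon>] unfolding A_def
      by (intro integrable_mult_right integrable_real_indicator)
         (auto simp: fmeasurable_def emeasure_completion less_top)
    have Uc: "integrable lborel (\<lambda>z::real^'n. (Cs' * \<epsilon>) * indicator (cball 0 (2 * r0)) z)"
      by (intro integrable_mult_right integrable_real_indicator) (use emeasure_lborel_cball_finite in auto)
    have DU: "D z \<le> U z" for z
    proof -
      have last: "0 \<le> (Cs' * \<epsilon>) * indicator (cball 0 (2 * r0)) z" using Cs' \<epsilon> by simp
      show ?thesis
      proof (cases "z \<in> K \<and> z - \<epsilon> *\<^sub>R e \<in> K")
        case True
        then have none: "(\<Sum>i<J - J0. b i * indicator (A i) z) = 0" by (intro sum.neutral) (auto simp: A_def layer_def)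
        have D: "D z = (\<eta> z - \<eta> (z - \<epsilon> *\<^sub>R e)) * pot \<delta> e (z + \<epsilon> *\<^sub>R e)" using True by (simp add: D_def)
        have n1: "norm (z - \<epsilon> *\<^sub>R e) \<le> norm z + \<epsilon> * norm e" "norm z \<le> norm (z - \<epsilon> *\<^sub>R e) + \<epsilon> * norm e"
          using norm_triangle_ineq4[of z "\<epsilon> *\<^sub>R e"] norm_triangle_ineq[of "z - \<epsilon> *\<^sub>R e" "\<epsilon> *\<^sub>R e"] \<epsilon> by auto
        consider "norm z \<le> r0 / 4" | "norm z > 2 * r0" | "r0 / 4 < norm z" "norm z \<le> 2 * r0" by linarith
        then show ?thesis
        proof cases
          case 1
          then have "\<eta> z = 1" "\<eta> (z - \<epsilon> *\<^sub>R e) = 1" using n1 ee r0 by (auto intro!: \<eta>(4))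
          then show ?thesis using last by (simp add: D U_def none)
        next
          case 2
          then have "\<eta> z = 0" "\<eta> (z - \<epsilon> *\<^sub>R e) = 0" using n1 ee r0 by (auto intro!: \<eta>(5))
          then show ?thesis using last by (simp add: D U_def none)
        next
          case 3
          have "\<bar>\<eta> z - \<eta> (z - \<epsilon> *\<^sub>R e)\<bar> \<le> L * (\<epsilon> * norm e)" using lip[of z "z - \<epsilon> *\<^sub>R e"] \<epsilon> by simp
          moreover have "\<bar>pot \<delta> e (z + \<epsilon> *\<^sub>R e)\<bar> \<le> C0 * (4 / r0) ^ (?n - 1)"
          proof -
            have "1 / (norm z + \<epsilon>) \<le> 1 / (r0 / 4)" using 3 r0 \<epsilon> by (intro divide_left_mono mult_pos_pos add_nonneg_pos) auto
            then have "(1 / (norm z + \<epsilon>)) ^ (?n - 1) \<le> (4 / r0) ^ (?n - 1)" using \<epsilon> by (intro power_mono) (auto simp: field_simps)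
            then have "C0 * (1 / (norm z + \<epsilon>)) ^ (?n - 1) \<le> C0 * (4 / r0) ^ (?n - 1)" using C0(1) by (intro mult_left_mono) auto
            then show ?thesis using C0(2)[of z \<epsilon> \<delta>] True \<epsilon>(1) \<delta>(1) by linarith
          qed
          ultimately have "\<bar>D z\<bar> \<le> (L * (\<epsilon> * norm e)) * (C0 * (4 / r0) ^ (?n - 1))"
            unfolding D abs_mult using L \<epsilon> by (intro mult_mono) auto
          also have "\<dots> = Cs' * \<epsilon>" by (simp add: Cs'_def)
          finally show ?thesis using 3 by (simp add: U_def none)
        qed
      next
        case False
        show ?thesis
        proof (cases "z \<in> K")
          case notK: False
          have "z - \<epsilon> *\<^sub>R e \<notin> K"
          proof
            assume "z - \<epsilon> *\<^sub>R e \<in> K"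
            from addK[OF this coneK[OF eK \<epsilon>(1)]] show False using notK by simp
          qed
          moreover have "(\<Sum>i<J - J0. b i * indicator (A i) z) = 0" using notK by (intro sum.neutral) (auto simp: A_def layer_def)
          ultimately show ?thesis using notK last by (simp add: D_def U_def)
        next
          case zK: True
          then have D: "D z = \<eta> z * pot \<delta> e (z + \<epsilon> *\<^sub>R e)" using False by (simp add: D_def)
          have "0 \<le> a * (1 / (norm z + \<epsilon>)) ^ (?n - 1)" using a \<epsilon> by simp
          then have neg: "pot \<delta> e (z + \<epsilon> *\<^sub>R e) \<le> 0" using a(2)[OF zK \<delta>(1) \<epsilon>(2)] by linarith
          show ?thesis
          proof (cases "\<exists>i<J - J0. z \<in> A i")
            case True
            then obtain i where i: "i < J - J0" "z \<in> A i" by blast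
            have "(\<Sum>i<J - J0. b i * indicator (A i) z) = b i * indicator (A i) z + (\<Sum>j\<in>{..<J - J0} - {i}. b j * indicator (A j) z)"
              using i by (intro sum.remove) auto
            also have "(\<Sum>j\<in>{..<J - J0} - {i}. b j * indicator (A j) z) = 0"
              using A_unique[OF i(2)] by (intro sum.neutral) (auto simp: indicator_def)
            finally have s: "(\<Sum>i<J - J0. b i * indicator (A i) z) = b i" using i by simp
            have "\<eta> z = 1" using A_bound[OF i(2,1)] r0 by (intro \<eta>(4)) auto
            then show ?thesis using A_bound[OF i(2,1)] last by (simp add: D U_def s)
          next
            case False
            then have "(\<Sum>i<J - J0. b i * indicator (A i) z) = 0" by (intro sum.neutral) auto
            moreover have "\<eta> z * pot \<delta> e (z + \<epsilon> *\<^sub>R e) \<le> 0" using \<eta>(2) neg by (intro mult_nonneg_nonpos) auto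
            ultimately show ?thesis using last by (simp add: D U_def)
          qed
        qed
      qed
    qed
    have contp: "continuous_on UNIV (\<lambda>z. pot \<delta> e (z + x))" for x
      using smooth_pot[OF \<delta>(1), of e x] Ck_continuous by (auto simp: smooth_def)
    have borK: "K \<in> sets borel" "{z. z - \<epsilon> *\<^sub>R e \<in> K} \<in> sets borel"
      using openK open_vimage[OF openK, of "\<lambda>z. z - \<epsilon> *\<^sub>R e"] by (auto simp: vimage_def continuous_intros)
    have i0: "integrable lborel (\<lambda>z. indicator K z * (\<eta> z * pot \<delta> e (z + x)))" for x
    proof -
      have "integrable lborel (\<lambda>z. \<eta> z * pot \<delta> e (z + x))"
        by (rule continuous_support_integrable[of _ 0 r0]) (use \<eta>out in \<open>auto intro!: continuous_intros cont\<eta> contp\<close>)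
      then have "integrable lborel (\<lambda>z. indicator K z *\<^sub>R (\<eta> z * pot \<delta> e (z + x)))"
        using borK by (intro integrable_mult_indicator) auto
      then show ?thesis by simp
    qed
    have i2: "integrable lborel (\<lambda>z. indicator K (z - \<epsilon> *\<^sub>R e) * (\<eta> (z - \<epsilon> *\<^sub>R e) * pot \<delta> e (z + \<epsilon> *\<^sub>R e)))"
    proof -
      have "integrable lborel (\<lambda>z. \<eta> (z - \<epsilon> *\<^sub>R e) * pot \<delta> e (z + \<epsilon> *\<^sub>R e))"
      proof (rule continuous_support_integrable[of _ "\<epsilon> *\<^sub>R e" r0])
        show "continuous_on UNIV (\<lambda>z. \<eta> (z - \<epsilon> *\<^sub>R e) * pot \<delta> e (z + \<epsilon> *\<^sub>R e))"
          by (intro continuous_intros contp continuous_on_compose2[OF cont\<eta>]) auto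
        show "\<eta> (z - \<epsilon> *\<^sub>R e) * pot \<delta> e (z + \<epsilon> *\<^sub>R e) = 0" if "z \<notin> cball (\<epsilon> *\<^sub>R e) r0" for z
          using that \<eta>out[of "z - \<epsilon> *\<^sub>R e"] by (simp add: dist_norm norm_minus_commute)
      qed
      then have "integrable lborel (\<lambda>z. indicator {z. z - \<epsilon> *\<^sub>R e \<in> K} z *\<^sub>R (\<eta> (z - \<epsilon> *\<^sub>R e) * pot \<delta> e (z + \<epsilon> *\<^sub>R e)))"
        using borK by (intro integrable_mult_indicator) auto
      then show ?thesis by (simp add: indicator_def)
    qed
    have "(\<integral>z. indicator K z * (\<eta> z * dpot \<delta> \<epsilon> z) \<partial>lborel) = (\<integral>z. indicator K z * (\<eta> z * pot \<delta> e (z + \<epsilon> *\<^sub>R e)) \<partial>lborel)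
        - (\<integral>z. indicator K z * (\<eta> z * pot \<delta> e (z + (2 * \<epsilon>) *\<^sub>R e)) \<partial>lborel)"
      unfolding dpot_def right_diff_distrib by (rule Bochner_Integration.integral_diff[OF i0 i0])
    also have "(\<integral>z. indicator K z * (\<eta> z * pot \<delta> e (z + (2 * \<epsilon>) *\<^sub>R e)) \<partial>lborel) =
       (\<integral>z. indicator K (z - \<epsilon> *\<^sub>R e) * (\<eta> (z - \<epsilon> *\<^sub>R e) * pot \<delta> e (z + \<epsilon> *\<^sub>R e)) \<partial>lborel)"
    proof -
      \<comment> \<open>The translation by \<open>- (\<epsilon> *\<^sub>R e)\<close> aligns the two
        kernels.\<close>
      have sh: "(z + - (\<epsilon> *\<^sub>R e)) + (2 * \<epsilon>) *\<^sub>R e = z + \<epsilon> *\<^sub>R e" for z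
      proof -
        have "(2 * \<epsilon>) *\<^sub>R e = \<epsilon> *\<^sub>R e + \<epsilon> *\<^sub>R e" by (simp only: scaleR_left_distrib[symmetric] mult_2)
        then show ?thesis by (simp only: add.assoc add.left_inverse) simp
      qed
      have "(\<lambda>z. indicator K z * (\<eta> z * pot \<delta> e (z + (2 * \<epsilon>) *\<^sub>R e))) \<in> borel_measurable borel"
        using borel_measurable_integrable[OF i0] by simp
      from lborel_integral_translation[OF this, of "- (\<epsilon> *\<^sub>R e)"]
      show ?thesis unfolding sh by simp
    qed
    also have "(\<integral>z. indicator K z * (\<eta> z * pot \<delta> e (z + \<epsilon> *\<^sub>R e)) \<partial>lborel)
        - (\<integral>z. indicator K (z - \<epsilon> *\<^sub>R e) * (\<eta> (z - \<epsilon> *\<^sub>R e) * pot \<delta> e (z + \<epsilon> *\<^sub>R e)) \<partial>lborel) = (\<integral>z. D z \<partial>lborel)"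
      unfolding D_def left_diff_distrib mult.assoc by (rule Bochner_Integration.integral_diff[OF i0 i2, symmetric])
    also have "\<dots> \<le> (\<integral>z. U z \<partial>lborel)"
    proof (rule integral_mono[OF _ _ DU])
      show "integrable lborel D" unfolding D_def left_diff_distrib mult.assoc by (rule Bochner_Integration.integrable_diff[OF i0 i2])
      show "integrable lborel U" unfolding U_def
        by (intro Bochner_Integration.integrable_add Bochner_Integration.integrable_minus Bochner_Integration.integrable_sum Ui Uc)
    qed
    also have "\<dots> = - (\<Sum>i<J - J0. b i * measure lborel (A i)) + Cs' * \<epsilon> * V"
    proof -
      have "(\<integral>z. (\<Sum>i<J - J0. b i * indicator (A i) z) \<partial>lborel) = (\<Sum>i<J - J0. b i * measure lborel (A i))"
        by (subst Bochner_Integration.integral_sum[OF Ui]) simp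
      moreover have "integrable lborel (\<lambda>z. \<Sum>i<J - J0. b i * indicator (A i) z)" by (intro Bochner_Integration.integrable_sum Ui)
      ultimately show ?thesis unfolding U_def V_def using Uc by simp
    qed
    also have "\<dots> \<le> - (\<Sum>i<J - J0. c5 * \<epsilon>) + Cs' * \<epsilon> * V"
    proof -
      \<comment> \<open>With X = l^i \<epsilon>, the dipole has order X^(1-n) and the piece has
        volume of order \<epsilon> X^(n-1): the scale drops out.\<close>
      have "c5 * \<epsilon> \<le> b i * measure lborel (A i)" for i
      proof -
        have "measure lborel (A i) = measure lebesgue (A i)"
          unfolding A_def using layer_measurable(2) by (simp add: measure_completion)
        moreover have "\<omega> * \<epsilon> ^ ?n * (real l ^ i) ^ (?n - 1) \<le> measure lebesgue (A i)"
          using vol(4)[of "l ^ i" \<epsilon>] l \<epsilon> by (simp add: A_def)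
        ultimately have "b i * (\<omega> * \<epsilon> ^ ?n * (real l ^ i) ^ (?n - 1)) \<le> b i * measure lborel (A i)"
          using b by (intro mult_left_mono) auto
        moreover have "b i * (\<omega> * \<epsilon> ^ ?n * (real l ^ i) ^ (?n - 1)) = c5 * \<epsilon>"
        proof -
          define X where "X = real l ^ i * \<epsilon>"
          have p: "X > 0" using l \<epsilon> by (simp add: X_def)
          have 1: "\<epsilon> ^ ?n * (real l ^ i) ^ (?n - 1) = \<epsilon> * X ^ (?n - 1)"
            using n2 unfolding X_def by (cases ?n) (auto simp: power_mult_distrib)
          have "C + 1 > 0" using vol by simp
          then have "(1 / ((C + 1) * X)) * X = 1 / (C + 1)" using p by simp
          then have 2: "(1 / ((C + 1) * X)) ^ (?n - 1) * X ^ (?n - 1) = (1 / (C + 1)) ^ (?n - 1)"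
            by (simp only: power_mult_distrib[symmetric])
          have 3: "q1 * u * (q2 * v * t) = q1 * q3 * q2 * x" if "v * t = x * y" "u * y = q3" for q1 q2 q3 u v t x y :: real
            using that by algebra
          show ?thesis unfolding b_def X_def[symmetric] c5_def by (rule 3[OF 1 2])
        qed
        ultimately show ?thesis by simp
      qed
      then show ?thesis by (intro add_mono le_imp_neg_le sum_mono) auto
    qed
    also have "\<dots> = (Cs' * V - real (J - J0) * c5) * \<epsilon>" by (simp add: algebra_simps)
    finally show ?thesis by (simp add: \<epsilon>_def)
  qed
  show ?thesis using that[OF l(1) c5 main] .
qed

text \<open>The weak equation turns the integral into that of w against the Laplacian of the test
  function. Derivatives of \<open>\<eta>\<close> live at distance at least r0 / 2 from the vertex,
  where differences of the dipole are O(\<epsilon>); the term without them is the smoothing error.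
  Bounds on Q suffice, as w vanishes elsewhere.\<close>

lemma test_laplacian_bound:
  fixes \<eta> :: "real^'n \<Rightarrow> real"
  assumes \<eta>: "smooth \<eta>" "\<And>z. 0 \<le> \<eta> z" "\<And>z. \<eta> z \<le> 1" "\<And>z. norm z \<le> r0 / 2 \<Longrightarrow> \<eta> z = 1" "\<And>z. norm z \<ge> r0 \<Longrightarrow> \<eta> z = 0"
  obtains CL where "\<And>\<epsilon>. 0 < \<epsilon> \<Longrightarrow> \<epsilon> \<le> 1 \<Longrightarrow>
     \<bar>LINT z|lebesgue. f z * (\<eta> z * dpot (\<epsilon> ^ (CARD('n) + 4)) \<epsilon> z)\<bar> \<le> CL * \<epsilon>"
proof -
  let ?n = "CARD('n)"
  obtain C0 where C0: "C0 > 0"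
    and b1: "\<And>z \<epsilon> \<delta>. z \<in> Q \<union> K \<Longrightarrow> \<epsilon> > 0 \<Longrightarrow> \<delta> > 0 \<Longrightarrow> \<bar>dpot \<delta> \<epsilon> z\<bar> \<le> C0 * \<epsilon> * (1 / (norm z + \<epsilon>)) ^ ?n"
    and b2: "\<And>z \<epsilon> \<delta> i. z \<in> Q \<union> K \<Longrightarrow> \<epsilon> > 0 \<Longrightarrow> \<delta> > 0 \<Longrightarrow>
       \<bar>pot1 \<delta> e (z + \<epsilon> *\<^sub>R e) $ i - pot1 \<delta> e (z + (2 * \<epsilon>) *\<^sub>R e) $ i\<bar> \<le> C0 * \<epsilon> * (1 / (norm z + \<epsilon>)) ^ (?n + 1)"
    and b3: "\<And>z \<epsilon> \<delta> s. z \<in> Q \<union> K \<Longrightarrow> \<epsilon> > 0 \<Longrightarrow> \<delta> > 0 \<Longrightarrow> 1 \<le> s \<Longrightarrow>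
       \<bar>\<Sum>i\<in>UNIV. pot2 \<delta> e (z + (s * \<epsilon>) *\<^sub>R e) $ i $ i\<bar> \<le> C0 * \<delta>\<^sup>2 * (1 / \<epsilon>) ^ (?n + 3)"
    by (rule dpot_bounds) (rule that)
  obtain \<eta>1 where d\<eta>: "\<And>x. (\<eta> has_derivative (\<lambda>v. \<eta>1 x \<bullet> v)) (at x)" using smooth_has_gradient[OF \<eta>(1)] by blast
  have sm1: "smooth (\<lambda>x. \<eta>1 x $ i)" for i by (rule smooth_gradient[OF \<eta>(1) d\<eta>])
  have "\<forall>i. \<exists>g. \<forall>x. ((\<lambda>x. \<eta>1 x $ i) has_derivative (\<lambda>v. g x \<bullet> v)) (at x)"
    using smooth_has_gradient[OF sm1] by metis
  then obtain h where h: "\<And>i x. ((\<lambda>x. \<eta>1 x $ i) has_derivative (\<lambda>v. h i x \<bullet> v)) (at x)" by metis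
  define \<eta>2 where "\<eta>2 x = (\<chi> i. h i x)" for x
  have d\<eta>1: "((\<lambda>x. \<eta>1 x $ i) has_derivative (\<lambda>v. \<eta>2 x $ i \<bullet> v)) (at x)" for i x
    using h by (simp add: \<eta>2_def)
  have sm2: "smooth (\<lambda>x. \<eta>2 x $ i $ j)" for i j by (rule smooth_gradient[OF sm1 d\<eta>1])
  have cont: "continuous_on UNIV F" if "smooth F" for F :: "real^'n \<Rightarrow> real"
    using that Ck_continuous by (auto simp: smooth_def)
  have "continuous_on UNIV (\<lambda>x. \<chi> i. \<eta>1 x $ i)" "continuous_on UNIV (\<lambda>x. \<chi> i j. \<eta>2 x $ i $ j)"
    by (intro continuous_on_vec_lambda cont sm1 sm2)+
  then have c\<eta>: "continuous_on UNIV \<eta>1" "continuous_on UNIV \<eta>2" by simp_all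
  have out0: "\<eta> z = 0" if "z \<notin> cball 0 r0" for z using \<eta>(5)[of z] that by simp
  have out1: "\<eta>1 z = 0" if "z \<notin> cball 0 r0" for z using gradient_outside_support[OF d\<eta> out0 that] .
  have out2: "\<eta>2 z = 0" if "z \<notin> cball 0 r0" for z
  proof -
    have "\<eta>2 z $ i = 0" for i
      by (rule gradient_outside_support[OF d\<eta>1 _ that]) (use out1 in simp)
    then show ?thesis by (simp add: vec_eq_iff)
  qed
  have in1: "\<eta>1 z = 0" if "norm z < r0 / 2" for z
  proof (rule gradient_unique[OF d\<eta>])
    have "(\<eta> has_derivative (\<lambda>v. 0)) (at z)"
      by (rule has_derivative_transform_within_open[of "\<lambda>_. 1" _ _ _ "ball 0 (r0 / 2)"]) (use that \<eta>(4) in auto)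
    then show "(\<eta> has_derivative (\<lambda>v. 0 \<bullet> v)) (at z)" by simp
  qed
  have in2: "\<eta>2 z = 0" if "norm z < r0 / 2" for z
  proof -
    have "\<eta>2 z $ i = 0" for i
    proof (rule gradient_unique[OF d\<eta>1])
      have "((\<lambda>x. \<eta>1 x $ i) has_derivative (\<lambda>v. 0)) (at z)"
        by (rule has_derivative_transform_within_open[of "\<lambda>_. 0" _ _ _ "ball 0 (r0 / 2)"]) (use that in1 in auto)
      then show "((\<lambda>x. \<eta>1 x $ i) has_derivative (\<lambda>v. 0 \<bullet> v)) (at z)" by simp
    qed
    then show ?thesis by (simp add: vec_eq_iff)
  qed
  obtain E1 where E1: "E1 \<ge> 0" "\<And>x. norm (\<eta>1 x) \<le> E1" using continuous_support_bounded[OF c\<eta>(1) out1] by blast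
  obtain E2 where E2: "E2 \<ge> 0" "\<And>x. norm (\<eta>2 x) \<le> E2" using continuous_support_bounded[OF c\<eta>(2) out2] by blast
  have "bounded (w ` cball 0 r0)"
    by (intro compact_imp_bounded compact_continuous_image continuous_on_subset[OF w]) auto
  then obtain Wb where Wb: "\<And>x. x \<in> cball 0 r0 \<Longrightarrow> \<bar>w x\<bar> \<le> Wb" by (force simp: bounded_iff)
  have Wb0: "Wb \<ge> 0" using Wb[of 0] r0 by simp
  define CL where "CL = 2 * (real ?n * (C0 * (2 / r0) ^ (?n + 1) * E1)) + C0 * (2 / r0) ^ ?n * (real ?n * E2) + 2 * C0"
  have CL0: "CL \<ge> 0" unfolding CL_def using C0 E1 E2 r0 by (intro add_nonneg_nonneg mult_nonneg_nonneg) auto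
  define V where "V = measure lborel (cball (0::real^'n) r0)"
  have main: "\<bar>LINT z|lebesgue. f z * (\<eta> z * dpot (\<epsilon> ^ (?n + 4)) \<epsilon> z)\<bar> \<le> (Wb * CL * V) * \<epsilon>"
    if \<epsilon>: "0 < \<epsilon>" "\<epsilon> \<le> 1" for \<epsilon>
  proof -
    \<comment> \<open>The exponent is chosen to make \<delta> \<epsilon>^(-(n+3)) equal to
      \<epsilon>; the smoothing error has one more factor \<delta> \<le> 1.\<close>
    define \<delta> where "\<delta> = \<epsilon> ^ (?n + 4)"
    have \<delta>: "\<delta> > 0" using \<epsilon> by (simp add: \<delta>_def)
    have d2: "\<delta>\<^sup>2 * (1 / \<epsilon>) ^ (?n + 3) \<le> \<epsilon>"
    proof -
      have "\<delta> * (1 / \<epsilon>) ^ (?n + 3) = \<epsilon> * (\<epsilon> ^ (?n + 3) * (1 / \<epsilon>) ^ (?n + 3))" by (simp add: \<delta>_def numeral_eq_Suc)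
      also have "\<dots> = \<epsilon>" unfolding power_mult_distrib[symmetric] using \<epsilon> by simp
      finally have "\<delta>\<^sup>2 * (1 / \<epsilon>) ^ (?n + 3) = \<delta> * \<epsilon>" by (simp add: power2_eq_square)
      also have "\<dots> \<le> 1 * \<epsilon>" unfolding \<delta>_def using \<epsilon> by (intro mult_right_mono power_le_one) auto
      finally show ?thesis by simp
    qed
    define F where "F z = \<eta> z * dpot \<delta> \<epsilon> z" for z
    define p1 where "p1 z = pot1 \<delta> e (z + \<epsilon> *\<^sub>R e) - pot1 \<delta> e (z + (2 * \<epsilon>) *\<^sub>R e)" for z
    define p2 where "p2 z = pot2 \<delta> e (z + \<epsilon> *\<^sub>R e) - pot2 \<delta> e (z + (2 * \<epsilon>) *\<^sub>R e)" for z
    have shift: "((\<lambda>z. z + x) has_derivative (\<lambda>v. v)) (at z)" for x z :: "real^'n" by (auto intro!: derivative_eq_intros)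
    have dp: "(dpot \<delta> \<epsilon> has_derivative (\<lambda>v. p1 z \<bullet> v)) (at z)" for z
      unfolding dpot_def[abs_def] p1_def inner_diff_left
      by (intro has_derivative_diff has_derivative_compose[OF shift pot_derivative[OF \<delta>]])
    have dp1: "((\<lambda>z. p1 z $ i) has_derivative (\<lambda>v. p2 z $ i \<bullet> v)) (at z)" for i z
      unfolding p1_def p2_def vector_minus_component inner_diff_left
      by (intro has_derivative_diff has_derivative_compose[OF shift pot1_derivative[OF \<delta>]])
    define F1 where "F1 z = dpot \<delta> \<epsilon> z *\<^sub>R \<eta>1 z + \<eta> z *\<^sub>R p1 z" for z
    define F2 where "F2 z = (\<chi> i. (dpot \<delta> \<epsilon> z *\<^sub>R \<eta>2 z $ i + \<eta>1 z $ i *\<^sub>R p1 z) + (\<eta> z *\<^sub>R p2 z $ i + p1 z $ i *\<^sub>R \<eta>1 z))" for z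
    have "smooth F" unfolding F_def dpot_def
    proof (rule smoothI)
      fix m
      show "Ck m (\<lambda>z. \<eta> z * (pot \<delta> e (z + \<epsilon> *\<^sub>R e) - pot \<delta> e (z + (2 * \<epsilon>) *\<^sub>R e)))"
        using \<eta>(1) by (intro Ck_mult Ck_diff smooth_pot[OF \<delta>, unfolded smooth_def, rule_format]) (simp add: smooth_def)
    qed
    moreover have "(F has_derivative (\<lambda>v. F1 z \<bullet> v)) (at z)" for z
      unfolding F_def[abs_def]
      by (rule has_derivative_eq_rhs[OF has_derivative_mult[OF d\<eta> dp]]) (auto simp: F1_def inner_add_left algebra_simps)
    moreover have "((\<lambda>z. F1 z $ i) has_derivative (\<lambda>v. F2 z $ i \<bullet> v)) (at z)" for i z
    proof -
      have "(\<lambda>z. F1 z $ i) = (\<lambda>z. dpot \<delta> \<epsilon> z * \<eta>1 z $ i + \<eta> z * p1 z $ i)" by (auto simp: F1_def)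
      then show ?thesis
        by (simp only:) (rule has_derivative_eq_rhs[OF has_derivative_add[OF has_derivative_mult[OF dp d\<eta>1] has_derivative_mult[OF d\<eta> dp1]]],
           auto simp: F2_def inner_add_left algebra_simps)
    qed
    moreover have "F z = 0" if "norm z \<ge> r0" for z using \<eta>(5)[OF that] by (simp add: F_def)
    ultimately have wk: "(LINT z|lebesgue. w z * (\<Sum>i\<in>UNIV. F2 z $ i $ i)) = (LINT z|lebesgue. f z * F z)"
      by (rule weak)
    have tr: "(\<Sum>i\<in>UNIV. F2 z $ i $ i) = 2 * (\<Sum>i\<in>UNIV. p1 z $ i * \<eta>1 z $ i) + dpot \<delta> \<epsilon> z * (\<Sum>i\<in>UNIV. \<eta>2 z $ i $ i)
        + \<eta> z * ((\<Sum>i\<in>UNIV. pot2 \<delta> e (z + \<epsilon> *\<^sub>R e) $ i $ i) - (\<Sum>i\<in>UNIV. pot2 \<delta> e (z + (2 * \<epsilon>) *\<^sub>R e) $ i $ i))" for z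
    proof -
      have "F2 z $ i $ i = 2 * (p1 z $ i * \<eta>1 z $ i) + dpot \<delta> \<epsilon> z * \<eta>2 z $ i $ i
         + \<eta> z * (pot2 \<delta> e (z + \<epsilon> *\<^sub>R e) $ i $ i - pot2 \<delta> e (z + (2 * \<epsilon>) *\<^sub>R e) $ i $ i)" for i
        by (simp add: F2_def p2_def algebra_simps)
      then show ?thesis by (simp only: sum.distrib sum_distrib_left[symmetric] sum_subtractf)
    qed
    have tr_bound: "\<bar>\<Sum>i\<in>UNIV. F2 z $ i $ i\<bar> \<le> CL * \<epsilon>" if z: "z \<in> Q" for z
    proof -
      define S1 where "S1 = (\<Sum>i\<in>UNIV. p1 z $ i * \<eta>1 z $ i)"
      define S2 where "S2 = dpot \<delta> \<epsilon> z * (\<Sum>i\<in>UNIV. \<eta>2 z $ i $ i)"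
      define T1 where "T1 = (\<Sum>i\<in>UNIV. pot2 \<delta> e (z + \<epsilon> *\<^sub>R e) $ i $ i)"
      define T2 where "T2 = (\<Sum>i\<in>UNIV. pot2 \<delta> e (z + (2 * \<epsilon>) *\<^sub>R e) $ i $ i)"
      have zz: "z \<in> Q \<union> K" using z by simp
      have T: "\<bar>T1\<bar> \<le> C0 * \<epsilon>" "\<bar>T2\<bar> \<le> C0 * \<epsilon>"
      proof -
        have "C0 * \<delta>\<^sup>2 * (1 / \<epsilon>) ^ (?n + 3) \<le> C0 * \<epsilon>"
          using mult_left_mono[OF d2, of C0] C0 by (simp add: mult.assoc)
        then show "\<bar>T1\<bar> \<le> C0 * \<epsilon>" "\<bar>T2\<bar> \<le> C0 * \<epsilon>"
          using b3[OF zz \<epsilon>(1) \<delta>, of 1] b3[OF zz \<epsilon>(1) \<delta>, of 2] by (simp_all add: T1_def T2_def)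
      qed
      have T3: "\<bar>\<eta> z * (T1 - T2)\<bar> \<le> (2 * C0) * \<epsilon>"
      proof -
        have "\<bar>\<eta> z * (T1 - T2)\<bar> \<le> 1 * \<bar>T1 - T2\<bar>" unfolding abs_mult using \<eta>(2,3)[of z] by (intro mult_right_mono) auto
        also have "\<dots> \<le> (2 * C0) * \<epsilon>" using T by (simp add: mult.assoc)
        finally show ?thesis .
      qed
      have S: "\<bar>S1\<bar> \<le> (real ?n * (C0 * (2 / r0) ^ (?n + 1) * E1)) * \<epsilon> \<and> \<bar>S2\<bar> \<le> (C0 * (2 / r0) ^ ?n * (real ?n * E2)) * \<epsilon>"
      proof (cases "norm z < r0 / 2")
        case True
        then have "S1 = 0" "S2 = 0" using in1 in2 by (simp_all add: S1_def S2_def)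
        then show ?thesis using C0 E1 E2 r0 \<epsilon> by (simp add: zero_le_mult_iff)
      next
        case False
        then have le: "1 / (norm z + \<epsilon>) \<le> 2 / r0" "0 \<le> 1 / (norm z + \<epsilon>)"
          using r0 \<epsilon> by (auto simp: field_simps)
        have "\<bar>p1 z $ i * \<eta>1 z $ i\<bar> \<le> (C0 * \<epsilon> * (2 / r0) ^ (?n + 1)) * E1" for i
        proof -
          have "\<bar>p1 z $ i\<bar> \<le> C0 * \<epsilon> * (1 / (norm z + \<epsilon>)) ^ (?n + 1)"
            using b2[OF zz \<epsilon>(1) \<delta>, of i] by (simp add: p1_def)
          also have "\<dots> \<le> C0 * \<epsilon> * (2 / r0) ^ (?n + 1)" using le C0 \<epsilon> by (intro mult_left_mono power_mono) auto
          finally show ?thesis unfolding abs_mult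
            using order_trans[OF component_le_norm_cart E1(2)] E1(1) by (intro mult_mono) auto
        qed
        then have "\<bar>S1\<bar> \<le> (\<Sum>i\<in>(UNIV::'n set). (C0 * \<epsilon> * (2 / r0) ^ (?n + 1)) * E1)"
          unfolding S1_def by (intro order_trans[OF sum_abs] sum_mono)
        moreover have "\<bar>S2\<bar> \<le> (C0 * \<epsilon> * (2 / r0) ^ ?n) * (real ?n * E2)"
          unfolding S2_def abs_mult
        proof (rule mult_mono)
          have "\<bar>dpot \<delta> \<epsilon> z\<bar> \<le> C0 * \<epsilon> * (1 / (norm z + \<epsilon>)) ^ ?n" by (rule b1[OF zz \<epsilon>(1) \<delta>])
          also have "\<dots> \<le> C0 * \<epsilon> * (2 / r0) ^ ?n" using le C0 \<epsilon> by (intro mult_left_mono power_mono) auto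
          finally show "\<bar>dpot \<delta> \<epsilon> z\<bar> \<le> C0 * \<epsilon> * (2 / r0) ^ ?n" .
          have "\<bar>\<eta>2 z $ i $ i\<bar> \<le> E2" for i
            using order_trans[OF component_le_norm_cart order_trans[OF Finite_Cartesian_Product.norm_nth_le E2(2)]] .
          then have "\<bar>\<Sum>i\<in>UNIV. \<eta>2 z $ i $ i\<bar> \<le> (\<Sum>i\<in>(UNIV::'n set). E2)" by (intro order_trans[OF sum_abs] sum_mono)
          then show "\<bar>\<Sum>i\<in>UNIV. \<eta>2 z $ i $ i\<bar> \<le> real ?n * E2" by simp
        qed (use C0 \<epsilon> r0 in auto)
        ultimately show ?thesis by (simp add: mult_ac)
      qed
      have "\<bar>\<Sum>i\<in>UNIV. F2 z $ i $ i\<bar> \<le> 2 * \<bar>S1\<bar> + \<bar>S2\<bar> + \<bar>\<eta> z * (T1 - T2)\<bar>"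
        unfolding tr S1_def[symmetric] S2_def[symmetric] T1_def[symmetric] T2_def[symmetric] by linarith
      also have "\<dots> \<le> 2 * ((real ?n * (C0 * (2 / r0) ^ (?n + 1) * E1)) * \<epsilon>) + (C0 * (2 / r0) ^ ?n * (real ?n * E2)) * \<epsilon> + (2 * C0) * \<epsilon>"
        using S T3 by (intro add_mono mult_left_mono) auto
      also have "\<dots> = CL * \<epsilon>" unfolding CL_def by (simp only: distrib_right mult.assoc)
      finally show ?thesis .
    qed
    have pt: "\<bar>w z * (\<Sum>i\<in>UNIV. F2 z $ i $ i)\<bar> \<le> (Wb * CL * \<epsilon>) * indicator (cball 0 r0) z" for z
    proof (cases "z \<in> cball 0 r0 \<and> z \<in> Q")
      case True
      have "\<bar>w z * (\<Sum>i\<in>UNIV. F2 z $ i $ i)\<bar> \<le> Wb * (CL * \<epsilon>)"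
        unfolding abs_mult using True Wb0 by (intro mult_mono Wb tr_bound) auto
      then show ?thesis using True by simp
    next
      case False
      then have "w z * (\<Sum>i\<in>UNIV. F2 z $ i $ i) = 0"
        using w0[of z] out0[of z] out1[of z] out2[of z] unfolding tr by (cases "z \<in> Q") auto
      moreover have "0 \<le> (Wb * CL * \<epsilon>) * indicator (cball 0 r0) z" using Wb0 CL0 \<epsilon> by simp
      ultimately show ?thesis by (simp only: abs_zero)
    qed
    have ic: "integrable lebesgue (\<lambda>z::real^'n. (Wb * CL * \<epsilon>) * indicator (cball 0 r0) z)"
      by (intro integrable_mult_right integrable_real_indicator)
         (use emeasure_lborel_cball_finite[of "0::real^'n" r0] in \<open>auto simp: emeasure_completion\<close>)
    have "\<bar>LINT z|lebesgue. w z * (\<Sum>i\<in>UNIV. F2 z $ i $ i)\<bar> \<le> (LINT z|lebesgue. (Wb * CL * \<epsilon>) * indicator (cball (0::real^'n) r0) z)"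
      by (rule abs_integral_le[OF ic pt])
    also have "\<dots> = (Wb * CL * V) * \<epsilon>"
      by (simp add: V_def measure_completion)
    finally show ?thesis unfolding wk F_def \<delta>_def .
  qed
  show ?thesis using that[OF main] by blast
qed

text \<open>Put a = \<open>\<bar>F0\<bar> * c5\<close>. If \<open>F0\<close> were nonzero, the cone
  would contribute at least a J \<epsilon> up to O(\<epsilon>), whereas the tested equation is
  O(\<epsilon>) and the remainder of f adds at most half of a J \<epsilon> plus O(\<epsilon>). After
  division by \<epsilon> this fails for large J.\<close>

lemma corner_value_zero: "F0 = 0"
proof (rule ccontr)
  let ?n = "CARD('n)"
  assume F0: "F0 \<noteq> 0"
  obtain \<eta> :: "real^'n \<Rightarrow> real" where \<eta>: "smooth \<eta>" "\<And>z. 0 \<le> \<eta> z" "\<And>z. \<eta> z \<le> 1"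
    "\<And>z. norm z \<le> r0 / 2 \<Longrightarrow> \<eta> z = 1" "\<And>z. norm z \<ge> r0 \<Longrightarrow> \<eta> z = 0"
    by (rule smooth_cutoff[OF r0]) (rule that)
  obtain l :: nat and c5 Cs :: real and J0 :: nat where l: "l \<ge> 2" and c5: "c5 > 0" and
    lower: "\<And>J \<delta>. J \<ge> J0 \<Longrightarrow> 0 < \<delta> \<Longrightarrow> \<delta> \<le> r0 / real l ^ J \<Longrightarrow>
      (\<integral>z. indicator K z * (\<eta> z * dpot \<delta> (r0 / real l ^ J) z) \<partial>lborel) \<le> (Cs - real (J - J0) * c5) * (r0 / real l ^ J)"
    by (rule corner_integral_le[OF \<eta>(1-3)], erule \<eta>(4), erule \<eta>(5)) (rule that)
  obtain CL where CL: "\<And>\<epsilon>. 0 < \<epsilon> \<Longrightarrow> \<epsilon> \<le> 1 \<Longrightarrow> \<bar>LINT z|lebesgue. f z * (\<eta> z * dpot (\<epsilon> ^ (?n + 4)) \<epsilon> z)\<bar> \<le> CL * \<epsilon>"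
    by (rule test_laplacian_bound[OF \<eta>(1-3)], erule \<eta>(4), erule \<eta>(5)) (rule that)
  obtain C0 where C0: "C0 > 0"
    and b1: "\<And>z \<epsilon> \<delta>. z \<in> Q \<union> K \<Longrightarrow> \<epsilon> > 0 \<Longrightarrow> \<delta> > 0 \<Longrightarrow> \<bar>dpot \<delta> \<epsilon> z\<bar> \<le> C0 * \<epsilon> * (1 / (norm z + \<epsilon>)) ^ ?n"
    by (rule dpot_bounds) (rule that)
  define V where "V = unit_ball_vol (real ?n)"
  have V: "V > 0" by (simp add: V_def)
  define C6 where "C6 = C0 * (real l ^ ?n * V)"
  have C6: "C6 > 0" using C0 V l by (simp add: C6_def)
  \<comment> \<open>Makes \<open>\<nu> * C6\<close>, the growth rate in J of the error near the
    vertex, half of \<open>\<bar>F0\<bar> * c5\<close>.\<close>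
  define \<nu> where "\<nu> = \<bar>F0\<bar> * c5 / (2 * C6)"
  have \<nu>: "\<nu> > 0" using F0 c5 C6 by (simp add: \<nu>_def)
  obtain r' where r': "r' > 0" "\<And>z. z \<in> Q \<Longrightarrow> norm z < r' \<Longrightarrow> \<bar>f z - F0 * indicator K z\<bar> \<le> \<nu>" using near[OF \<nu>] by blast
  define r where "r = min r' r0"
  have r: "r > 0" "r \<le> r0" using r' r0 by (auto simp: r_def)
  define G where "G z = f z - F0 * indicator K z" for z
  have Gnear: "\<bar>G z\<bar> \<le> \<nu>" if "norm z < r" for z
  proof (cases "z \<in> Q")
    case True then show ?thesis using r'(2) that by (simp add: G_def r_def)
  next
    case False
    then have "z \<notin> K" using KQ that r(2) by auto
    then show ?thesis using False f0 \<nu> by (simp add: G_def)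
  qed
  have G0: "G z = 0" if "z \<notin> Q \<union> K" for z using that f0 by (simp add: G_def)
  have fI: "integrable lebesgue (\<lambda>z. indicator (cball 0 r0) z * f z)"
    using fint by (simp add: set_integrable_def)
  have Kb: "K \<in> sets lebesgue" using openK by simp
  have KI: "integrable lebesgue (\<lambda>z. indicator (cball 0 r0) z * indicator K z :: real)"
  proof -
    have "K \<inter> cball 0 r0 \<in> lmeasurable"
      by (rule bounded_set_imp_lmeasurable) (use Kb in \<open>auto intro: bounded_subset[OF bounded_cball]\<close>)
    then have "integrable lebesgue (indicator (K \<inter> cball 0 r0) :: _ \<Rightarrow> real)"
      by (intro integrable_real_indicator) (simp_all only: fmeasurable_def mem_Collect_eq infinity_ennreal_def)
    moreover have "(\<lambda>z. indicator (cball 0 r0) z * indicator K z :: real) = indicator (K \<inter> cball 0 r0)"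
      by (auto simp: indicator_def)
    ultimately show ?thesis by simp
  qed
  have GI: "integrable lebesgue (\<lambda>z. indicator (cball 0 r0) z * G z)"
    using Bochner_Integration.integrable_diff[OF fI integrable_mult_right[OF KI, of F0]] by (simp add: G_def algebra_simps)
  define IG where "IG = (LINT z|lebesgue. indicator (cball 0 r0) z * \<bar>G z\<bar>)"
  have GI': "integrable lebesgue (\<lambda>z. indicator (cball 0 r0) z * \<bar>G z\<bar>)"
    using integrable_abs[OF GI] by (simp add: abs_mult)
  define C7 where "C7 = C0 * (1 / r) ^ ?n * IG"
  have main: "\<bar>F0\<bar> * (real (J - J0) * c5 - Cs) \<le> CL + \<nu> * C6 * real (J + 1) + C7"
    if J: "J \<ge> J0" "r0 / real l ^ J \<le> 1" for J
  proof -
    define \<epsilon> where "\<epsilon> = r0 / real l ^ J"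
    have \<epsilon>: "\<epsilon> > 0" "\<epsilon> \<le> 1" using r0 l J by (auto simp: \<epsilon>_def)
    define \<delta> where "\<delta> = \<epsilon> ^ (?n + 4)"
    have \<delta>: "\<delta> > 0" "\<delta> \<le> \<epsilon>"
      using \<epsilon> power_decreasing[of 1 "?n + 4" \<epsilon>] by (auto simp: \<delta>_def)
    define F where "F z = \<eta> z * dpot \<delta> \<epsilon> z" for z
    have Fb: "\<bar>F z\<bar> \<le> C0 * \<epsilon> * (1 / (norm z + \<epsilon>)) ^ ?n" if "z \<in> Q \<union> K" for z
    proof -
      have "\<bar>F z\<bar> \<le> 1 * \<bar>dpot \<delta> \<epsilon> z\<bar>" unfolding F_def abs_mult using \<eta>(2,3)[of z] by (intro mult_right_mono) auto
      then show ?thesis using b1[OF that \<epsilon>(1) \<delta>(1)] by linarith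
    qed
    have F0out: "F z = 0" if "z \<notin> cball 0 r0" for z using that \<eta>(5)[of z] by (simp add: F_def)
    have cF: "continuous_on UNIV F"
    proof -
      have "Ck 0 F" unfolding F_def[abs_def] dpot_def
        using \<eta>(1) by (intro Ck_mult Ck_diff smooth_pot[OF \<delta>(1), unfolded smooth_def, rule_format]) (simp add: smooth_def)
      then show ?thesis by simp
    qed
    then have mF: "F \<in> borel_measurable lebesgue" by (intro measurable_completion) (simp add: borel_measurable_continuous_onI)
    obtain LF where LF: "LF \<ge> 0" "\<And>z. norm (F z) \<le> LF" using continuous_support_bounded[OF cF F0out] by blast
    have prodI: "integrable lebesgue (\<lambda>z. g z * F z)" if "integrable lebesgue (\<lambda>z. indicator (cball 0 r0) z * g z)" for g
    proof -
      have "integrable lebesgue (\<lambda>z. (indicator (cball 0 r0) z * g z) * F z)"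
      proof (rule Bochner_Integration.integrable_bound[OF integrable_mult_right[OF that, of LF]])
        show "(\<lambda>z. (indicator (cball 0 r0) z * g z) * F z) \<in> borel_measurable lebesgue"
          using borel_measurable_integrable[OF that] mF by (rule borel_measurable_times)
        show "AE z in lebesgue. norm ((indicator (cball 0 r0) z * g z) * F z) \<le> norm (LF * (indicator (cball 0 r0) z * g z))"
        proof (rule AE_I2)
          fix z
          have "\<bar>indicator (cball 0 r0) z * g z\<bar> * \<bar>F z\<bar> \<le> \<bar>indicator (cball 0 r0) z * g z\<bar> * LF"
            using LF(2)[of z] by (intro mult_left_mono) auto
          then show "norm ((indicator (cball 0 r0) z * g z) * F z) \<le> norm (LF * (indicator (cball 0 r0) z * g z))"
            using LF(1) by (simp only: real_norm_def abs_mult abs_of_nonneg mult.commute[of LF])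
        qed
      qed
      moreover have "(indicator (cball 0 r0) z * g z) * F z = g z * F z" for z
        using F0out[of z] by (cases "z \<in> cball 0 r0") auto
      ultimately show ?thesis by simp
    qed
    define M where "M = (\<integral>z. indicator K z * F z \<partial>lborel)"
    have M: "M \<le> (Cs - real (J - J0) * c5) * \<epsilon>"
      using lower[OF J(1) \<delta>(1)] \<delta>(2) by (simp add: M_def F_def \<epsilon>_def)
    have "(\<lambda>z. indicator K z * F z) \<in> borel_measurable lborel"
      using openK cF by (auto intro!: borel_measurable_times borel_measurable_indicator simp: borel_measurable_continuous_onI)
    then have Ml: "(LINT z|lebesgue. indicator K z * F z) = M" unfolding M_def by (rule integral_completion)
    have "(LINT z|lebesgue. f z * F z) - F0 * M = (LINT z|lebesgue. G z * F z)"
    proof -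
      have "(LINT z|lebesgue. f z * F z) - (LINT z|lebesgue. F0 * (indicator K z * F z)) = (LINT z|lebesgue. f z * F z - F0 * (indicator K z * F z))"
        by (rule Bochner_Integration.integral_diff[symmetric, OF prodI[OF fI] integrable_mult_right[OF prodI[OF KI]]])
      moreover have "f z * F z - F0 * (indicator K z * F z) = G z * F z" for z by (simp add: G_def left_diff_distrib)
      ultimately show ?thesis unfolding integral_mult_right_zero Ml by (simp only:)
    qed
    moreover have "\<bar>LINT z|lebesgue. f z * F z\<bar> \<le> CL * \<epsilon>" using CL[OF \<epsilon>] by (simp add: F_def \<delta>_def)
    moreover have "\<bar>LINT z|lebesgue. G z * F z\<bar> \<le> (\<nu> * C6 * real (J + 1) + C7) * \<epsilon>"
    proof -
      obtain g :: "real^'n \<Rightarrow> real" where g': "integrable lborel g"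
        "\<And>z. norm z \<le> r0 \<Longrightarrow> (1 / (norm z + r0 / real l ^ J)) ^ ?n \<le> g z" "\<And>z. g z \<ge> 0"
        "(\<integral>z. g z \<partial>lborel) = real (J + 1) * real l ^ ?n * unit_ball_vol (real ?n)"
        by (rule radial_weight_integral[OF l r0, where J = J]) (rule that)
      note g = g'[folded \<epsilon>_def V_def]
      \<comment> \<open>Within radius r the remainder is at most \<open>\<nu>\<close> and meets the
        logarithmic weight; beyond, it is integrable and meets a kernel of size
        O(\<epsilon>).\<close>
      define U where "U z = (\<nu> * C0 * \<epsilon>) * g z + (C0 * \<epsilon> * (1 / r) ^ ?n) * (indicator (cball 0 r0) z * \<bar>G z\<bar>)" for z
      have gl: "integrable lebesgue g" using g(1) borel_measurable_integrable[OF g(1)] by (simp add: integrable_completion)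
      have gi: "(LINT z|lebesgue. g z) = real (J + 1) * real l ^ ?n * V"
        using g(4) borel_measurable_integrable[OF g(1)] by (simp add: integral_completion)
      have UI: "integrable lebesgue U" unfolding U_def
        by (intro Bochner_Integration.integrable_add integrable_mult_right gl GI')
      have "\<bar>G z * F z\<bar> \<le> U z" for z
      proof -
        have p1: "0 \<le> (\<nu> * C0 * \<epsilon>) * g z" using \<nu> C0 \<epsilon> g(3) by simp
        have p2: "0 \<le> (C0 * \<epsilon> * (1 / r) ^ ?n) * (indicator (cball 0 r0) z * \<bar>G z\<bar>)" using C0 \<epsilon> r by simp
        consider "z \<notin> cball 0 r0 \<or> z \<notin> Q \<union> K" | "z \<in> cball 0 r0" "z \<in> Q \<union> K" "norm z < r" | "z \<in> cball 0 r0" "z \<in> Q \<union> K" "norm z \<ge> r"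
          by fastforce
        then show ?thesis
        proof cases
          case 1
          then have "G z * F z = 0" using F0out[of z] G0[of z] by auto
          then have "\<bar>G z * F z\<bar> = 0" by (simp only: abs_zero)
          moreover have "U z \<ge> 0" unfolding U_def by (rule add_nonneg_nonneg[OF p1 p2])
          ultimately show ?thesis by linarith
        next
          case 2
          have "\<bar>G z * F z\<bar> \<le> \<nu> * (C0 * \<epsilon> * (1 / (norm z + \<epsilon>)) ^ ?n)"
            unfolding abs_mult using Gnear[OF 2(3)] Fb[OF 2(2)] \<nu> by (intro mult_mono) auto
          also have "\<dots> \<le> \<nu> * (C0 * \<epsilon> * g z)" using g(2)[of z] 2(1) \<nu> C0 \<epsilon> by (intro mult_left_mono) auto
          also have "\<dots> = (\<nu> * C0 * \<epsilon>) * g z" by (simp only: mult.assoc)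
          finally show ?thesis unfolding U_def using p2 by linarith
        next
          case 3
          have "1 / (norm z + \<epsilon>) \<le> 1 / r" using 3 r \<epsilon> by (intro divide_left_mono mult_pos_pos add_nonneg_pos) auto
          then have "(1 / (norm z + \<epsilon>)) ^ ?n \<le> (1 / r) ^ ?n" using \<epsilon> by (intro power_mono) auto
          then have "C0 * \<epsilon> * (1 / (norm z + \<epsilon>)) ^ ?n \<le> C0 * \<epsilon> * (1 / r) ^ ?n" using C0 \<epsilon> by (intro mult_left_mono) auto
          then have "\<bar>F z\<bar> \<le> C0 * \<epsilon> * (1 / r) ^ ?n" using Fb[OF 3(2)] by linarith
          then have "\<bar>G z\<bar> * \<bar>F z\<bar> \<le> \<bar>G z\<bar> * (C0 * \<epsilon> * (1 / r) ^ ?n)" by (intro mult_left_mono) auto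
          then have "\<bar>G z * F z\<bar> \<le> (C0 * \<epsilon> * (1 / r) ^ ?n) * (indicator (cball 0 r0) z * \<bar>G z\<bar>)"
            using 3(1) by (simp only: abs_mult indicator_simps mult_1 mult.commute)
          then show ?thesis unfolding U_def using p1 by linarith
        qed
      qed
      from abs_integral_le[OF UI this]
      have "\<bar>LINT z|lebesgue. G z * F z\<bar> \<le> (LINT z|lebesgue. U z)" .
      also have "\<dots> = (\<nu> * C0 * \<epsilon>) * (real (J + 1) * real l ^ ?n * V) + (C0 * \<epsilon> * (1 / r) ^ ?n) * IG"
        unfolding U_def IG_def gi[symmetric]
        by (subst Bochner_Integration.integral_add) (auto intro!: integrable_mult_right gl GI')
      also have "\<dots> = (\<nu> * C6 * real (J + 1) + C7) * \<epsilon>" by (simp add: C6_def C7_def algebra_simps)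
      finally show ?thesis .
    qed
    ultimately have "\<bar>F0 * M\<bar> \<le> (CL + \<nu> * C6 * real (J + 1) + C7) * \<epsilon>"
      unfolding distrib_right by linarith
    moreover have "\<bar>F0\<bar> * ((real (J - J0) * c5 - Cs) * \<epsilon>) \<le> \<bar>F0 * M\<bar>"
    proof -
      have "(real (J - J0) * c5 - Cs) * \<epsilon> \<le> - M" using M by (simp add: algebra_simps)
      also have "\<dots> \<le> \<bar>M\<bar>" by simp
      finally show ?thesis unfolding abs_mult by (intro mult_left_mono) auto
    qed
    ultimately have "(\<bar>F0\<bar> * (real (J - J0) * c5 - Cs)) * \<epsilon> \<le> (CL + \<nu> * C6 * real (J + 1) + C7) * \<epsilon>"
      by (simp only: mult.assoc)
    then show ?thesis using \<epsilon>(1) by (simp only: mult_le_cancel_right_pos)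
  qed
  define a where "a = \<bar>F0\<bar> * c5"
  have a: "a > 0" using F0 c5 by (simp add: a_def)
  have \<nu>C: "\<nu> * C6 = a / 2" using C6 by (simp add: \<nu>_def a_def)
  \<comment> \<open>Collects the terms that do not grow with J, with some slack.\<close>
  define B where "B = CL + C7 + \<bar>F0\<bar> * Cs + a * real J0 + a"
  obtain j0 where j0: "r0 < real l ^ j0" using real_arch_pow[of "real l" r0] l by auto
  obtain j1 :: nat where j1: "2 * \<bar>B\<bar> / a < real j1" using reals_Archimedean2 by blast
  define J where "J = max J0 (max j0 j1)"
  have "r0 / real l ^ J \<le> 1"
  proof -
    have "real l ^ j0 \<le> real l ^ J" using l by (intro power_increasing) (auto simp: J_def)
    then have "r0 \<le> real l ^ J" using j0 by linarith
    then show ?thesis using l by (simp add: divide_le_eq)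
  qed
  from main[OF _ this] have "\<bar>F0\<bar> * (real (J - J0) * c5 - Cs) \<le> CL + \<nu> * C6 * real (J + 1) + C7" by (simp add: J_def)
  moreover have "real (J - J0) = real J - real J0" by (simp add: J_def of_nat_diff)
  ultimately have "a * (real J - real J0) - \<bar>F0\<bar> * Cs \<le> CL + (a / 2) * (real J + 1) + C7"
    unfolding \<nu>C by (simp add: a_def algebra_simps)
  then have "a * real J / 2 \<le> B" using a by (simp add: B_def field_simps)
  moreover have "2 * \<bar>B\<bar> < a * real j1" using j1 a by (simp add: field_simps)
  moreover have "a * real j1 \<le> a * real J" using a by (intro mult_left_mono) (auto simp: J_def)
  ultimately show False by linarith
qed

end

section \<open>Vanishing of the source at a corner\<close>

lemma continuous_lebesgue_measurable:
  fixes g :: "'a::euclidean_space \<Rightarrow> 'b::topological_space"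
  shows "continuous_on UNIV g \<Longrightarrow> g \<in> borel_measurable lebesgue"
  by (rule measurable_completion) (simp add: borel_measurable_continuous_onI)

text \<open>The affine change of variables with all scaling factors equal to 1.\<close>

lemma lebesgue_translation:
  "(+) v \<in> lebesgue \<rightarrow>\<^sub>M lebesgue" "distr lebesgue lebesgue ((+) v) = (lebesgue :: 'a::euclidean_space measure)"
proof -
  have T: "(\<lambda>x. v + (\<Sum>j\<in>Basis. (1 * (x \<bullet> j)) *\<^sub>R j)) = ((+) v :: 'a \<Rightarrow> 'a)"
    by (auto simp: euclidean_representation)
  show m: "(+) v \<in> lebesgue \<rightarrow>\<^sub>M lebesgue"
    using lebesgue_affine_measurable[where c = "\<lambda>_::'a. 1" and t = v] unfolding T by simp
  have "lebesgue = density (distr lebesgue lebesgue ((+) v)) (\<lambda>_. (\<Prod>j\<in>(Basis::'a set). ennreal \<bar>1\<bar>))"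
    using lebesgue_affine_euclidean[where c = "\<lambda>_::'a. 1" and t = v] unfolding T by simp
  then show "distr lebesgue lebesgue ((+) v) = (lebesgue :: 'a measure)" by (simp add: density_1)
qed

lemma lebesgue_integral_translation:
  fixes g :: "'a::euclidean_space \<Rightarrow> 'b::{banach, second_countable_topology}"
  assumes "g \<in> borel_measurable lebesgue"
  shows "(LINT z|lebesgue. g (v + z)) = (LINT z|lebesgue. g z)"
    "integrable lebesgue (\<lambda>z. g (v + z)) = integrable lebesgue g"
  using integral_distr[OF lebesgue_translation(1) assms, of v] integrable_distr_eq[OF lebesgue_translation(1) assms, of v]
  by (simp_all add: lebesgue_translation(2))

lemma interior_polytope:
  fixes S :: "'a::euclidean_space set"
  assumes S: "finite S" and P: "P = interior (convex hull S)" "P \<noteq> {}"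
  shows "open P" "convex P" "closure P = convex hull S"
  using assms finite_imp_compact_convex_hull[OF S]
  by (auto simp: convex_closure_interior compact_imp_closed)

lemma translation_has_derivative: "((\<lambda>z. z - v) has_derivative (\<lambda>v. v)) (at z)"
  by (auto intro!: derivative_eq_intros)

lemma smooth_translation:
  fixes F :: "real^'n::finite \<Rightarrow> real"
  assumes "smooth F" shows "smooth (\<lambda>z. F (z - v))"
proof -
  have "Ck m G \<Longrightarrow> Ck m (\<lambda>z. G (z - v))" for m and G :: "real^'n \<Rightarrow> real"
  proof (induction m arbitrary: G)
    case 0
    then show ?case by (auto intro!: continuous_on_compose2[of UNIV G] continuous_intros)
  next
    case (Suc m)
    then obtain g where g: "\<And>x. (G has_derivative (\<lambda>v. g x \<bullet> v)) (at x)" "\<And>i. Ck m (\<lambda>x. g x $ i)" by auto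
    show ?case
      by (rule Ck_SucI[where g = "\<lambda>x. g (x - v)"])
        (use has_derivative_compose[OF translation_has_derivative g(1)] Suc.IH[OF g(2)] in auto)
  qed
  then show ?thesis using assms by (auto simp: smooth_def)
qed

text \<open>\<open>v\<close> is extreme in two hulls for two reasons: in that of \<open>S\<close>,
  so that the cell agrees with a cone near v, and in that of \<open>T\<close>, which carries
  \<open>w\<close> and \<open>f\<close>, so that this set lies in a pointed cone. The rest moves v
  to the origin.\<close>

lemma corner_vanishing_real:
  fixes w f :: "real^'n::finite \<Rightarrow> real"
  assumes n2: "CARD('n) \<ge> 2"
    and S: "finite S" and P: "P = interior (convex hull S)" "P \<noteq> {}" and vS: "v extreme_point_of (convex hull S)"
    and T: "finite T" and vT: "v extreme_point_of (convex hull T)" and PT: "P \<subseteq> convex hull T"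
    and w: "continuous_on UNIV w" and w0: "\<And>z. z \<notin> convex hull T \<Longrightarrow> w z = 0" and f0: "\<And>z. z \<notin> convex hull T \<Longrightarrow> f z = 0"
    and fm: "f \<in> borel_measurable lebesgue" and fint: "\<And>r. set_integrable lebesgue (cball v r) f"
    and near: "\<And>\<nu>. \<nu> > 0 \<Longrightarrow> \<exists>r>0. \<forall>z. dist z v < r \<longrightarrow> \<bar>f z - F0 * indicator P z\<bar> \<le> \<nu>"
    and weak: "\<And>F F1 F2 r. smooth F \<Longrightarrow> (\<And>z. (F has_derivative (\<lambda>v. F1 z \<bullet> v)) (at z)) \<Longrightarrow>
        (\<And>z i. ((\<lambda>z. F1 z $ i) has_derivative (\<lambda>v. F2 z $ i \<bullet> v)) (at z)) \<Longrightarrow>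
        (\<And>z. z \<notin> cball v r \<Longrightarrow> F z = 0) \<Longrightarrow>
        (LINT z|lebesgue. w z * (\<Sum>i\<in>UNIV. F2 z $ i $ i)) = (LINT z|lebesgue. f z * F z)"
  shows "F0 = 0"
proof -
  note Pp = interior_polytope[OF S P]
  obtain r where r: "r > 0" "\<And>x t. x \<in> P \<Longrightarrow> t > 0 \<Longrightarrow> norm (t *\<^sub>R (x - v)) < r \<Longrightarrow> v + t *\<^sub>R (x - v) \<in> P"
    by (rule polytope_locally_conic[OF S P vS]) (rule that)
  obtain d c where d: "c > 0" "\<And>x. x \<in> convex hull T \<Longrightarrow> c * norm (x - v) \<le> d \<bullet> (x - v)"
    by (rule vertex_supporting_cone[OF T vT]) (rule that)
  have dP: "\<And>x. x \<in> P \<Longrightarrow> c * norm (x - v) \<le> d \<bullet> (x - v)" using d(2) PT by blast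
  obtain e c' where e: "v + e \<in> P" "c' > 0" "\<And>x. x \<in> P \<Longrightarrow> c' * norm (x - v) \<le> e \<bullet> (x - v)"
    by (rule convex_interior_dual_direction[OF Pp(2) P(2) d(1) dP], assumption) (rule that)
  \<comment> \<open>One constant for both cone conditions: d on the hull of \<open>T\<close>, and e
    on the cone of the cell.\<close>
  define c0 where "c0 = min c c'"
  have c0: "c0 > 0" "c0 \<le> c" "c0 \<le> c'" using d(1) e(2) by (auto simp: c0_def)
  define K where "K = {t *\<^sub>R (x - v) |t x. t > 0 \<and> x \<in> P}"
  have PK: "z \<in> K" if "v + z \<in> P" for z
    unfolding K_def using that by (intro CollectI exI[of _ 1] exI[of _ "v + z"]) auto
  have KP: "v + z \<in> P" if "z \<in> K" "norm z < r" for z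
    using that r(2) unfolding K_def by blast
  interpret corner K e c0 "\<lambda>z. w (v + z)" "\<lambda>z. f (v + z)" F0 r "{z. v + z \<in> convex hull T}" d
  proof
    show "2 \<le> CARD('n)" "0 < c0" "0 < r" by (fact n2 c0(1) r(1))+
    show "open K"
    proof -
      have "open ((\<lambda>x. - (t *\<^sub>R v) + t *\<^sub>R x) ` P)" if "t > 0" for t
        using that Pp(1) by (intro open_affinity) auto
      moreover have "K = (\<Union>t\<in>{0<..}. (\<lambda>x. - (t *\<^sub>R v) + t *\<^sub>R x) ` P)"
        by (auto simp: K_def scaleR_diff_right)
      ultimately show ?thesis by auto
    qed
    show "t *\<^sub>R z \<in> K" if "z \<in> K" "t > 0" for z t
    proof -
      obtain s x where "z = s *\<^sub>R (x - v)" "s > 0" "x \<in> P" using \<open>z \<in> K\<close> unfolding K_def by blast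
      then show ?thesis unfolding K_def using \<open>t > 0\<close> by (intro CollectI exI[of _ "t * s"] exI[of _ x]) auto
    qed
    show "x + y \<in> K" if xy: "x \<in> K" "y \<in> K" for x y
    proof -
      obtain s p where p: "x = s *\<^sub>R (p - v)" "s > 0" "p \<in> P" using xy(1) unfolding K_def by blast
      obtain t q where q: "y = t *\<^sub>R (q - v)" "t > 0" "q \<in> P" using xy(2) unfolding K_def by blast
      have "(s / (s + t)) *\<^sub>R p + (t / (s + t)) *\<^sub>R q \<in> P"
        using p q by (intro convexD[OF Pp(2)]) (auto simp: add_divide_distrib[symmetric])
      moreover have "x + y = (s + t) *\<^sub>R ((s / (s + t)) *\<^sub>R p + (t / (s + t)) *\<^sub>R q - v)"
      proof -
        have "(s + t) *\<^sub>R ((s / (s + t)) *\<^sub>R p + (t / (s + t)) *\<^sub>R q - v) = s *\<^sub>R p + t *\<^sub>R q - (s + t) *\<^sub>R v"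
          using p(2) q(2) by (simp add: scaleR_add_right scaleR_diff_right)
        then show ?thesis using p q by (simp add: scaleR_diff_right scaleR_left_distrib)
      qed
      ultimately show ?thesis unfolding K_def using p q by (intro CollectI exI[of _ "s + t"] exI conjI) auto
    qed
    show "e \<in> K" using e(1) by (rule PK)
    show "c0 * norm z \<le> e \<bullet> z" if "z \<in> K" for z
    proof -
      obtain s x where sx: "z = s *\<^sub>R (x - v)" "s > 0" "x \<in> P" using \<open>z \<in> K\<close> unfolding K_def by blast
      have "c0 * norm (x - v) \<le> c' * norm (x - v)" using c0 by (intro mult_right_mono) auto
      then have "c0 * norm (x - v) \<le> e \<bullet> (x - v)" using e(3)[OF sx(3)] by linarith
      then have "s * (c0 * norm (x - v)) \<le> s * (e \<bullet> (x - v))" using sx(2) by (intro mult_left_mono) auto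
      then show ?thesis using sx by (simp add: mult_ac)
    qed
    show "continuous_on UNIV (\<lambda>z. w (v + z))"
      by (rule continuous_on_compose2[OF w]) (auto intro!: continuous_intros)
    show "w (v + z) = 0" if "z \<notin> {z. v + z \<in> convex hull T}" for z using w0 that by simp
    show "f (v + z) = 0" if "z \<notin> {z. v + z \<in> convex hull T}" for z using f0 that by simp
    show "set_integrable lebesgue (cball 0 r) (\<lambda>z. f (v + z))"
    proof -
      have "integrable lebesgue (\<lambda>z. indicator (cball v r) z *\<^sub>R f z)" using fint by (simp add: set_integrable_def)
      then have "integrable lebesgue (\<lambda>z. indicator (cball v r) (v + z) *\<^sub>R f (v + z))"
        using lebesgue_integral_translation(2)[OF borel_measurable_integrable, of "\<lambda>z. indicator (cball v r) z *\<^sub>R f z" v] by simp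
      moreover have "indicat_real (cball v r) (v + z) = indicat_real (cball 0 r) z" for z by (simp add: indicator_def dist_norm)
      ultimately show ?thesis by (simp add: set_integrable_def)
    qed
    show "\<exists>r>0. \<forall>z\<in>{z. v + z \<in> convex hull T}. norm z < r \<longrightarrow> \<bar>f (v + z) - F0 * indicator K z\<bar> \<le> \<nu>" if "\<nu> > 0" for \<nu>
    proof -
      obtain s where s: "s > 0" "\<And>z. dist z v < s \<Longrightarrow> \<bar>f z - F0 * indicator P z\<bar> \<le> \<nu>" using near[OF \<open>\<nu> > 0\<close>] by blast
      have "\<bar>f (v + z) - F0 * indicator K z\<bar> \<le> \<nu>" if "norm z < min s r" for z
      proof -
        have "indicator P (v + z) = (indicator K z :: real)" using PK[of z] KP[of z] that by (auto simp: indicator_def)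
        then show ?thesis using s(2)[of "v + z"] that by (simp add: dist_norm)
      qed
      then show ?thesis using s(1) r(1) by (intro exI[of _ "min s r"]) auto
    qed
    show "K \<inter> ball 0 r \<subseteq> {z. v + z \<in> convex hull T}" using KP PT by auto
    show "c0 * norm z \<le> d \<bullet> z" if "z \<in> {z. v + z \<in> convex hull T}" for z
    proof -
      have "c0 * norm z \<le> c * norm z" using c0 by (intro mult_right_mono) auto
      then show ?thesis using d(2)[of "v + z"] that by simp
    qed
    fix F :: "real^'n \<Rightarrow> real" and F1 F2
    assume F: "smooth F" "\<And>z. (F has_derivative (\<lambda>v. F1 z \<bullet> v)) (at z)"
        "\<And>z i. ((\<lambda>z. F1 z $ i) has_derivative (\<lambda>v. F2 z $ i \<bullet> v)) (at z)" "\<And>z. norm z \<ge> r \<Longrightarrow> F z = 0"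
    have trc: "(\<lambda>z. \<Sum>i\<in>UNIV. F2 z $ i $ i) \<in> borel_measurable lebesgue"
    proof -
      have "continuous_on UNIV (\<lambda>z. F2 z $ i $ i)" for i
        using smooth_gradient[OF smooth_gradient[OF F(1,2)] F(3), of i i] by (rule smooth_continuous)
      then have "continuous_on UNIV (\<lambda>z. \<Sum>i\<in>UNIV. F2 z $ i $ i)" by (intro continuous_on_sum)
      then show ?thesis by (rule continuous_lebesgue_measurable)
    qed
    have "(LINT z|lebesgue. w z * (\<Sum>i\<in>UNIV. F2 (z - v) $ i $ i)) = (LINT z|lebesgue. f z * F (z - v))"
    proof (rule weak[OF smooth_translation[OF F(1)] has_derivative_compose[OF translation_has_derivative F(2)] has_derivative_compose[OF translation_has_derivative F(3)]])
      show "F (z - v) = 0" if "z \<notin> cball v r" for z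
        using that by (intro F(4)) (simp add: dist_norm norm_minus_commute)
    qed
    moreover have wm: "w \<in> borel_measurable lebesgue" by (rule continuous_lebesgue_measurable[OF w])
    moreover have Fm: "F \<in> borel_measurable lebesgue" by (rule continuous_lebesgue_measurable[OF smooth_continuous[OF F(1)]])
    moreover have "G \<in> borel_measurable lebesgue \<Longrightarrow> (\<lambda>z. G (z - v)) \<in> borel_measurable lebesgue" for G :: "real^'n \<Rightarrow> real"
      using measurable_compose[OF lebesgue_translation(1)[of "- v"], of G borel] by simp
    ultimately have "(LINT z|lebesgue. w (v + z) * (\<Sum>i\<in>UNIV. F2 (v + z - v) $ i $ i)) = (LINT z|lebesgue. f (v + z) * F (v + z - v))"
      using lebesgue_integral_translation(1)[of "\<lambda>z. w z * (\<Sum>i\<in>UNIV. F2 (z - v) $ i $ i)" v]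
        lebesgue_integral_translation(1)[of "\<lambda>z. f z * F (z - v)" v] fm trc by simp
    then show "(LINT z|lebesgue. w (v + z) * (\<Sum>i\<in>UNIV. F2 z $ i $ i)) = (LINT z|lebesgue. f (v + z) * F z)" by simp
  qed
  show ?thesis by (rule corner_value_zero)
qed

section \<open>Total waves with a common far field\<close>

lemma continuous_support_integrable_lebesgue:
  fixes F :: "'a::euclidean_space \<Rightarrow> 'b::euclidean_space"
  assumes "continuous_on UNIV F" "\<And>x. x \<notin> cball c R \<Longrightarrow> F x = 0"
  shows "integrable lebesgue F"
  using continuous_support_integrable[OF assms] by (simp add: integrable_completion borel_measurable_integrable)

lemma potential_measurable:
  assumes "open P" "\<phi> \<in> borel_measurable lebesgue"
  shows "potential P \<phi> \<in> borel_measurable lebesgue"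
proof -
  have "P \<in> sets lebesgue" using assms(1) by (simp add: lborelD)
  then show ?thesis using assms(2) unfolding potential_def[abs_def] by measurable
qed

lemma potential_mult_integrable:
  fixes G :: "real^'n::finite \<Rightarrow> complex"
  assumes P: "open P" and \<phi>: "\<phi> \<in> borel_measurable lebesgue" and B: "AE x in lebesgue. cmod (\<phi> x) \<le> B"
    and G: "integrable lebesgue G"
  shows "integrable lebesgue (\<lambda>x. potential P \<phi> x * G x)"
proof (rule Bochner_Integration.integrable_bound[where f = "\<lambda>x. B * norm (G x)"])
  show "integrable lebesgue (\<lambda>x. B * norm (G x))" using G by (intro integrable_mult_right integrable_norm)
  show "(\<lambda>x. potential P \<phi> x * G x) \<in> borel_measurable lebesgue"
    using potential_measurable[OF P \<phi>] borel_measurable_integrable[OF G] by (rule borel_measurable_times)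
  show "AE x in lebesgue. norm (potential P \<phi> x * G x) \<le> norm (B * norm (G x))"
    using B
  proof eventually_elim
    case (elim x)
    have "norm (potential P \<phi> x) \<le> \<bar>B\<bar>" using elim by (auto simp: potential_def indicator_def)
    then have "norm (potential P \<phi> x) * norm (G x) \<le> \<bar>B\<bar> * norm (G x)" by (rule mult_right_mono) simp
    then show ?case by (simp add: norm_mult abs_mult)
  qed
qed

text \<open>The Laplacian of the test function is read off the given Hessian. Splitting the integral
  takes integrability of both parts: the first is continuous of compact support, the second uses the
  bound on \<open>\<phi>\<close>.\<close>

lemma total_wave_real_test:
  fixes F :: "real^'n::finite \<Rightarrow> real"
  assumes P: "open P" and \<phi>: "\<phi> \<in> borel_measurable lebesgue" and B: "AE x in lebesgue. cmod (\<phi> x) \<le> B"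
    and u: "total_wave k (potential P \<phi>) ui u"
    and F: "smooth F" "\<And>z. (F has_derivative (\<lambda>v. F1 z \<bullet> v)) (at z)"
      "\<And>z i. ((\<lambda>z. F1 z $ i) has_derivative (\<lambda>v. F2 z $ i \<bullet> v)) (at z)" "\<And>z. z \<notin> cball a r \<Longrightarrow> F z = 0"
  defines "g \<equiv> \<lambda>x. complex_of_real (k\<^sup>2) * (u x + potential P \<phi> x * u x)"
  shows "integrable lebesgue (\<lambda>x. u x * complex_of_real (\<Sum>i\<in>UNIV. F2 x $ i $ i))"
    "integrable lebesgue (\<lambda>x. g x * complex_of_real (F x))"
    "(LINT x|lebesgue. u x * complex_of_real (\<Sum>i\<in>UNIV. F2 x $ i $ i)) = - (LINT x|lebesgue. g x * complex_of_real (F x))"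
proof -
  have uc: "continuous_on UNIV u" using u by (simp add: total_wave_def)
  have "continuous_on UNIV (\<lambda>z. F2 z $ i $ i)" for i
    using smooth_gradient[OF smooth_gradient[OF F(1,2)] F(3), of i i] by (rule smooth_continuous)
  then have "continuous_on UNIV (\<lambda>z. \<Sum>i\<in>UNIV. F2 z $ i $ i)" by (intro continuous_on_sum)
  then have c1: "continuous_on UNIV (\<lambda>x. u x * complex_of_real (\<Sum>i\<in>UNIV. F2 x $ i $ i))"
    by (intro continuous_on_mult uc continuous_on_of_real)
  have F1: "F1 z = 0" if "z \<notin> cball a r" for z by (rule gradient_outside_support[OF F(2) F(4) that])
  have F1': "F1 z $ i = 0" if "z \<notin> cball a r" for z i using F1[OF that] by simp
  have F2: "F2 z $ i = 0" if "z \<notin> cball a r" for z i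
    by (rule gradient_outside_support[OF F(3) F1' that])
  show I1: "integrable lebesgue (\<lambda>x. u x * complex_of_real (\<Sum>i\<in>UNIV. F2 x $ i $ i))"
    by (rule continuous_support_integrable_lebesgue[OF c1, of a r]) (simp add: F2)
  have uF: "integrable lebesgue (\<lambda>x. u x * complex_of_real (F x))"
  proof (rule continuous_support_integrable_lebesgue)
    show "continuous_on UNIV (\<lambda>x. u x * complex_of_real (F x))"
      by (intro continuous_on_mult uc continuous_on_of_real smooth_continuous[OF F(1)])
    show "u x * complex_of_real (F x) = 0" if "x \<notin> cball a r" for x using F(4)[OF that] by simp
  qed
  have eq: "g x * complex_of_real (F x)
      = complex_of_real (k\<^sup>2) * (u x * complex_of_real (F x) + potential P \<phi> x * (u x * complex_of_real (F x)))" for x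
    by (simp add: g_def algebra_simps)
  show I2: "integrable lebesgue (\<lambda>x. g x * complex_of_real (F x))"
    unfolding eq
    by (intro integrable_mult_right Bochner_Integration.integrable_add uF potential_mult_integrable[OF P \<phi> B])
  have "bounded {z. complex_of_real (F z) \<noteq> 0}"
    by (rule bounded_subset[OF bounded_cball[of a r]]) (use F(4) in \<open>auto simp del: mem_cball\<close>)
  then have "test_fun (\<lambda>x. complex_of_real (F x))"
    using smooth_fun_of_real[OF F(1)] by (simp add: test_fun_def)
  then have weak: "(LINT x|lebesgue. u x * (laplacian (\<lambda>x. complex_of_real (F x)) x
      + complex_of_real (k\<^sup>2) * (1 + potential P \<phi> x) * complex_of_real (F x))) = 0"
    using u by (simp add: total_wave_def)
  have "u x * (laplacian (\<lambda>x. complex_of_real (F x)) x + complex_of_real (k\<^sup>2) * (1 + potential P \<phi> x) * complex_of_real (F x))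
     = u x * complex_of_real (\<Sum>i\<in>UNIV. F2 x $ i $ i) + g x * complex_of_real (F x)" for x
    unfolding laplacian_of_real[OF F(2,3)] by (simp add: g_def algebra_simps del: of_real_sum)
  with weak have "(LINT x|lebesgue. u x * complex_of_real (\<Sum>i\<in>UNIV. F2 x $ i $ i) + g x * complex_of_real (F x)) = 0"
    by (simp only:)
  then show "(LINT x|lebesgue. u x * complex_of_real (\<Sum>i\<in>UNIV. F2 x $ i $ i)) = - (LINT x|lebesgue. g x * complex_of_real (F x))"
    unfolding Bochner_Integration.integral_add[OF I1 I2] by (simp only: eq_neg_iff_add_eq_0)
qed

text \<open>The leading terms at infinity cancel; each remainder is O(r^(-n/2)), and r^n compensates
  the square.\<close>

lemma far_field_decay:
  assumes "far_field k ui u A" "far_field k ui u' A'" "\<forall>xh::real^'n::finite. norm xh = 1 \<longrightarrow> A xh = A' xh"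
  obtains C R where "\<And>x. norm x \<ge> R \<Longrightarrow> norm x ^ CARD('n) * (cmod (u x - u' x))\<^sup>2 \<le> C"
proof -
  define E where "E r xh = exp (\<i> * complex_of_real (k * r)) / complex_of_real (r powr ((real CARD('n) - 1) / 2)) * A xh"
    for r and xh :: "real^'n"
  obtain C R where C: "\<And>r xh. r \<ge> R \<Longrightarrow> norm xh = 1 \<Longrightarrow>
      cmod (u (r *\<^sub>R xh) - ui (r *\<^sub>R xh) - E r xh) \<le> C * r powr (- (real CARD('n) / 2))"
    using assms(1) unfolding far_field_def E_def by blast
  obtain C' R' where "\<forall>r\<ge>R'. \<forall>xh::real^'n. norm xh = 1 \<longrightarrow>
        cmod (u' (r *\<^sub>R xh) - ui (r *\<^sub>R xh)
              - exp (\<i> * complex_of_real (k * r)) / complex_of_real (r powr ((real CARD('n) - 1) / 2)) * A' xh)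
        \<le> C' * r powr (- (real CARD('n) / 2))"
    using assms(2) unfolding far_field_def by blast
  then have C': "\<And>r xh. r \<ge> R' \<Longrightarrow> norm xh = 1 \<Longrightarrow>
      cmod (u' (r *\<^sub>R xh) - ui (r *\<^sub>R xh) - E r xh) \<le> C' * r powr (- (real CARD('n) / 2))"
    using assms(3) unfolding E_def by simp
  have "norm x ^ CARD('n) * (cmod (u x - u' x))\<^sup>2 \<le> (C + C')\<^sup>2" if x: "norm x \<ge> max 1 (max R R')" for x
  proof -
    define r where "r = norm x"
    have r: "r \<ge> R" "r \<ge> R'" "r > 0" using x by (auto simp: r_def)
    have xr: "x = r *\<^sub>R sgn x" "norm (sgn x) = 1" using r by (auto simp: r_def sgn_div_norm)
    have "u x - u' x = (u x - ui x - E r (sgn x)) - (u' x - ui x - E r (sgn x))" by simp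
    then have "cmod (u x - u' x) \<le> cmod (u x - ui x - E r (sgn x)) + cmod (u' x - ui x - E r (sgn x))"
      by (metis norm_triangle_ineq4)
    also have "\<dots> \<le> C * r powr (- (real CARD('n) / 2)) + C' * r powr (- (real CARD('n) / 2))"
      using C[OF r(1) xr(2)] C'[OF r(2) xr(2)] unfolding xr(1)[symmetric] by (rule add_mono)
    finally have "(cmod (u x - u' x))\<^sup>2 \<le> ((C + C') * r powr (- (real CARD('n) / 2)))\<^sup>2"
      by (intro power_mono) (auto simp: distrib_right)
    also have "\<dots> = (C + C')\<^sup>2 * (r powr (- (real CARD('n) / 2)) * r powr (- (real CARD('n) / 2)))"
      by (simp only: power_mult_distrib power2_eq_square[of "r powr _"])
    also have "\<dots> = (C + C')\<^sup>2 * r powr (- real CARD('n))" unfolding powr_add[symmetric] by simp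
    finally have "r ^ CARD('n) * (cmod (u x - u' x))\<^sup>2 \<le> r ^ CARD('n) * ((C + C')\<^sup>2 * r powr (- real CARD('n)))"
      using r(3) by (intro mult_left_mono) auto
    also have "\<dots> = (C + C')\<^sup>2" using r(3) by (simp add: powr_minus powr_realpow field_simps)
    finally show ?thesis by (simp add: r_def)
  qed
  then show ?thesis by (rule that)
qed

text \<open>Symmetric in the two scattering problems, so that it can be interpreted again with the
  roles exchanged.\<close>

locale equal_far_fields =
  fixes k :: real and P P' S S' :: "(real^'n::finite) set" and \<phi> \<phi>' ui u u' A A' :: "real^'n \<Rightarrow> complex" and B B' :: real
  assumes k: "k > 0" and dim: "CARD('n) \<ge> 2"
    and S: "finite S" "P = interior (convex hull S)" "P \<noteq> {}"
    and S': "finite S'" "P' = interior (convex hull S')" "P' \<noteq> {}"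
    and \<phi>: "\<phi> \<in> borel_measurable lebesgue" "AE x in lebesgue. cmod (\<phi> x) \<le> B"
    and \<phi>': "\<phi>' \<in> borel_measurable lebesgue" "AE x in lebesgue. cmod (\<phi>' x) \<le> B'"
    and u: "total_wave k (potential P \<phi>) ui u"
    and u': "total_wave k (potential P' \<phi>') ui u'"
    and A: "far_field k ui u A" and A': "far_field k ui u' A'"
    and same: "\<forall>xh::real^'n. norm xh = 1 \<longrightarrow> A xh = A' xh"
begin

abbreviation "Q \<equiv> convex hull (S \<union> S')"

definition w :: "real^'n \<Rightarrow> complex" where "w x = u x - u' x"

text \<open>The term with \<open>w\<close> is counted as source, which leaves the pure Laplacian on
  the other side; it is harmless at a vertex of Q, where the continuous \<open>w\<close>
  vanishes.\<close>

definition f :: "real^'n \<Rightarrow> complex" where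
  "f x = - complex_of_real (k\<^sup>2) * (w x + potential P \<phi> x * u x - potential P' \<phi>' x * u' x)"

lemma hulls: "P \<subseteq> convex hull S" "P' \<subseteq> convex hull S'" "convex hull S \<subseteq> Q" "convex hull S' \<subseteq> Q"
  using S(2) S'(2) interior_subset by (auto intro!: hull_mono)

lemma outside: "x \<notin> Q \<Longrightarrow> x \<notin> P" "x \<notin> Q \<Longrightarrow> x \<notin> P'"
  by (meson hulls subsetD)+

lemma opens: "open P" "open P'"
  using S(2) S'(2) by auto

lemma continuous: "continuous_on UNIV u" "continuous_on UNIV u'" "continuous_on UNIV w"
  using u u' unfolding w_def[abs_def] by (auto simp: total_wave_def intro!: continuous_intros)

lemma f_measurable: "f \<in> borel_measurable lebesgue"
  unfolding f_def[abs_def]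
  by (intro borel_measurable_times borel_measurable_add borel_measurable_diff borel_measurable_const
      potential_measurable opens \<phi>(1) \<phi>'(1) continuous_lebesgue_measurable continuous)

lemma f_integrable: "set_integrable lebesgue (cball v r) f"
proof -
  have I: "integrable lebesgue (\<lambda>x. indicator (cball v r) x *\<^sub>R g x)" if "continuous_on UNIV g" for g :: "real^'n \<Rightarrow> complex"
  proof -
    have "integrable lborel (\<lambda>x. indicator (cball v r) x *\<^sub>R g x)"
      by (rule borel_integrable_compact) (use that in \<open>auto intro: continuous_on_subset\<close>)
    then show ?thesis by (simp add: integrable_completion borel_measurable_integrable)
  qed
  have "indicator (cball v r) x *\<^sub>R f x = - complex_of_real (k\<^sup>2) * (indicator (cball v r) x *\<^sub>R w x
      + potential P \<phi> x * (indicator (cball v r) x *\<^sub>R u x) - potential P' \<phi>' x * (indicator (cball v r) x *\<^sub>R u' x))" for x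
    by (auto simp: f_def indicator_def)
  then show ?thesis unfolding set_integrable_def
    by (simp only:) (intro integrable_mult_right Bochner_Integration.integrable_add Bochner_Integration.integrable_diff
        potential_mult_integrable[OF opens(1) \<phi>] potential_mult_integrable[OF opens(2) \<phi>'] I continuous)
qed

text \<open>The two weak equations are subtracted. The factor \<open>c\<close> and the real part
  produce the real functions that the exterior and the corner results treat.\<close>

lemma weak_difference:
  assumes F: "smooth F" "\<And>z. (F has_derivative (\<lambda>v. F1 z \<bullet> v)) (at z)"
      "\<And>z i. ((\<lambda>z. F1 z $ i) has_derivative (\<lambda>v. F2 z $ i \<bullet> v)) (at z)" "\<And>z. z \<notin> cball a r \<Longrightarrow> F z = 0"
  shows "(LINT x|lebesgue. Re (c * w x) * (\<Sum>i\<in>UNIV. F2 x $ i $ i)) = (LINT x|lebesgue. Re (c * f x) * F x)"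
    "integrable lebesgue (\<lambda>x. Re (c * w x) * (\<Sum>i\<in>UNIV. F2 x $ i $ i))"
    "integrable lebesgue (\<lambda>x. Re (c * f x) * F x)"
proof -
  define E where "E x = (\<Sum>i\<in>UNIV. F2 x $ i $ i)" for x
  note T = total_wave_real_test[OF opens(1) \<phi> u F, folded E_def]
  note T' = total_wave_real_test[OF opens(2) \<phi>' u' F, folded E_def]
  have w: "w x * complex_of_real (E x) = u x * complex_of_real (E x) - u' x * complex_of_real (E x)" for x
    by (simp add: w_def algebra_simps)
  have f: "f x * complex_of_real (F x) = complex_of_real (k\<^sup>2) * (u' x + potential P' \<phi>' x * u' x) * complex_of_real (F x)
      - complex_of_real (k\<^sup>2) * (u x + potential P \<phi> x * u x) * complex_of_real (F x)" for x
    by (simp add: f_def w_def algebra_simps)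
  have L: "bounded_linear (\<lambda>z. Re (c * z))"
    by (rule bounded_linear_compose[OF bounded_linear_Re bounded_linear_mult_right])
  have Iw: "integrable lebesgue (\<lambda>x. w x * complex_of_real (E x))"
    unfolding w by (rule Bochner_Integration.integrable_diff[OF T(1) T'(1)])
  have If: "integrable lebesgue (\<lambda>x. f x * complex_of_real (F x))"
    unfolding f by (rule Bochner_Integration.integrable_diff[OF T'(2) T(2)])
  have "(LINT x|lebesgue. w x * complex_of_real (E x))
      = (LINT x|lebesgue. u x * complex_of_real (E x)) - (LINT x|lebesgue. u' x * complex_of_real (E x))"
    unfolding w by (rule Bochner_Integration.integral_diff[OF T(1) T'(1)])
  moreover have "(LINT x|lebesgue. f x * complex_of_real (F x))
      = (LINT x|lebesgue. complex_of_real (k\<^sup>2) * (u' x + potential P' \<phi>' x * u' x) * complex_of_real (F x))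
      - (LINT x|lebesgue. complex_of_real (k\<^sup>2) * (u x + potential P \<phi> x * u x) * complex_of_real (F x))"
    unfolding f by (rule Bochner_Integration.integral_diff[OF T'(2) T(2)])
  ultimately have "(LINT x|lebesgue. w x * complex_of_real (E x)) = (LINT x|lebesgue. f x * complex_of_real (F x))"
    by (simp only: T(3) T'(3) diff_minus_eq_add uminus_add_conv_diff)
  then have "(LINT x|lebesgue. Re (c * (w x * complex_of_real (E x)))) = (LINT x|lebesgue. Re (c * (f x * complex_of_real (F x))))"
    unfolding integral_bounded_linear[OF L Iw] integral_bounded_linear[OF L If] by simp
  moreover have R: "Re (c * (z * complex_of_real t)) = Re (c * z) * t" for z t
    by (simp add: algebra_simps)
  ultimately show "(LINT x|lebesgue. Re (c * w x) * (\<Sum>i\<in>UNIV. F2 x $ i $ i)) = (LINT x|lebesgue. Re (c * f x) * F x)"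
    unfolding R E_def by simp
  show "integrable lebesgue (\<lambda>x. Re (c * w x) * (\<Sum>i\<in>UNIV. F2 x $ i $ i))"
    using integrable_bounded_linear[OF L Iw] unfolding R E_def .
  show "integrable lebesgue (\<lambda>x. Re (c * f x) * F x)"
    using integrable_bounded_linear[OF L If] unfolding R .
qed

lemma w_outside:
  assumes x: "x \<notin> Q" shows "w x = 0"
proof -
  \<comment> \<open>With this factor the real part at x is |w(x)|^2, so its vanishing
    suffices.\<close>
  define c where "c = cnj (w x)"
  obtain C R where CR: "\<And>x. norm x \<ge> R \<Longrightarrow> norm x ^ CARD('n) * (cmod (u x - u' x))\<^sup>2 \<le> C"
    by (rule far_field_decay[OF A A' same]) (rule that)
  have "Re (c * w x) = 0"
  proof (rule vanishes_outside_convex_real[where w = "\<lambda>x. Re (c * w x)" and Q = Q and k = k and ?R0.0 = R and C = "(cmod c)\<^sup>2 * C"])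
    show "continuous_on UNIV (\<lambda>x. Re (c * w x))" by (intro continuous_intros continuous)
    show "compact Q" using S(1) S'(1) by (intro finite_imp_compact_convex_hull) auto
    show "Q \<noteq> {}" using S(3) hulls by auto
    show "convex Q" "k > 0" "x \<notin> Q" using k x by auto
    show "norm y ^ CARD('n) * (Re (c * w y))\<^sup>2 \<le> (cmod c)\<^sup>2 * C" if "norm y \<ge> R" for y
    proof -
      have "\<bar>Re (c * w y)\<bar> \<le> cmod c * cmod (w y)" using abs_Re_le_cmod[of "c * w y"] by (simp only: norm_mult)
      then have "(Re (c * w y))\<^sup>2 \<le> (cmod c * cmod (w y))\<^sup>2" by (simp add: abs_le_square_iff[symmetric])
      then have "norm y ^ CARD('n) * (Re (c * w y))\<^sup>2 \<le> norm y ^ CARD('n) * (cmod c * cmod (w y))\<^sup>2"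
        by (intro mult_left_mono) auto
      also have "\<dots> = (cmod c)\<^sup>2 * (norm y ^ CARD('n) * (cmod (w y))\<^sup>2)" by (simp add: power_mult_distrib mult_ac)
      also have "\<dots> \<le> (cmod c)\<^sup>2 * C" using CR[OF that] unfolding w_def by (intro mult_left_mono) auto
      finally show ?thesis .
    qed
    fix x :: "real^'n" and \<delta> :: real
    assume \<delta>: "\<delta> > 0" and disj: "Q \<inter> cball x \<delta> = {}"
    define F where "F y = moll \<delta> 0 (y - x)" for y
    define E where "E y = (\<Sum>i\<in>UNIV. moll2 \<delta> (y - x) $ i $ i)" for y
    have F0: "F y = 0" if "y \<notin> cball x \<delta>" for y
      unfolding F_def using that by (intro moll_outside \<delta>) (simp add: dist_norm norm_minus_commute)
    have smF: "smooth F" unfolding F_def[abs_def] by (rule smooth_translation[OF smooth_moll])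
    have F1: "(F has_derivative (\<lambda>v. moll1 \<delta> (y - x) \<bullet> v)) (at y)" for y
    proof -
      have "(moll \<delta> 0 has_derivative (\<lambda>v. moll1 \<delta> z \<bullet> v)) (at z)" for z :: "real^'n"
        using moll_derivative[of \<delta> 0 z] by (simp add: moll1_def)
      from has_derivative_compose[OF translation_has_derivative this] show ?thesis by (simp add: F_def[abs_def])
    qed
    note W = weak_difference[of F "\<lambda>y. moll1 \<delta> (y - x)" "\<lambda>y. moll2 \<delta> (y - x)" x \<delta> c, folded E_def,
        OF smF F1 has_derivative_compose[OF translation_has_derivative moll1_derivative] F0]
    have fF: "Re (c * f y) * F y = - (k\<^sup>2 * (Re (c * w y) * F y))" for y
    proof (cases "y \<in> cball x \<delta>")
      case True
      then have "y \<notin> Q" using disj by blast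
      then have "y \<notin> P" "y \<notin> P'" by (rule outside)+
      then have "c * f y = - (k\<^sup>2) *\<^sub>R (c * w y)" by (simp add: f_def potential_def scaleR_conv_of_real)
      then have "Re (c * f y) = - k\<^sup>2 * Re (c * w y)" by simp
      then show ?thesis by simp
    next
      case False
      then show ?thesis using F0 by simp
    qed
    have "(LINT y|lebesgue. Re (c * w y) * E y - Re (c * f y) * F y) = 0"
      using W(1) Bochner_Integration.integral_diff[OF W(2,3)] by simp
    moreover have "Re (c * w y) * E y - Re (c * f y) * F y = Re (c * w y) * (E y + k\<^sup>2 * F y)" for y
      unfolding fF by (simp only: distrib_left mult_ac minus_minus diff_minus_eq_add)
    ultimately have "(LINT y|lebesgue. Re (c * w y) * (E y + k\<^sup>2 * F y)) = 0" by (simp only:)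
    moreover have "continuous_on UNIV (\<lambda>y. Re (c * w y) * (E y + k\<^sup>2 * F y))"
    proof -
      have m2: "continuous_on UNIV (\<lambda>y. moll2 \<delta> (y - x) $ i $ i)" for i
        by (intro continuous_on_component continuous_on_compose2[OF continuous_moll(3)] continuous_intros) auto
      have "continuous_on UNIV E" unfolding E_def[abs_def] by (intro continuous_on_sum m2)
      then show ?thesis by (intro continuous_intros continuous smooth_continuous[OF smF])
    qed
    ultimately have "(LINT y|lborel. Re (c * w y) * (E y + k\<^sup>2 * F y)) = 0"
      by (subst integral_completion[symmetric]) (simp_all add: borel_measurable_continuous_onI)
    then show "(\<integral>y. Re (c * w y) * ((\<Sum>i\<in>UNIV. moll2 \<delta> (y - x) $ i $ i) + k\<^sup>2 * moll \<delta> 0 (y - x)) \<partial>lborel) = 0"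
      by (simp only: E_def F_def)
  qed
  moreover have "c * w x = complex_of_real ((cmod (w x))\<^sup>2)" unfolding c_def by (simp only: complex_norm_square mult.commute)
  ultimately show ?thesis by simp
qed

lemma f_outside:
  assumes "x \<notin> Q" shows "f x = 0"
proof -
  have "x \<notin> P" "x \<notin> P'" using assms by (rule outside)+
  then show ?thesis using w_outside[OF assms] by (simp add: f_def potential_def)
qed

text \<open>A nonzero value would persist near v, and that neighborhood would lie in Q by
  \<open>w_outside\<close>; but an extreme point is not interior.\<close>

lemma w_extreme:
  assumes v: "v extreme_point_of Q" shows "w v = 0"
proof (rule ccontr)
  assume "w v \<noteq> 0"
  then have "open {x. w x \<noteq> 0}" "v \<in> {x. w x \<noteq> 0}"
    using open_Collect_neq[OF continuous(3) continuous_on_const, of 0] by auto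
  moreover have "{x. w x \<noteq> 0} \<subseteq> Q" using w_outside by blast
  ultimately have "v \<in> interior Q" by (meson interior_maximal subsetD)
  then show False using extreme_point_not_in_interior[OF v] by blast
qed

text \<open>\<open>b\<close> is the value of the second potential on P near v. Two cases occur: 0
  where the second cell is absent, and the value of \<open>\<phi>'\<close> where the cells coincide.
  In both, f minus \<open>F0\<close> times the indicator of P tends to 0 at v, so that the corner
  result forces \<open>F0\<close> = 0.\<close>

lemma vertex_balance:
  assumes v: "v extreme_point_of Q" "v extreme_point_of (convex hull S)"
    and c: "isCont \<phi> v" and V': "((\<lambda>z. potential P' \<phi>' z - b * indicator P z) \<longlongrightarrow> 0) (nhds v)"
  shows "\<phi> v * u v = b * u' v"
proof -
  define F0 where "F0 = - complex_of_real (k\<^sup>2) * (\<phi> v * u v - b * u' v)"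
  have lim: "((\<lambda>z. f z - F0 * indicator P z) \<longlongrightarrow> 0) (nhds v)"
  proof -
    have at: "(g \<longlongrightarrow> g v) (nhds v)" if "isCont g v" for g :: "real^'n \<Rightarrow> complex"
      using that by (simp add: continuous_within tendsto_at_iff_tendsto_nhds)
    have cu: "isCont u v" "isCont u' v" "isCont w v" using continuous by (auto simp: continuous_on_eq_continuous_at)
    have null: "((\<lambda>z. indicator P z * (g z - g v)) \<longlongrightarrow> 0) (nhds v)" if "isCont g v" for g :: "real^'n \<Rightarrow> complex"
    proof (rule Lim_null_comparison)
      show "\<forall>\<^sub>F z in nhds v. norm (indicator P z * (g z - g v)) \<le> norm (g z - g v)"
        by (intro always_eventually) (simp add: indicator_def)
      show "((\<lambda>z. norm (g z - g v)) \<longlongrightarrow> 0) (nhds v)" using at[OF that]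
        by (intro tendsto_norm_zero) (simp add: LIM_zero_iff)
    qed
    \<comment> \<open>Rearranged so that each term is visibly null at v: \<open>w\<close>,
      differences from values at v restricted to P, and the assumed limit times a continuous
      function.\<close>
    have "((\<lambda>z. - complex_of_real (k\<^sup>2) * (w z + indicator P z * (\<phi> z * u z - \<phi> v * u v)
        - ((potential P' \<phi>' z - b * indicator P z) * u' z + b * (indicator P z * (u' z - u' v))))) \<longlongrightarrow>
        - complex_of_real (k\<^sup>2) * (0 + 0 - (0 * u' v + b * 0))) (nhds v)"
      using at[OF cu(3)] w_extreme[OF v(1)]
      by (intro tendsto_intros null V' at cu continuous_mult c) auto
    moreover have "- complex_of_real (k\<^sup>2) * (w z + indicator P z * (\<phi> z * u z - \<phi> v * u v)
        - ((potential P' \<phi>' z - b * indicator P z) * u' z + b * (indicator P z * (u' z - u' v))))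
        = f z - F0 * indicator P z" for z
      by (simp add: f_def F0_def potential_def algebra_simps)
    ultimately show ?thesis by simp
  qed
  \<comment> \<open>Multiplication by the conjugate of \<open>F0\<close> turns the limit into |F0|^2
    and makes the real corner result applicable.\<close>
  have "Re (cnj F0 * F0) = 0"
  proof (rule corner_vanishing_real[OF dim S v(2) _ v(1), where w = "\<lambda>x. Re (cnj F0 * w x)" and f = "\<lambda>x. Re (cnj F0 * f x)"])
    show "finite (S \<union> S')" using S(1) S'(1) by simp
    show "P \<subseteq> Q" using hulls by blast
    show "continuous_on UNIV (\<lambda>x. Re (cnj F0 * w x))" by (intro continuous_intros continuous)
    show "Re (cnj F0 * w z) = 0" "Re (cnj F0 * f z) = 0" if "z \<notin> Q" for z
      using w_outside[OF that] f_outside[OF that] by simp_all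
    show "(\<lambda>x. Re (cnj F0 * f x)) \<in> borel_measurable lebesgue"
      using f_measurable by measurable
    show "set_integrable lebesgue (cball v r) (\<lambda>x. Re (cnj F0 * f x))" for r
    proof -
      have "bounded_linear (\<lambda>z. Re (cnj F0 * z))"
        by (rule bounded_linear_compose[OF bounded_linear_Re bounded_linear_mult_right])
      from integrable_bounded_linear[OF this f_integrable[unfolded set_integrable_def]]
      show ?thesis unfolding set_integrable_def by (simp add: algebra_simps)
    qed
    show "\<exists>r>0. \<forall>z. dist z v < r \<longrightarrow> \<bar>Re (cnj F0 * f z) - Re (cnj F0 * F0) * indicator P z\<bar> \<le> \<nu>" if \<nu>: "\<nu> > 0" for \<nu>
    proof -
      have "((\<lambda>z. Re (cnj F0 * (f z - F0 * indicator P z))) \<longlongrightarrow> Re (cnj F0 * 0)) (nhds v)"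
        by (intro tendsto_intros lim)
      then have "\<forall>\<^sub>F z in nhds v. dist (Re (cnj F0 * (f z - F0 * indicator P z))) 0 < \<nu>"
        using \<nu> by (intro tendstoD) auto
      then obtain r where r: "r > 0" "\<And>z. dist z v < r \<Longrightarrow> \<bar>Re (cnj F0 * (f z - F0 * indicator P z))\<bar> < \<nu>"
        unfolding eventually_nhds_metric by auto
      moreover have "Re (cnj F0 * (f z - F0 * indicator P z)) = Re (cnj F0 * f z) - Re (cnj F0 * F0) * indicator P z" for z
        by (simp add: indicator_def right_diff_distrib)
      ultimately show ?thesis by (intro exI[of _ r]) (metis less_imp_le)
    qed
  qed (rule weak_difference(1))
  moreover have "cnj F0 * F0 = complex_of_real ((cmod F0)\<^sup>2)" by (simp only: complex_norm_square mult.commute)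
  ultimately have "F0 = 0" by simp
  then show ?thesis using k by (simp add: F0_def)
qed

lemma extreme_point_of_part:
  assumes "v extreme_point_of Q" "v \<in> convex hull S"
  shows "v extreme_point_of (convex hull S)"
  using assms hulls(3) unfolding extreme_point_of_def by blast

text \<open>Off the second closed cell its potential vanishes near v, and
  \<open>vertex_balance\<close> with b = 0 gives u(v) = 0. As w(v) = 0, also u'(v) = 0, which
  \<open>nz\<close> excludes.\<close>

lemma corner_not_hidden:
  assumes v: "v extreme_point_of Q" "v \<in> convex hull S"
    and c: "isCont \<phi> v" and nz: "\<phi> v \<noteq> 0" "u v \<noteq> 0 \<or> u' v \<noteq> 0"
  shows "v \<in> convex hull S'"
proof (rule ccontr)
  assume "v \<notin> convex hull S'"
  moreover have "open (- (convex hull S'))"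
    using finite_imp_compact_convex_hull[OF S'(1)] by (simp add: compact_imp_closed open_Compl)
  ultimately have "\<forall>\<^sub>F z in nhds v. z \<in> - (convex hull S')" by (intro eventually_nhds_in_open) auto
  then have "\<forall>\<^sub>F z in nhds v. potential P' \<phi>' z - 0 * indicator P z = 0"
    by eventually_elim (use hulls(2) in \<open>auto simp: potential_def indicator_def\<close>)
  then have "((\<lambda>z. potential P' \<phi>' z - 0 * indicator P z) \<longlongrightarrow> 0) (nhds v)" by (rule tendsto_eventually)
  from vertex_balance[OF v(1) extreme_point_of_part[OF v] c this] have "u v = 0" using nz(1) by simp
  moreover have "u v = u' v" using w_extreme[OF v(1)] by (simp add: w_def)
  ultimately show False using nz(2) by simp
qed

text \<open>Equal cells have equal closures, so Q is that closure and v is extreme in it.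
  \<open>vertex_balance\<close> with b = \<open>\<phi>' v\<close> then leaves a common nonzero value
  of u and u' to cancel.\<close>

lemma vertex_values_agree:
  assumes eq: "P = P'" and v: "v extreme_point_of (convex hull S)"
    and c: "isCont \<phi> v" "isCont \<phi>' v" and nz: "u v \<noteq> 0 \<or> u' v \<noteq> 0"
  shows "\<phi> v = \<phi>' v"
proof -
  have hull: "convex hull S' = convex hull S"
    using interior_polytope(3)[OF S] interior_polytope(3)[OF S'] eq by simp
  have "S \<union> S' \<subseteq> convex hull S" using hull hull_subset[of S convex] hull_subset[of S' convex] by auto
  then have "Q \<subseteq> convex hull S" by (intro hull_minimal convex_convex_hull)
  then have Q: "Q = convex hull S" using hulls(3) by blast
  have "((\<lambda>z. \<phi>' z - \<phi>' v) \<longlongrightarrow> 0) (nhds v)"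
    using c(2) by (simp add: continuous_within tendsto_at_iff_tendsto_nhds LIM_zero_iff)
  then have "((\<lambda>z. potential P' \<phi>' z - \<phi>' v * indicator P z) \<longlongrightarrow> 0) (nhds v)"
    by (rule Lim_null_comparison[rotated, OF tendsto_norm_zero])
      (simp add: potential_def eq indicator_def)
  with vertex_balance[of v "\<phi>' v"] v c(1) have "\<phi> v * u v = \<phi>' v * u' v" by (simp add: Q)
  moreover have "u v = u' v" using w_extreme[of v] v by (simp add: w_def Q)
  ultimately show ?thesis using nz by auto
qed

end

text \<open>The Holder modulus tends to 0 at v; continuity is the form in which the corner argument
  uses it.\<close>

lemma admissible_potential_isCont:
  assumes "admissible_potential P \<phi>" "v \<in> vertices P"
  shows "isCont \<phi> v"
proof -
  obtain \<alpha> \<delta> C where h: "\<alpha> > 0" "\<delta> > 0" "\<forall>x\<in>ball v \<delta>. \<forall>y\<in>ball v \<delta>. cmod (\<phi> x - \<phi> y) \<le> C * dist x y powr \<alpha>"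
    using assms unfolding admissible_potential_def by blast
  have "\<forall>\<^sub>F x in at v. x \<in> ball v \<delta>" using h(2) by (intro eventually_at_in_open') auto
  then have le: "\<forall>\<^sub>F x in at v. norm (\<phi> x - \<phi> v) \<le> C * dist x v powr \<alpha>"
    by eventually_elim (use h in auto)
  have "((\<lambda>x. C * dist x v powr \<alpha>) \<longlongrightarrow> C * 0) (at v)"
  proof (intro tendsto_mult_left tendsto_zero_powrI)
    have "((\<lambda>x. dist x v) \<longlongrightarrow> dist v v) (at v)" by (intro tendsto_intros)
    then show "((\<lambda>x. dist x v) \<longlongrightarrow> 0) (at v)" by simp
  qed (use h in auto)
  then have "((\<lambda>x. \<phi> x - \<phi> v) \<longlongrightarrow> 0) (at v)"
    unfolding mult_zero_right by (rule Lim_null_comparison[OF le])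
  then show ?thesis by (simp add: isCont_def LIM_zero_iff)
qed

theorem theorem2p5:
  fixes k :: real
    and P P' :: "(real^'n::finite) set"
    and \<phi> \<phi>' ui u u' A A' :: "real^'n \<Rightarrow> complex"
  assumes dim: "CARD('n) = 2 \<or> CARD('n) = 3"
    and k: "k > 0"
    and V: "admissible_potential P \<phi>"
    and V': "admissible_potential P' \<phi>'"
    and ui: "entire_helmholtz k ui"
    and u: "total_wave k (potential P \<phi>) ui u"
    and u': "total_wave k (potential P' \<phi>') ui u'"
    and vert: "\<forall>xc \<in> vertices P \<union> vertices P'. u xc \<noteq> 0 \<or> u' xc \<noteq> 0"
    and A: "far_field k ui u A"
    and A': "far_field k ui u' A'"
    and same: "\<forall>xh::real^'n. norm xh = 1 \<longrightarrow> A xh = A' xh"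
  shows "P = P' \<and> (\<forall>xc \<in> vertices P. \<phi> xc = \<phi>' xc)"
proof -
  obtain S where S: "finite S" "P = interior (convex hull S)" "P \<noteq> {}"
    using V unfolding admissible_potential_def admissible_cell_def by blast
  obtain S' where S': "finite S'" "P' = interior (convex hull S')" "P' \<noteq> {}"
    using V' unfolding admissible_potential_def admissible_cell_def by blast
  obtain B where \<phi>: "\<phi> \<in> borel_measurable lebesgue" "AE x in lebesgue. cmod (\<phi> x) \<le> B"
    using V unfolding admissible_potential_def by blast
  obtain B' where \<phi>': "\<phi>' \<in> borel_measurable lebesgue" "AE x in lebesgue. cmod (\<phi>' x) \<le> B'"
    using V' unfolding admissible_potential_def by blast
  have vP: "v \<in> vertices P \<longleftrightarrow> v extreme_point_of (convex hull S)" for v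
    by (simp add: vertices_def interior_polytope(3)[OF S])
  have vP': "v \<in> vertices P' \<longleftrightarrow> v extreme_point_of (convex hull S')" for v
    by (simp add: vertices_def interior_polytope(3)[OF S'])
  \<comment> \<open>Both orders are needed, since an extreme point of Q may come from either
    cell.\<close>
  interpret X: equal_far_fields k P P' S S' \<phi> \<phi>' ui u u' A A' B B'
    by unfold_locales (use dim k S S' \<phi> \<phi>' u u' A A' same in auto)
  interpret Y: equal_far_fields k P' P S' S \<phi>' \<phi> ui u' u A' A B' B
    by unfold_locales (use dim k S S' \<phi> \<phi>' u u' A A' same in auto)
  \<comment> \<open>An extreme point of Q is a generator of one hull; the matching interpretation
    puts it into the other hull as well.\<close>
  have both: "v \<in> convex hull S \<inter> convex hull S'" if v: "v extreme_point_of X.Q" for v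
  proof -
    have v': "v extreme_point_of Y.Q" by (subst Un_commute) (rule v)
    have X: "v \<in> convex hull S'" if "v \<in> convex hull S"
    proof -
      have "v \<in> vertices P" using X.extreme_point_of_part[OF v that] vP by simp
      then show ?thesis
        using X.corner_not_hidden[OF v that admissible_potential_isCont[OF V]] V vert
        by (auto simp: admissible_potential_def)
    qed
    have Y: "v \<in> convex hull S" if "v \<in> convex hull S'"
    proof -
      have "v \<in> vertices P'" using Y.extreme_point_of_part[OF v' that] vP' by simp
      then show ?thesis
        using Y.corner_not_hidden[OF v' that admissible_potential_isCont[OF V']] V' vert
        by (auto simp: admissible_potential_def)
    qed
    have "v \<in> S \<union> S'" by (rule extreme_point_of_convex_hull[OF v])
    then show ?thesis using X Y hull_inc[of v S convex] hull_inc[of v S' convex] by blast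
  qed
  \<comment> \<open>By Minkowski's theorem Q is the hull of its extreme points, hence contained in
    both closed cells, and so equal to each of them.\<close>
  have "X.Q = convex hull {v. v extreme_point_of X.Q}"
    using S(1) S'(1) by (intro Krein_Milman_Minkowski finite_imp_compact_convex_hull) auto
  also have "\<dots> \<subseteq> convex hull S \<inter> convex hull S'"
    using both by (intro hull_minimal convex_Int convex_convex_hull) auto
  finally have "convex hull S = convex hull S'" using X.hulls(3,4) by blast
  then have eq: "P = P'" using S(2) S'(2) by simp
  moreover have "\<phi> v = \<phi>' v" if v: "v \<in> vertices P" for v
    using X.vertex_values_agree[OF eq, of v] v vP admissible_potential_isCont[OF V v]
      admissible_potential_isCont[OF V', of v] vert eq by auto
  ultimately show ?thesis by blast
qed

end
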